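(* Consider $N$ spin-$s$ qudits and the code space $$\mathfrak{C}=\mathrm{span}\{|J,M\rangle:\ M=M_{\min},\,M_{\min}+\Delta,\,M_{\min}+2\Delta,\dots,M_{\max}\},$$ where $J\sim N^a$, $M_{\max}-M_{\min}\sim N^b$, and $b<a\le 1$. If $\Delta\ge 2sd+1$, then $\mathfrak{C}$ forms a $(\!(N,O[b\log_2 N])\!)$ approximate quantum error-correcting code against $d$-local noise on known sites, i.e. against any noise channel $\mathcal{N}(\rho)=\sum_{j=1}^{n_d}K_j\rho K_j^\dagger$ whose Kraus operators $K_j$ are at most $d$-local and all act on one fixed set of $d$ qudits, with $n_d=(2s+1)^{2d}$ the number of independent Kraus operators, and its inaccuracy is $$\epsilon(d)=O\!\left[\sqrt{d}\,(2s+1)^{d}\,N^{-(a-b)/2}\right].$$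
   Context: System: $N$ spin-$s$ degrees of freedom (qudits of dimension $2s+1$, with $s$ an integer or half-integer) with local spin operators $\hat q_j^z,\hat q_j^\pm$ satisfying $[\hat q_j^+,\hat q_j^-]=2\hat q_j^z$, $[\hat q_j^z,\hat q_j^\pm]=\pm\hat q_j^\pm$ (spin-$s$ irreducible representation on each site), and total operators $\hat Q^z=\sum_j\hat q_j^z$, $\hat Q^\pm=\sum_j\hat q_j^\pm$. For a total spin $J\le sN$, $\{|J,M\rangle\}_{M=-J}^{J}$ denotes any family of orthonormal states satisfying $\hat Q^z|J,M\rangle=M|J,M\rangle$ and $\hat Q^\pm|J,M\rangle=c_M^\pm|J,M\pm1\rangle$ with $c_M^\pm=\sqrt{(J\mp M)(J\pm M+1)}$ (a spin-$J$ irrep, possibly chosen among or superposed over several copies of it; the same choice for all $M$). $M_{\min}$ and $M_{\max}$ are magnetic quantum numbers of this irrep. An operator is $d$-local if it acts nontrivially on at most $d$ qudits. $X\sim Y$ denotes scaling $X=\Theta(Y)$ as $N\to\infty$, and $O(\cdot)$ refers to the same limit. $(\!(N,k)\!)$ denotes a code on $N$ qudits with $k$ logical qubits, i.e. a code space of dimension $2^k$; here $k=\log_2\big(\tfrac{M_{\max}-M_{\min}}{\Delta}+1\big)$. Let $V$ be an isometry from a $2^k$-dimensional logical space $L$ onto $\mathfrak C$. The code inaccuracy against a noise channel $\mathcal N$ is $\epsilon(\mathcal N)=\min_{\mathcal R}D_P\big(\mathcal R\circ\mathcal N\circ\mathcal V,\mathrm{id}_L\big)$, where $\mathcal V(\cdot)=V(\cdot)V^\dagger$,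 the minimum is over quantum (recovery) channels $\mathcal R$ to $L$, and the purified distance of channels $\mathcal E,\mathcal F$ on $L$ is $D_P(\mathcal E,\mathcal F)=\max_{|\psi\rangle}\sqrt{1-f^2\big[(\mathcal E\otimes\mathrm{id})(|\psi\rangle\langle\psi|),(\mathcal F\otimes\mathrm{id})(|\psi\rangle\langle\psi|)\big]}$, with $|\psi\rangle$ ranging over unit vectors of $L\otimes L$ and $f(\rho,\sigma)=\mathrm{Tr}\sqrt{\sqrt\rho\,\sigma\sqrt\rho}$. One writes $\epsilon(d)$ for $\epsilon(\mathcal N)$ when $\mathcal N$ is noise on at most $d$ sites.
   Formalization: The bound k = O(b log2 N) is proved for b > 0; for b = 0, where it would read k = 0 but k >= 1 always holds (e.g. two code words at fixed spacing Delta), k = O(1) is proved instead. *)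

theory Defs
  imports
    "HOL-Library.FuncSet"
    "HOL-Library.Landau_Symbols"
    "Jordan_Normal_Form.Schur_Decomposition"
    "Jordan_Normal_Form.VS_Connect"
begin

section \<open>Qudits and spin operators\<close>

definition qudit_dim :: "real \<Rightarrow> nat" where
  "qudit_dim s = nat \<lfloor>2 * s\<rfloor> + 1"

text \<open>
  The space of \<open>N\<close> qudits of dimension \<open>n\<close> is \<open>carrier_vec (n ^ N)\<close>. The computational basis
  vector with index \<open>x < n ^ N\<close> is the product vector whose factor on site \<open>j < N\<close> is the basis
  vector with index \<open>site_index n j x < n\<close>, the \<open>j\<close>-th digit of \<open>x\<close> in base \<open>n\<close>.
\<close>

definition site_index :: "nat \<Rightarrow> nat \<Rightarrow> nat \<Rightarrow> nat" where
  "site_index n j x = (x div n ^ j) mod n"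

text \<open>
  The operator \<open>A \<otimes> 1\<close> with \<open>A\<close> on the sites in \<open>S\<close>, where \<open>A\<close> is given by its matrix elements
  between the configurations \<open>S \<rightarrow> {..<n}\<close>.
\<close>

definition embed_op ::
  "nat \<Rightarrow> nat \<Rightarrow> nat set \<Rightarrow> ((nat \<Rightarrow> nat) \<Rightarrow> (nat \<Rightarrow> nat) \<Rightarrow> complex) \<Rightarrow> complex mat" where
  "embed_op n N S A = mat (n ^ N) (n ^ N) (\<lambda>(x, y).
     if \<forall>j\<in>{..<N} - S. site_index n j x = site_index n j y
     then A (\<lambda>j\<in>S. site_index n j x) (\<lambda>j\<in>S. site_index n j y) else 0)"

definition acts_on_sites :: "nat \<Rightarrow> nat \<Rightarrow> nat set \<Rightarrow> complex mat \<Rightarrow> bool" where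
  "acts_on_sites n N S X \<longleftrightarrow> (\<exists>A. X = embed_op n N S A)"

definition ladder_plus :: "real \<Rightarrow> real \<Rightarrow> real" where
  "ladder_plus J M = sqrt ((J - M) * (J + M + 1))"

definition ladder_minus :: "real \<Rightarrow> real \<Rightarrow> real" where
  "ladder_minus J M = sqrt ((J + M) * (J - M + 1))"

text \<open>
  The spin-\<open>s\<close> irreducible representation in the eigenbasis of its \<open>z\<close>-component: the basis
  vector with index \<open>i \<le> 2 * s\<close> has magnetic quantum number \<open>i - s\<close>.
\<close>

definition spin_z :: "real \<Rightarrow> complex mat" where
  "spin_z s = mat (qudit_dim s) (qudit_dim s)
     (\<lambda>(i, j). if i = j then complex_of_real (real j - s) else 0)"

definition spin_plus :: "real \<Rightarrow> complex mat" where
  "spin_plus s = mat (qudit_dim s) (qudit_dim s)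
     (\<lambda>(i, j). if i = j + 1 then complex_of_real (ladder_plus s (real j - s)) else 0)"

definition spin_minus :: "real \<Rightarrow> complex mat" where
  "spin_minus s = mat (qudit_dim s) (qudit_dim s)
     (\<lambda>(i, j). if i + 1 = j then complex_of_real (ladder_minus s (real j - s)) else 0)"

text \<open>The sum over all sites \<open>j < N\<close> of the single-site operator \<open>q\<close> acting on site \<open>j\<close>.\<close>

definition total_op :: "nat \<Rightarrow> nat \<Rightarrow> complex mat \<Rightarrow> complex mat" where
  "total_op n N q = mat (n ^ N) (n ^ N)
     (\<lambda>xy. \<Sum>j<N. embed_op n N {j} (\<lambda>u v. q $$ (u j, v j)) $$ xy)"

definition total_z :: "real \<Rightarrow> nat \<Rightarrow> complex mat" where
  "total_z s N = total_op (qudit_dim s) N (spin_z s)"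

definition total_plus :: "real \<Rightarrow> nat \<Rightarrow> complex mat" where
  "total_plus s N = total_op (qudit_dim s) N (spin_plus s)"

definition total_minus :: "real \<Rightarrow> nat \<Rightarrow> complex mat" where
  "total_minus s N = total_op (qudit_dim s) N (spin_minus s)"

section \<open>Spin multiplets and the code space\<close>

definition magnetic_numbers :: "real \<Rightarrow> real set" where
  "magnetic_numbers J = {M. \<exists>i::nat. M = - J + real i \<and> M \<le> J}"

text \<open>
  \<open>ket M\<close> is the state \<open>|J, M\<rangle>\<close>; it is meaningful only for \<open>M \<in> magnetic_numbers J\<close>. The ladder
  coefficients vanish at \<open>M = J\<close> and \<open>M = - J\<close>, where \<open>|J, M + 1\<rangle>\<close> and \<open>|J, M - 1\<rangle>\<close>
  do not exist.
\<close>

definition spin_multiplet :: "real \<Rightarrow> nat \<Rightarrow> real \<Rightarrow> (real \<Rightarrow> complex vec) \<Rightarrow> bool" where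
  "spin_multiplet s N J ket \<longleftrightarrow>
     (let D = qudit_dim s ^ N in
       2 * J \<in> \<nat> \<and> J \<le> s * real N \<and>
       (\<forall>M\<in>magnetic_numbers J. ket M \<in> carrier_vec D) \<and>
       (\<forall>M\<in>magnetic_numbers J. \<forall>M'\<in>magnetic_numbers J.
          ket M \<bullet>c ket M' = (if M = M' then 1 else 0)) \<and>
       (\<forall>M\<in>magnetic_numbers J.
          total_z s N *\<^sub>v ket M = complex_of_real M \<cdot>\<^sub>v ket M \<and>
          total_plus s N *\<^sub>v ket M =
            (if M = J then 0\<^sub>v D else complex_of_real (ladder_plus J M) \<cdot>\<^sub>v ket (M + 1)) \<and>
          total_minus s N *\<^sub>v ket M =
            (if M = - J then 0\<^sub>v D else complex_of_real (ladder_minus J M) \<cdot>\<^sub>v ket (M - 1))))"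

definition code_labels :: "real \<Rightarrow> real \<Rightarrow> nat \<Rightarrow> real set" where
  "code_labels Mmin Mmax \<Delta> = {M. \<exists>i::nat. M = Mmin + real i * real \<Delta> \<and> M \<le> Mmax}"

definition code_basis :: "(real \<Rightarrow> complex vec) \<Rightarrow> real \<Rightarrow> real \<Rightarrow> nat \<Rightarrow> complex vec set" where
  "code_basis ket Mmin Mmax \<Delta> = ket ` code_labels Mmin Mmax \<Delta>"

abbreviation vec_span :: "nat \<Rightarrow> complex vec set \<Rightarrow> complex vec set" where
  "vec_span D B \<equiv> LinearCombinations.module.span class_ring (module_vec TYPE(complex) D) B"

definition subspace_dim :: "nat \<Rightarrow> complex vec set \<Rightarrow> nat" where
  "subspace_dim D W = vectorspace.dim class_ring ((module_vec TYPE(complex) D)\<lparr>carrier := W\<rparr>)"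

definition code_space ::
  "real \<Rightarrow> nat \<Rightarrow> (real \<Rightarrow> complex vec) \<Rightarrow> real \<Rightarrow> real \<Rightarrow> nat \<Rightarrow> complex vec set" where
  "code_space s N ket Mmin Mmax \<Delta> = vec_span (qudit_dim s ^ N) (code_basis ket Mmin Mmax \<Delta>)"

definition logical_qubits :: "real \<Rightarrow> real \<Rightarrow> nat \<Rightarrow> real" where
  "logical_qubits Mmin Mmax \<Delta> = log 2 ((Mmax - Mmin) / real \<Delta> + 1)"

section \<open>Quantum channels and code inaccuracy\<close>

definition mat_trace :: "complex mat \<Rightarrow> complex" where
  "mat_trace A = (\<Sum>i<dim_row A. A $$ (i, i))"

definition psd :: "complex mat \<Rightarrow> bool" where
  "psd A \<longleftrightarrow> square_mat A \<and> mat_adjoint A = A \<and>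
     (\<forall>v\<in>carrier_vec (dim_row A). Re ((A *\<^sub>v v) \<bullet>c v) \<ge> 0)"

definition psd_sqrt :: "complex mat \<Rightarrow> complex mat" where
  "psd_sqrt A = (THE B. psd B \<and> B * B = A)"

definition fidelity :: "complex mat \<Rightarrow> complex mat \<Rightarrow> real" where
  "fidelity \<rho> \<sigma> = Re (mat_trace (psd_sqrt (psd_sqrt \<rho> * \<sigma> * psd_sqrt \<rho>)))"

definition pure_state :: "complex vec \<Rightarrow> complex mat" where
  "pure_state \<psi> = mat (dim_vec \<psi>) (dim_vec \<psi>) (\<lambda>(i, j). \<psi> $ i * cnj (\<psi> $ j))"

text \<open>
  \<open>E \<otimes> id\<close> for a linear map \<open>E\<close> from \<open>m \<times> m\<close> to \<open>n \<times> n\<close> matrices and the identity on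
  \<open>r \<times> r\<close> matrices. The index of a product basis vector is \<open>i * r + k\<close> with \<open>k < r\<close> for the
  reference system, so that \<open>X\<close> is a sum of terms \<open>X\<^sub>k\<^sub>l \<otimes> |k\<rangle>\<langle>l|\<close>, each sent to
  \<open>E X\<^sub>k\<^sub>l \<otimes> |k\<rangle>\<langle>l|\<close>.
\<close>

definition tensor_id ::
  "nat \<Rightarrow> nat \<Rightarrow> nat \<Rightarrow> (complex mat \<Rightarrow> complex mat) \<Rightarrow> complex mat \<Rightarrow> complex mat" where
  "tensor_id m n r E X = mat (n * r) (n * r) (\<lambda>(p, q).
     E (mat m m (\<lambda>(i, j). X $$ (i * r + p mod r, j * r + q mod r))) $$ (p div r, q div r))"

text \<open>Completely positive, trace-preserving linear maps.\<close>

definition quantum_channel :: "nat \<Rightarrow> nat \<Rightarrow> (complex mat \<Rightarrow> complex mat) \<Rightarrow> bool" where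
  "quantum_channel m n E \<longleftrightarrow>
     (\<forall>X\<in>carrier_mat m m. E X \<in> carrier_mat n n \<and> mat_trace (E X) = mat_trace X) \<and>
     (\<forall>X\<in>carrier_mat m m. \<forall>Y\<in>carrier_mat m m. E (X + Y) = E X + E Y) \<and>
     (\<forall>c. \<forall>X\<in>carrier_mat m m. E (c \<cdot>\<^sub>m X) = c \<cdot>\<^sub>m E X) \<and>
     (\<forall>r. \<forall>X\<in>carrier_mat (m * r) (m * r). psd X \<longrightarrow> psd (tensor_id m n r E X))"

definition kraus_map :: "nat \<Rightarrow> nat \<Rightarrow> (nat \<Rightarrow> complex mat) \<Rightarrow> complex mat \<Rightarrow> complex mat" where
  "kraus_map D nk K \<rho> = mat D D (\<lambda>xy. \<Sum>j=1..nk. (K j * \<rho> * mat_adjoint (K j)) $$ xy)"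

definition encoding_map :: "complex mat \<Rightarrow> complex mat \<Rightarrow> complex mat" where
  "encoding_map V \<rho> = V * \<rho> * mat_adjoint V"

text \<open>The purified distance of two maps on the \<open>m \<times> m\<close> matrices.\<close>

definition purified_distance ::
  "nat \<Rightarrow> (complex mat \<Rightarrow> complex mat) \<Rightarrow> (complex mat \<Rightarrow> complex mat) \<Rightarrow> real" where
  "purified_distance m E F =
     (SUP \<psi>\<in>{\<psi>. \<psi> \<in> carrier_vec (m * m) \<and> \<psi> \<bullet>c \<psi> = 1}.
        sqrt (1 - (fidelity (tensor_id m m m E (pure_state \<psi>))
                            (tensor_id m m m F (pure_state \<psi>)))\<^sup>2))"

text \<open>
  The inaccuracy of the code with encoding isometry \<open>V\<close> from an \<open>m\<close>-dimensional logical space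
  into a \<open>D\<close>-dimensional physical space, against \<open>Noise\<close>. The set of channels is compact, so
  that the infimum over recovery channels is a minimum; likewise for the supremum above.
\<close>

definition code_inaccuracy ::
  "nat \<Rightarrow> nat \<Rightarrow> complex mat \<Rightarrow> (complex mat \<Rightarrow> complex mat) \<Rightarrow> real" where
  "code_inaccuracy m D V Noise =
     (INF Rec\<in>{Rec. quantum_channel D m Rec}.
        purified_distance m (Rec \<circ> Noise \<circ> encoding_map V) (\<lambda>\<rho>. \<rho>))"

definition isometry_onto :: "nat \<Rightarrow> nat \<Rightarrow> complex mat \<Rightarrow> complex vec set \<Rightarrow> bool" where
  "isometry_onto m D V W \<longleftrightarrow> V \<in> carrier_mat D m \<and> mat_adjoint V * V = 1\<^sub>m m \<and>
     (\<lambda>x. V *\<^sub>v x) ` carrier_vec m = W"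

text \<open>
  Noise on a known set \<open>S\<close> of \<open>d\<close> sites, with \<open>(2 * s + 1) ^ (2 * d)\<close> Kraus operators, some of
  which may vanish.
\<close>

definition local_noise ::
  "real \<Rightarrow> nat \<Rightarrow> nat \<Rightarrow> nat set \<Rightarrow> (complex mat \<Rightarrow> complex mat) \<Rightarrow> bool" where
  "local_noise s N d S Noise \<longleftrightarrow> S \<subseteq> {..<N} \<and> card S = d \<and>
     (let D = qudit_dim s ^ N; nd = qudit_dim s ^ (2 * d) in
       quantum_channel D D Noise \<and>
       (\<exists>K. (\<forall>j\<in>{1..nd}. acts_on_sites (qudit_dim s) N S (K j)) \<and>
            Noise = kraus_map D nd K))"

end

theory Submission
  imports Defs "HOL-Library.Function_Algebras" "Jordan_Normal_Form.DL_Rank"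
    "Jordan_Normal_Form.Spectral_Radius"
begin

text \<open>
  For \<open>a\<close> in the state space of the noisy sites \<open>S\<close> let \<open>A = |a\<rangle>\<langle>a|\<close> act on \<open>S\<close>, and let \<open>g M\<close> be the
  expectation value of \<open>A\<close> in \<open>|J, M\<rangle>\<close>. The expectation value of \<open>[[A, Q\<^sup>+], Q\<^sup>-]\<close> is a discrete
  Sturm-Liouville expression in \<open>g\<close> with coefficients \<open>(J - M) * (J + M + 1)\<close>. It is bounded by
  \<open>4 * \<kappa>\<^sup>2\<close> with \<open>\<kappa> = O(d)\<close>, since only the parts of \<open>Q\<^sup>+\<close> and \<open>Q\<^sup>-\<close> on \<open>S\<close> contribute. As the
  coefficients vanish at \<open>M = J\<close> and \<open>M = - J\<close>, summation from the nearer end gives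
  \<open>g (M + 1) - g M = O(\<kappa>\<^sup>2 / J)\<close> for all \<open>M\<close>, edges included. Hence the reduced states \<open>G M\<close> on \<open>S\<close>
  of the code words differ in operator norm by at most \<open>\<delta> = O(d\<^sup>2 * N powr (b - a))\<close>. Since
  \<open>\<Delta>\<close> exceeds \<open>2 * s * d\<close>, operators on \<open>S\<close> have no matrix elements between different code words.

  Let \<open>T M\<close> be the map from \<open>S\<close> to the remaining sites given by \<open>|J, M\<rangle>\<close>, so that
  \<open>G M = (T M)\<^sup>\<dagger> T M\<close>, and let \<open>G = G M\<^sub>0 + \<delta>\<close>, which dominates every \<open>G M\<close>. The recovery discards
  \<open>S\<close> and applies \<open>\<Sum> |M\<rangle> \<otimes> T M\<^sub>0 G\<^sup>-\<^sup>1 (T M)\<^sup>\<dagger>\<close>, a contraction. Its overlap with the ideal recovery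
  is \<open>Tr (G M\<^sub>0 G\<^sup>-\<^sup>1 G M) \<ge> 1 - \<delta> * (2 * s + 1) ^ d\<close>, so the squared inaccuracy is at most
  \<open>2 * \<delta> * (2 * s + 1) ^ d\<close>.
\<close>

section \<open>Positive semidefinite matrices\<close>

text \<open>The expectation value of a single commutator \<open>[A, Q+]\<close> in
  \<open>|J, M>\<close> involves elements of \<open>A\<close> between neighbouring states; the
  double commutator closes on the diagonal values \<open>g M\<close>. The resulting bound holds for
  all rank-one \<open>A\<close> and hence in operator norm. The number of code words therefore never
  enters, and only the dimension \<open>(2 * s + 1) ^ d\<close> of the noisy sites appears, through
  a single trace. Knowing the noisy sites allows the recovery to discard them. Which noise acted
  there then drops out: its Kraus operators are complete already on \<open>S\<close>, so they
  preserve the inner products that measure the recovery. Entangled inputs are no worse than others,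
  because the maps \<open>T M\<close> have orthogonal ranges; the recovered channel is diagonal in
  the code words, and an input enters only through the weights of the code words. The squared
  inaccuracy comes out with the factor \<open>d ^ 2 * (2 * s + 1) ^ d\<close>. The stated rate has
  the square \<open>d * (2 * s + 1) ^ (2 * d)\<close>, which dominates it since \<open>d\<close> is
  at most \<open>(2 * s + 1) ^ d\<close> for \<open>s > 0\<close>.\<close>

abbreviation adj :: "complex mat \<Rightarrow> complex mat" where
  "adj \<equiv> mat_adjoint"

lemma sum_rotate:
  "(\<Sum>a\<in>A. \<Sum>b\<in>B. \<Sum>c\<in>C. f a b c) = (\<Sum>b\<in>B. \<Sum>c\<in>C. \<Sum>a\<in>A. f a b c)"
  by (subst sum.swap) (intro sum.cong refl sum.swap)

section \<open>Adjoints and entrywise formulas\<close>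

lemma mat_adjoint_carrier [simp, intro]:
  "A \<in> carrier_mat n m \<Longrightarrow> adj A \<in> carrier_mat m n"
  by (auto simp: mat_adjoint_def)

lemma mat_adjoint_dim [simp]:
  "dim_row (adj A) = dim_col A" "dim_col (adj A) = dim_row A"
  by (auto simp: mat_adjoint_def)

lemma mat_adjoint_index:
  fixes A :: "complex mat"
  assumes "i < dim_col A" "j < dim_row A"
  shows "adj A $$ (i, j) = cnj (A $$ (j, i))"
  using assms by (simp add: mat_adjoint_def mat_of_rows_def)

lemma mat_adjoint_adjoint [simp]: "adj (adj A) = (A :: complex mat)"
  by (rule eq_matI) (auto simp: mat_adjoint_index)

lemma index_mult_mat_sum:
  assumes "A \<in> carrier_mat n m" "B \<in> carrier_mat m k" "i < n" "j < k"
  shows "(A * B) $$ (i, j) = (\<Sum>l<m. A $$ (i, l) * B $$ (l, j))"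
  using assms by (auto simp: scalar_prod_def lessThan_atLeast0 intro!: sum.cong)

lemma index_mult_mat_vec_sum:
  assumes "A \<in> carrier_mat n m" "v \<in> carrier_vec m" "i < n"
  shows "(A *\<^sub>v v) $ i = (\<Sum>l<m. A $$ (i, l) * v $ l)"
  using assms by (auto simp: scalar_prod_def lessThan_atLeast0 intro!: sum.cong)

lemma cscalar_prod_sum:
  fixes v w :: "complex vec"
  assumes "w \<in> carrier_vec n"
  shows "v \<bullet>c w = (\<Sum>i<n. v $ i * cnj (w $ i))"
  using assms by (auto simp: scalar_prod_def lessThan_atLeast0 intro!: sum.cong)

lemma mat_adjoint_mult:
  fixes A B :: "complex mat"
  assumes "A \<in> carrier_mat n m" "B \<in> carrier_mat m k"
  shows "adj (A * B) = adj B * adj A"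
proof (rule eq_matI)
  have B': "adj B \<in> carrier_mat k m" and A': "adj A \<in> carrier_mat m n"
    using assms by auto
  fix i j
  assume "i < dim_row (adj B * adj A)" "j < dim_col (adj B * adj A)"
  then have ij: "i < k" "j < n" using assms by auto
  have "adj (A * B) $$ (i, j) = cnj ((A * B) $$ (j, i))"
    using assms ij by (subst mat_adjoint_index) auto
  also have "\<dots> = (\<Sum>l<m. cnj (B $$ (l, i)) * cnj (A $$ (j, l)))"
    by (simp add: index_mult_mat_sum[OF assms ij(2,1)] mult.commute)
  also have "\<dots> = (adj B * adj A) $$ (i, j)"
    unfolding index_mult_mat_sum[OF B' A' ij]
    using assms ij by (auto simp: mat_adjoint_index intro!: sum.cong)
  finally show "adj (A * B) $$ (i, j) = (adj B * adj A) $$ (i, j)" .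
qed (use assms in auto)

lemma mat_adjoint_one [simp]: "adj (1\<^sub>m n) = (1\<^sub>m n :: complex mat)"
  by (rule eq_matI) (auto simp: mat_adjoint_index)

lemma hermitian_index:
  fixes A :: "complex mat"
  assumes "adj A = A" "A \<in> carrier_mat n n" "i < n" "j < n"
  shows "A $$ (i, j) = cnj (A $$ (j, i))"
  using mat_adjoint_index[of i A j] assms by simp

lemma hermitianI:
  fixes A :: "complex mat"
  assumes "A \<in> carrier_mat n n" "\<And>i j. i < n \<Longrightarrow> j < n \<Longrightarrow> cnj (A $$ (j, i)) = A $$ (i, j)"
  shows "adj A = A"
  using assms by (intro eq_matI) (auto simp: mat_adjoint_index)

lemma cscalar_prod_mat_adjoint:
  fixes A :: "complex mat"
  assumes "A \<in> carrier_mat n m" "v \<in> carrier_vec m" "w \<in> carrier_vec n"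
  shows "(A *\<^sub>v v) \<bullet>c w = v \<bullet>c (adj A *\<^sub>v w)"
proof -
  have A': "adj A \<in> carrier_mat m n" using assms by auto
  have "(A *\<^sub>v v) \<bullet>c w = (\<Sum>i<n. \<Sum>l<m. A $$ (i, l) * v $ l * cnj (w $ i))"
    by (simp add: cscalar_prod_sum[OF assms(3)] index_mult_mat_vec_sum[OF assms(1,2)]
        sum_distrib_right)
  also have "\<dots> = (\<Sum>l<m. \<Sum>i<n. A $$ (i, l) * v $ l * cnj (w $ i))"
    by (rule sum.swap)
  also have "\<dots> = (\<Sum>l<m. v $ l * cnj ((adj A *\<^sub>v w) $ l))"
    using assms
    by (auto simp: index_mult_mat_vec_sum[OF A' assms(3)] sum_distrib_left mat_adjoint_index
        mult_ac simp del: index_mult_mat_vec intro!: sum.cong)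
  also have "\<dots> = v \<bullet>c (adj A *\<^sub>v w)"
    using mult_mat_vec_carrier[OF A' assms(3)] by (rule cscalar_prod_sum[symmetric])
  finally show ?thesis .
qed

section \<open>Quadratic forms and positivity\<close>

lemma cscalar_prod_self:
  fixes v :: "complex vec"
  assumes "v \<in> carrier_vec n"
  shows "v \<bullet>c v = complex_of_real (\<Sum>i<n. (cmod (v $ i))\<^sup>2)"
  by (simp add: cscalar_prod_sum[OF assms] complex_norm_square flip: of_real_power)

text \<open>Vectors are bare functions, of which only the values below \<open>n\<close> count, so
  that positivity can be tested without carrier conditions.\<close>

definition qform :: "nat \<Rightarrow> complex mat \<Rightarrow> (nat \<Rightarrow> complex) \<Rightarrow> complex" where
  "qform n A f = (\<Sum>i<n. \<Sum>j<n. cnj (f i) * A $$ (i, j) * f j)"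

lemma qform_vec:
  assumes "A \<in> carrier_mat n n" "v \<in> carrier_vec n"
  shows "(A *\<^sub>v v) \<bullet>c v = qform n A (\<lambda>i. v $ i)"
  using assms
  by (auto simp: qform_def cscalar_prod_sum[OF assms(2)] index_mult_mat_vec_sum[OF assms]
      sum_distrib_left mult_ac simp del: index_mult_mat_vec intro!: sum.cong)

lemma psd_iff_qform:
  assumes A: "A \<in> carrier_mat n n"
  shows "psd A \<longleftrightarrow> adj A = A \<and> (\<forall>f. Re (qform n A f) \<ge> 0)"
proof -
  have "(\<forall>v\<in>carrier_vec n. Re ((A *\<^sub>v v) \<bullet>c v) \<ge> 0) \<longleftrightarrow> (\<forall>f. Re (qform n A f) \<ge> 0)"
  proof
    assume *: "\<forall>v\<in>carrier_vec n. Re ((A *\<^sub>v v) \<bullet>c v) \<ge> 0"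
    show "\<forall>f. Re (qform n A f) \<ge> 0"
    proof
      fix f
      have "qform n A (\<lambda>i. vec n f $ i) = qform n A f"
        by (simp add: qform_def)
      then show "Re (qform n A f) \<ge> 0"
        using *[rule_format, of "vec n f"] qform_vec[OF A, of "vec n f"] by simp
    qed
  qed (use qform_vec[OF A] in auto)
  then show ?thesis using A by (auto simp: psd_def)
qed

lemma qform_gram:
  assumes "C \<in> carrier_mat m n"
  shows "qform n (adj C * C) f
    = complex_of_real (\<Sum>k<m. (cmod (\<Sum>i<n. C $$ (k, i) * f i))\<^sup>2)"
proof -
  have C': "adj C \<in> carrier_mat n m" using assms by auto
  have "complex_of_real (\<Sum>k<m. (cmod (\<Sum>i<n. C $$ (k, i) * f i))\<^sup>2)
      = (\<Sum>k<m. (\<Sum>i<n. cnj (C $$ (k, i) * f i)) * (\<Sum>i<n. C $$ (k, i) * f i))"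
    by (simp add: complex_norm_square mult.commute flip: of_real_power)
  also have "\<dots> = (\<Sum>k<m. \<Sum>i<n. \<Sum>j<n. cnj (f i) * cnj (C $$ (k, i)) * C $$ (k, j) * f j)"
    by (simp only: sum_product) (simp add: mult_ac)
  also have "\<dots> = (\<Sum>i<n. \<Sum>j<n. \<Sum>k<m. cnj (f i) * cnj (C $$ (k, i)) * C $$ (k, j) * f j)"
    by (rule sum_rotate)
  also have "\<dots> = qform n (adj C * C) f"
    unfolding qform_def using assms
    by (intro sum.cong refl)
      (simp add: index_mult_mat_sum[OF C' assms] mat_adjoint_index sum_distrib_left
        sum_distrib_right mult_ac del: index_mult_mat)
  finally show ?thesis by simp
qed

lemma psd_gram:
  assumes "C \<in> carrier_mat m n"
  shows "psd (adj C * C)"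
proof -
  have C': "adj C \<in> carrier_mat n m" using assms by auto
  have "adj C * C \<in> carrier_mat n n" using assms by auto
  then show ?thesis
    by (auto simp: psd_iff_qform mat_adjoint_mult[OF C' assms] qform_gram[OF assms]
        intro!: sum_nonneg)
qed

lemma qform_conj:
  assumes A: "A \<in> carrier_mat n n" and W: "W \<in> carrier_mat n k"
  shows "qform k (adj W * A * W) f = qform n A (\<lambda>i. (W *\<^sub>v vec k f) $ i)"
proof -
  have W': "adj W \<in> carrier_mat k n" using W by auto
  let ?v = "vec k f"
  have Wv: "W *\<^sub>v ?v \<in> carrier_vec n" and WA: "adj W * A \<in> carrier_mat k n"
    using A W W' by auto
  have "qform k (adj W * A * W) f = qform k (adj W * A * W) (\<lambda>i. ?v $ i)"
    by (simp add: qform_def)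
  also have "\<dots> = ((adj W * A * W) *\<^sub>v ?v) \<bullet>c ?v"
    using A W by (subst qform_vec) auto
  also have "(adj W * A * W) *\<^sub>v ?v = adj W *\<^sub>v (A *\<^sub>v (W *\<^sub>v ?v))"
    using assoc_mult_mat_vec[OF WA W, of ?v] assoc_mult_mat_vec[OF W' A Wv] by simp
  also have "\<dots> \<bullet>c ?v = (A *\<^sub>v (W *\<^sub>v ?v)) \<bullet>c (W *\<^sub>v ?v)"
    using A W W' by (subst cscalar_prod_mat_adjoint[OF W']) auto
  also have "\<dots> = qform n A (\<lambda>i. (W *\<^sub>v ?v) $ i)"
    using A W by (intro qform_vec) auto
  finally show ?thesis .
qed

lemma psd_conj:
  assumes A: "A \<in> carrier_mat n n" "psd A" and W: "W \<in> carrier_mat n k"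
  shows "psd (adj W * A * W)"
proof -
  have W': "adj W \<in> carrier_mat k n" using W by auto
  have AA: "adj A = A" using A(2) by (simp add: psd_def)
  have "adj (adj W * A * W) = adj W * adj (adj W * A)"
    using A W W' by (subst mat_adjoint_mult[of _ k n]) auto
  also have "adj (adj W * A) = A * W"
    using A W W' AA by (subst mat_adjoint_mult[of _ k n]) auto
  also have "adj W * (A * W) = adj W * A * W"
    using A W W' by (simp add: assoc_mult_mat[of _ k n _ n _ k])
  finally have "adj (adj W * A * W) = adj W * A * W" .
  moreover have "adj W * A * W \<in> carrier_mat k k"
    using A W W' by auto
  ultimately show ?thesis
    using A W by (auto simp: psd_iff_qform qform_conj)
qed

section \<open>Square roots of positive semidefinite matrices\<close>

lemma unitary_completion:
  fixes v :: "complex vec"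
  assumes v: "v \<in> carrier_vec n" and v0: "v \<noteq> 0\<^sub>v n"
  obtains W c where "W \<in> carrier_mat n n" "adj W * W = 1\<^sub>m n" "W * adj W = 1\<^sub>m n"
    "col W 0 = c \<cdot>\<^sub>v v"
proof -
  have n: "n \<noteq> 0" using v v0 by (intro notI) (auto intro!: eq_vecI)
  interpret cof_vec_space n "TYPE(complex)" .
  define b where "b = basis_completion v"
  define ws where "ws = gram_schmidt n b"
  note bc = basis_completion[OF v v0, folded b_def]
  note gs = gram_schmidt_result[OF bc(2,4,5) ws_def]
  have len: "length ws = n" using gs bc by simp
  have "b = v # tl b" using bc(6,7) n by (cases b) auto
  then have hd: "hd ws = v" using gram_schmidt_hd[OF v, of "tl b"] by (simp add: ws_def)
  have ws0: "ws ! 0 = v" using hd len n by (cases ws) auto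
  have wsi: "ws ! i \<in> carrier_vec n" if "i < n" for i using gs(3) len that by auto
  \<comment> \<open>Gram-Schmidt yields an orthogonal but unnormalised family that starts with
    \<open>v\<close> itself; dividing by the norms gives a unitary whose first column is a multiple
    of \<open>v\<close>.\<close>
  define r where "r i = sqrt (\<Sum>k<n. (cmod (ws ! i $ k))\<^sup>2)" for i
  have rr: "ws ! i \<bullet>c ws ! i = complex_of_real (r i) * complex_of_real (r i)" if "i < n" for i
    unfolding cscalar_prod_self[OF wsi[OF that]] r_def
    by (simp add: sum_nonneg flip: of_real_mult)
  have r0: "r i \<noteq> 0" if "i < n" for i
    using rr[OF that] corthogonalD[OF gs(2), of i i] that len by auto
  define W where "W = mat n n (\<lambda>(k, i). ws ! i $ k / complex_of_real (r i))"
  have W: "W \<in> carrier_mat n n" by (simp add: W_def)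
  have W': "adj W \<in> carrier_mat n n" using W by auto
  have WW: "adj W * W = 1\<^sub>m n"
  proof (rule eq_matI)
    fix i j assume "i < dim_row (1\<^sub>m n)" "j < dim_col (1\<^sub>m n)"
    then have ij: "i < n" "j < n" by auto
    have "(adj W * W) $$ (i, j)
        = (\<Sum>k<n. ws ! j $ k * cnj (ws ! i $ k) / (complex_of_real (r i) * complex_of_real (r j)))"
      unfolding index_mult_mat_sum[OF W' W ij] using ij
      by (auto simp: mat_adjoint_index W_def intro!: sum.cong)
    also have "\<dots> = (ws ! j \<bullet>c ws ! i) / (complex_of_real (r i) * complex_of_real (r j))"
      by (simp add: cscalar_prod_sum[OF wsi[OF ij(1)]] sum_divide_distrib)
    also have "\<dots> = 1\<^sub>m n $$ (i, j)"
      using ij rr[of i] r0[of i] corthogonalD[OF gs(2), of j i] len by auto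
    finally show "(adj W * W) $$ (i, j) = 1\<^sub>m n $$ (i, j)" .
  qed (use W in auto)
  have "W * adj W = 1\<^sub>m n" by (rule mat_mult_left_right_inverse[OF W' W WW])
  moreover have "col W 0 = (1 / complex_of_real (r 0)) \<cdot>\<^sub>v v"
    using n ws0 v by (intro eq_vecI) (auto simp: W_def)
  ultimately show ?thesis using that W WW by blast
qed

text \<open>Deflation by induction on the dimension: with an eigenvector as first column of a
  unitary \<open>W\<close>, the first column of \<open>adj W * A * W\<close> vanishes below the
  corner, hermiticity clears the first row, and the induction hypothesis takes the root of the
  remaining block.\<close>

lemma psd_sqrt_exists:
  assumes "A \<in> carrier_mat n n" "psd A"
  shows "\<exists>B\<in>carrier_mat n n. psd B \<and> B * B = A"
  using assms
proof (induction n arbitrary: A)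
  case 0
  then show ?case by (intro bexI[of _ A]) auto
next
  case (Suc n)
  note A = Suc.prems
  have herm: "adj A = A" using A(2) by (simp add: psd_def)
  obtain e where "eigenvalue A e"
    using spectrum_non_empty[OF A(1)] by (auto simp: spectrum_def)
  then obtain v where v: "v \<in> carrier_vec (Suc n)" "v \<noteq> 0\<^sub>v (Suc n)" "A *\<^sub>v v = e \<cdot>\<^sub>v v"
    using A(1) by (auto simp: eigenvalue_def eigenvector_def)
  obtain W c where W: "W \<in> carrier_mat (Suc n) (Suc n)"
    and WW: "adj W * W = 1\<^sub>m (Suc n)" "W * adj W = 1\<^sub>m (Suc n)"
    and col: "col W 0 = c \<cdot>\<^sub>v v"
    using unitary_completion[OF v(1,2)] by blast
  have W': "adj W \<in> carrier_mat (Suc n) (Suc n)" using W by auto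
  define M where "M = adj W * A * W"
  have M: "M \<in> carrier_mat (Suc n) (Suc n)" using A W by (auto simp: M_def)
  have psdM: "psd M" unfolding M_def by (rule psd_conj[OF A W])
  then have hermM: "adj M = M" by (simp add: psd_def)
  have AcW: "A *\<^sub>v col W 0 = e \<cdot>\<^sub>v col W 0"
    unfolding col using A v by (simp add: mult_mat_vec[OF A(1) v(1)] smult_smult_assoc mult.commute)
  have cW: "col W 0 \<in> carrier_vec (Suc n)" using W by (auto intro!: carrier_vecI)
  have "col M 0 = adj W * A *\<^sub>v col W 0"
    unfolding M_def using A W W' by (intro col_mult2) auto
  also have "\<dots> = adj W *\<^sub>v (e \<cdot>\<^sub>v col W 0)"
    using A W' cW by (simp add: assoc_mult_mat_vec[OF W' A(1) cW] AcW)
  also have "\<dots> = e \<cdot>\<^sub>v (adj W *\<^sub>v col W 0)"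
    by (rule mult_mat_vec[OF W' cW])
  also have "adj W *\<^sub>v col W 0 = col (1\<^sub>m (Suc n)) 0"
    unfolding WW(1)[symmetric] using W W' by (intro col_mult2[symmetric]) auto
  finally have colM: "col M 0 = e \<cdot>\<^sub>v col (1\<^sub>m (Suc n)) 0" .
  have Mi0: "M $$ (i, 0) = (if i = 0 then e else 0)" if "i < Suc n" for i
  proof -
    have "M $$ (i, 0) = col M 0 $ i" using M that by auto
    then show ?thesis using that by (simp add: colM)
  qed
  have M0i: "M $$ (0, i) = (if i = 0 then cnj e else 0)" if "i < Suc n" for i
    using hermitian_index[OF hermM M _ that, of 0] Mi0[OF that] by auto
  have e_real: "cnj e = e" using Mi0[of 0] M0i[of 0] by simp
  have qM: "Re (qform (Suc n) M f) \<ge> 0" for f using psdM M by (simp add: psd_iff_qform)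
  have e_nonneg: "Re e \<ge> 0"
    using qM[of "\<lambda>i. if i = 0 then 1 else 0"]
    by (simp add: qform_def sum.lessThan_Suc_shift Mi0[of 0] del: sum.lessThan_Suc)
  define N where "N = mat n n (\<lambda>(i, j). M $$ (Suc i, Suc j))"
  have N: "N \<in> carrier_mat n n" by (simp add: N_def)
  have "adj N = N"
  proof (rule hermitianI[OF N])
    show "cnj (N $$ (j, i)) = N $$ (i, j)" if "i < n" "j < n" for i j
      using hermitian_index[OF hermM M, of "Suc i" "Suc j"] that by (simp add: N_def)
  qed
  moreover have "Re (qform n N f) \<ge> 0" for f
  proof -
    have "qform (Suc n) M (\<lambda>i. case i of 0 \<Rightarrow> 0 | Suc k \<Rightarrow> f k) = qform n N f"
      by (simp add: qform_def sum.lessThan_Suc_shift N_def del: sum.lessThan_Suc)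
    then show ?thesis using qM by metis
  qed
  ultimately have "psd N" using N by (simp add: psd_iff_qform)
  then obtain B where B: "B \<in> carrier_mat n n" "psd B" "B * B = N"
    using Suc.IH[OF N] by auto
  define B1 where "B1 = mat (Suc n) (Suc n) (\<lambda>(i, j). if i = 0 \<and> j = 0
     then complex_of_real (sqrt (Re e)) else if i = 0 \<or> j = 0 then 0 else B $$ (i - 1, j - 1))"
  have B1: "B1 \<in> carrier_mat (Suc n) (Suc n)" by (simp add: B1_def)
  have "adj B1 = B1"
  proof (rule hermitianI[OF B1])
    fix i j assume ij: "i < Suc n" "j < Suc n"
    have "B $$ (i - 1, j - 1) = cnj (B $$ (j - 1, i - 1))" if "0 < i" "0 < j"
      using B(2) ij that by (intro hermitian_index[OF _ B(1)]) (auto simp: psd_def)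
    then show "cnj (B1 $$ (j, i)) = B1 $$ (i, j)" using ij by (auto simp: B1_def)
  qed
  moreover have "Re (qform (Suc n) B1 f) \<ge> 0" for f
  proof -
    have "qform (Suc n) B1 f
        = cnj (f 0) * complex_of_real (sqrt (Re e)) * f 0 + qform n B (\<lambda>i. f (Suc i))"
      by (simp add: qform_def sum.lessThan_Suc_shift B1_def del: sum.lessThan_Suc)
    moreover have "Re (cnj (f 0) * complex_of_real (sqrt (Re e)) * f 0) \<ge> 0"
    proof -
      have "Re (cnj (f 0) * complex_of_real (sqrt (Re e)) * f 0)
          = sqrt (Re e) * ((Re (f 0))\<^sup>2 + (Im (f 0))\<^sup>2)"
        by (simp add: power2_eq_square algebra_simps)
      then show ?thesis using e_nonneg by simp
    qed
    moreover have "Re (qform n B (\<lambda>i. f (Suc i))) \<ge> 0"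
      using B by (simp add: psd_iff_qform)
    ultimately show ?thesis by simp
  qed
  ultimately have psdB1: "psd B1" using B1 by (simp add: psd_iff_qform)
  have BB1: "B1 * B1 = M"
  proof (rule eq_matI)
    fix i j assume "i < dim_row M" "j < dim_col M"
    then have ij: "i < Suc n" "j < Suc n" using M by auto
    have ee: "complex_of_real (sqrt (Re e)) * complex_of_real (sqrt (Re e)) = e"
      using e_nonneg e_real
      by (auto simp: complex_eq_iff simp flip: of_real_mult)
    have sums: "(B1 * B1) $$ (i, j) = B1 $$ (i, 0) * B1 $$ (0, j)
        + (\<Sum>k<n. B1 $$ (i, Suc k) * B1 $$ (Suc k, j))"
      unfolding index_mult_mat_sum[OF B1 B1 ij] by (simp add: sum.lessThan_Suc_shift del: sum.lessThan_Suc)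
    show "(B1 * B1) $$ (i, j) = M $$ (i, j)"
    proof (cases "i = 0 \<or> j = 0")
      case True
      then show ?thesis
        unfolding sums using ij Mi0[of i] M0i[of j] ee e_real by (auto simp: B1_def)
    next
      case False
      then obtain i' j' where ij': "i = Suc i'" "j = Suc j'" "i' < n" "j' < n"
        using ij by (metis Suc_less_eq not0_implies_Suc)
      have "(B1 * B1) $$ (i, j) = (\<Sum>k<n. B $$ (i', k) * B $$ (k, j'))"
        unfolding sums using ij' by (simp add: B1_def)
      also have "\<dots> = (B * B) $$ (i', j')"
        by (rule index_mult_mat_sum[OF B(1,1) ij'(3,4), symmetric])
      also have "\<dots> = M $$ (i, j)" using B(3) ij' by (simp add: N_def)
      finally show ?thesis .
    qed
  qed (use B1 M in auto)
  \<comment> \<open>The double adjoint makes \<open>X\<close> literally a congruence by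
    \<open>adj W\<close>, the form in which \<open>psd_conj\<close> gives positivity.\<close>
  define X where "X = adj (adj W) * B1 * adj W"
  have X: "X \<in> carrier_mat (Suc n) (Suc n)" using B1 W W' by (auto simp: X_def)
  have Xe: "X = W * B1 * adj W" by (simp add: X_def)
  have psdX: "psd X" unfolding X_def by (rule psd_conj[OF B1 psdB1 W'])
  let ?n = "Suc n"
  note assoc = assoc_mult_mat[of _ ?n ?n _ ?n _ ?n]
  have "X * X = W * B1 * ((adj W * W) * (B1 * adj W))"
    unfolding Xe using B1 W W' by (simp add: assoc mult_carrier_mat[of _ ?n ?n _ ?n])
  also have "\<dots> = W * (B1 * B1) * adj W"
    unfolding WW using B1 W W' by (simp add: assoc mult_carrier_mat[of _ ?n ?n _ ?n])
  also have "\<dots> = (W * adj W) * (A * (W * adj W))"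
    unfolding BB1 M_def using A W W' by (simp add: assoc mult_carrier_mat[of _ ?n ?n _ ?n])
  also have "\<dots> = A" using A(1) by (simp add: WW)
  finally show ?case using X psdX by blast
qed

lemma mat_trace_gram:
  assumes M: "M \<in> carrier_mat m n"
  shows "mat_trace (adj M * M) = complex_of_real (\<Sum>j<n. \<Sum>i<m. (cmod (M $$ (i, j)))\<^sup>2)"
proof -
  have "(adj M * M) $$ (j, j) = (\<Sum>i<m. complex_of_real ((cmod (M $$ (i, j)))\<^sup>2))" if j: "j < n" for j
    unfolding index_mult_mat_sum[OF mat_adjoint_carrier[OF M] M j j] using M j
    by (intro sum.cong refl) (simp add: mat_adjoint_index complex_norm_square mult.commute flip: of_real_power)
  then show ?thesis using M by (simp add: mat_trace_def del: index_mult_mat(1))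
qed

lemma gram_trace_eq_0:
  assumes M: "M \<in> carrier_mat m n" and tr: "Re (mat_trace (adj M * M)) = 0"
  shows "M = 0\<^sub>m m n"
proof -
  have "(\<Sum>j<n. \<Sum>i<m. (cmod (M $$ (i, j)))\<^sup>2) = 0" using tr by (simp add: mat_trace_gram[OF M])
  then have "\<forall>j\<in>{..<n}. \<forall>i\<in>{..<m}. (cmod (M $$ (i, j)))\<^sup>2 = 0"
    by (subst (asm) sum_nonneg_eq_0_iff, simp, intro sum_nonneg, simp)
      (simp add: sum_nonneg_eq_0_iff)
  then show ?thesis using M by (intro eq_matI) auto
qed

lemma mat_trace_commute:
  assumes P: "P \<in> carrier_mat n n" and Q: "Q \<in> carrier_mat n n"
  shows "mat_trace (P * Q) = mat_trace (Q * P)"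
proof -
  have "mat_trace (P * Q) = (\<Sum>i<n. \<Sum>l<n. P $$ (i, l) * Q $$ (l, i))"
    using P Q by (auto simp: mat_trace_def index_mult_mat_sum[OF P Q] simp del: index_mult_mat(1))
  also have "\<dots> = (\<Sum>l<n. \<Sum>i<n. Q $$ (l, i) * P $$ (i, l))"
    by (subst sum.swap) (simp add: mult.commute)
  also have "\<dots> = mat_trace (Q * P)"
    using P Q by (auto simp: mat_trace_def index_mult_mat_sum[OF Q P] simp del: index_mult_mat(1))
  finally show ?thesis .
qed

text \<open>
  With \<open>X = B - C\<close> one has \<open>B X + X C = 0\<close>, so the traces of \<open>X B X\<close> and \<open>X C X\<close> add up to zero.
\<close>

lemma psd_sqrt_unique:
  assumes B: "B \<in> carrier_mat n n" "psd B" and C: "C \<in> carrier_mat n n" "psd C"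
    and eq: "B * B = C * C"
  shows "B = C"
proof -
  define X where "X = B - C"
  have X: "X \<in> carrier_mat n n" using B C by (simp add: X_def minus_carrier_mat)
  have hB: "adj B = B" and hC: "adj C = C" using B C by (auto simp: psd_def)
  have hX: "adj X = X"
  proof (rule hermitianI[OF X])
    fix i j assume ij: "i < n" "j < n"
    show "cnj (X $$ (j, i)) = X $$ (i, j)"
      using hermitian_index[OF hB B(1) ij] hermitian_index[OF hC C(1) ij] ij B(1) C(1)
      by (simp add: X_def)
  qed
  note assoc = assoc_mult_mat[of _ n n _ n _ n]
  have BXXC: "B * X = - (X * C)"
  proof -
    have "B * X = B * B - B * C" unfolding X_def by (rule mult_minus_distrib_mat[OF B(1) B(1) C(1)])
    also have "X * C = B * C - C * C" unfolding X_def by (rule minus_mult_distrib_mat[OF B(1) C(1) C(1)])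
    ultimately show ?thesis unfolding eq
      using B C by (auto intro!: eq_matI)
  qed
  \<comment> \<open>A root \<open>S\<close> of \<open>P\<close> turns the trace of
    \<open>X P X\<close> into the squared Frobenius norm of \<open>S X\<close>; once that vanishes,
    so does \<open>P X = S (S X)\<close>.\<close>
  have factor: "\<exists>S\<in>carrier_mat n n. P * X = S * (S * X) \<and> adj (S * X) * (S * X) = X * (P * X)"
    if P: "P \<in> carrier_mat n n" "psd P" for P
  proof -
    obtain S where S: "S \<in> carrier_mat n n" "psd S" "S * S = P" using psd_sqrt_exists[OF P] by blast
    have hS: "adj S = S" using S(2) by (simp add: psd_def)
    have "P * X = S * (S * X)" using S(1,3) X assoc by metis
    then show ?thesis
      using S(1) X by (intro bexI[of _ S] conjI)
        (simp_all add: mat_adjoint_mult[OF S(1) X] hS hX assoc mult_carrier_mat[of _ n n _ n])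
  qed
  obtain S where S: "S \<in> carrier_mat n n" "B * X = S * (S * X)" "adj (S * X) * (S * X) = X * (B * X)"
    using factor[OF B] by blast
  obtain R where R: "R \<in> carrier_mat n n" "C * X = R * (R * X)" "adj (R * X) * (R * X) = X * (C * X)"
    using factor[OF C] by blast
  have SX: "S * X \<in> carrier_mat n n" and RX: "R * X \<in> carrier_mat n n" and XC: "X * C \<in> carrier_mat n n"
    using S R X C by auto
  have "mat_trace (X * (B * X)) = - mat_trace (X * (X * C))"
    unfolding BXXC using X C XC by (auto simp: mat_trace_def sum_negf)
  also have "mat_trace (X * (X * C)) = mat_trace (X * (C * X))"
    using mat_trace_commute[OF X XC] X C by (simp add: assoc)
  finally have "mat_trace (adj (S * X) * (S * X)) + mat_trace (adj (R * X) * (R * X)) = 0"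
    unfolding S(3) R(3) by simp
  from arg_cong[OF this, of Re]
  have "Re (mat_trace (adj (S * X) * (S * X))) + Re (mat_trace (adj (R * X) * (R * X))) = 0" by simp
  moreover have "Re (mat_trace (adj (S * X) * (S * X))) \<ge> 0" "Re (mat_trace (adj (R * X) * (R * X))) \<ge> 0"
    unfolding mat_trace_gram[OF SX] mat_trace_gram[OF RX] by (auto intro!: sum_nonneg)
  ultimately have "Re (mat_trace (adj (S * X) * (S * X))) = 0" "Re (mat_trace (adj (R * X) * (R * X))) = 0"
    by linarith+
  then have "B * X = 0\<^sub>m n n" "C * X = 0\<^sub>m n n"
    unfolding S(2) R(2) using gram_trace_eq_0[OF SX] gram_trace_eq_0[OF RX] S(1) R(1) by auto
  then have "X * X = 0\<^sub>m n n"
    unfolding X_def minus_mult_distrib_mat[OF B(1) C(1) X, unfolded X_def] by auto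
  then have "X = 0\<^sub>m n n" using hX by (intro gram_trace_eq_0[OF X]) (simp add: mat_trace_def)
  then have "X $$ (i, j) = 0" if "i < n" "j < n" for i j using that by simp
  then show ?thesis using B(1) C(1) by (intro eq_matI) (auto simp: X_def)
qed

lemma psd_sqrt:
  assumes "A \<in> carrier_mat n n" "psd A"
  shows "psd_sqrt A \<in> carrier_mat n n" "psd (psd_sqrt A)" "psd_sqrt A * psd_sqrt A = A"
proof -
  obtain B where B: "B \<in> carrier_mat n n" "psd B" "B * B = A"
    using psd_sqrt_exists[OF assms] by blast
  \<comment> \<open>The description in \<open>psd_sqrt\<close> does not fix a dimension;
    \<open>C * C = A\<close> does, and uniqueness needs it.\<close>
  have car: "C \<in> carrier_mat n n" if "psd C" "C * C = A" for C
    using that assms(1) by (auto simp: psd_def intro!: carrier_matI)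
  have "psd_sqrt A = B"
    unfolding psd_sqrt_def
    using B car by (intro the_equality) (auto intro: psd_sqrt_unique[of _ n])
  with B show "psd_sqrt A \<in> carrier_mat n n" "psd (psd_sqrt A)" "psd_sqrt A * psd_sqrt A = A"
    by auto
qed

lemma psd_sqrt_eqI:
  assumes "B \<in> carrier_mat n n" "psd B" "B * B = A"
  shows "psd_sqrt A = B"
proof -
  have A: "A \<in> carrier_mat n n" using assms by auto
  have hB: "adj B = B" using assms(2) by (simp add: psd_def)
  have "psd A" using psd_gram[OF assms(1)] assms(3) by (simp add: hB)
  note psd_sqrt[OF A this]
  then show ?thesis using psd_sqrt_unique[OF _ _ assms(1,2)] assms(3) by metis
qed

section \<open>Channels and fidelity with a pure state\<close>

lemma pure_state_carrier [simp, intro]: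
  "v \<in> carrier_vec n \<Longrightarrow> pure_state v \<in> carrier_mat n n"
  by (auto simp: pure_state_def)

lemma qform_pure_state:
  assumes "v \<in> carrier_vec n"
  shows "qform n (pure_state v) f = complex_of_real ((cmod (\<Sum>i<n. cnj (f i) * v $ i))\<^sup>2)"
proof -
  have "qform n (pure_state v) f = (\<Sum>i<n. \<Sum>j<n. (cnj (f i) * v $ i) * cnj (cnj (f j) * v $ j))"
    unfolding qform_def using assms by (intro sum.cong refl) (simp add: pure_state_def mult_ac)
  also have "\<dots> = (\<Sum>i<n. cnj (f i) * v $ i) * cnj (\<Sum>i<n. cnj (f i) * v $ i)"
    by (simp only: sum_product cnj_sum)
  finally show ?thesis by (simp add: complex_norm_square flip: of_real_power)
qed

lemma psd_smult_pure_state: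
  assumes v: "v \<in> carrier_vec n" and c: "c \<ge> 0"
  shows "psd (complex_of_real c \<cdot>\<^sub>m pure_state v)"
proof -
  have "adj (complex_of_real c \<cdot>\<^sub>m pure_state v) = complex_of_real c \<cdot>\<^sub>m pure_state v"
    using v by (intro eq_matI) (auto simp: mat_adjoint_index pure_state_def)
  moreover have "qform n (complex_of_real c \<cdot>\<^sub>m pure_state v) f
      = complex_of_real c * qform n (pure_state v) f" for f
    using v by (simp add: qform_def sum_distrib_left pure_state_def mult_ac)
  ultimately show ?thesis
    using v c by (subst psd_iff_qform[of _ n]) (auto simp: qform_pure_state simp del: of_real_power)
qed

lemma psd_pure_state:
  assumes "v \<in> carrier_vec n"
  shows "psd (pure_state v)"
proof -
  have "1 \<cdot>\<^sub>m pure_state v = pure_state v" by (rule eq_matI) auto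
  then show ?thesis using psd_smult_pure_state[OF assms, of 1] by simp
qed

lemma mat_trace_pure_state:
  assumes "v \<in> carrier_vec n"
  shows "mat_trace (pure_state v) = v \<bullet>c v"
  using assms by (auto simp: mat_trace_def pure_state_def cscalar_prod_sum[OF assms])

text \<open>With \<open>C = psd_sqrt A\<close> and \<open>w = C v\<close>, the sandwiched pure state
  is \<open>|w><w|\<close>, whose root is \<open>|w><w|\<close> divided by the norm of
  \<open>w\<close>. The trace of that root is this norm, and its square is the form of
  \<open>A\<close> at \<open>v\<close>.\<close>

lemma fidelity_pure_state:
  assumes A: "A \<in> carrier_mat n n" "psd A" and v: "v \<in> carrier_vec n"
  shows "fidelity A (pure_state v) = sqrt (Re (qform n A (\<lambda>i. v $ i)))"
proof -
  define C where "C = psd_sqrt A"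
  note C = psd_sqrt[OF A, folded C_def]
  have herm: "adj C = C" using C(2) by (simp add: psd_def)
  define w where "w = C *\<^sub>v v"
  have w: "w \<in> carrier_vec n" using C v by (auto simp: w_def)
  have "C * pure_state v * C = pure_state w"
  proof (rule eq_matI)
    fix i j assume "i < dim_row (pure_state w)" "j < dim_col (pure_state w)"
    then have ij: "i < n" "j < n" using w by (auto simp: pure_state_def)
    have CP: "C * pure_state v \<in> carrier_mat n n" using C v by auto
    have wi: "(C * pure_state v) $$ (i, l) = w $ i * cnj (v $ l)" if "l < n" for l
      unfolding index_mult_mat_sum[OF C(1) pure_state_carrier[OF v] ij(1) that] w_def
        index_mult_mat_vec_sum[OF C(1) v ij(1)] using that v
      by (simp add: pure_state_def sum_distrib_left sum_distrib_right mult_ac)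
    note Cc = hermitian_index[OF herm C(1) _ ij(2)]
    have "(C * pure_state v * C) $$ (i, j) = (\<Sum>l<n. w $ i * cnj (v $ l) * cnj (C $$ (j, l)))"
      unfolding index_mult_mat_sum[OF CP C(1) ij] using wi Cc by simp
    also have "\<dots> = w $ i * cnj (w $ j)"
      unfolding w_def index_mult_mat_vec_sum[OF C(1) v ij(2)]
      by (simp add: sum_distrib_left mult_ac)
    finally show "(C * pure_state v * C) $$ (i, j) = pure_state w $$ (i, j)"
      using ij w by (simp add: pure_state_def)
  qed (use C w in \<open>auto simp: pure_state_def\<close>)
  moreover
  define r where "r = sqrt (\<Sum>i<n. (cmod (w $ i))\<^sup>2)"
  have r: "r \<ge> 0" by (simp add: r_def sum_nonneg)
  have ww: "w \<bullet>c w = complex_of_real (r * r)"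
    unfolding cscalar_prod_self[OF w] r_def by (simp add: sum_nonneg)
  \<comment> \<open>For \<open>r = 0\<close> the factor \<open>1 / r\<close> is 0 and
    \<open>w\<close> vanishes as well, so the formula survives.\<close>
  have "psd_sqrt (pure_state w) = complex_of_real (1 / r) \<cdot>\<^sub>m pure_state w" (is "_ = ?P")
  proof (rule psd_sqrt_eqI)
    show P: "?P \<in> carrier_mat n n" using w by auto
    show "psd ?P" using r by (intro psd_smult_pure_state[OF w]) auto
    show "?P * ?P = pure_state w"
    proof (rule eq_matI)
      fix i j assume "i < dim_row (pure_state w)" "j < dim_col (pure_state w)"
      then have ij: "i < n" "j < n" using w by (auto simp: pure_state_def)
      have "(?P * ?P) $$ (i, j)
          = (\<Sum>l<n. w $ i * cnj (w $ j) / complex_of_real (r * r) * (w $ l * cnj (w $ l)))"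
        unfolding index_mult_mat_sum[OF P P ij] using w ij
        by (intro sum.cong refl) (simp add: pure_state_def mult_ac)
      also have "\<dots> = w $ i * cnj (w $ j) / complex_of_real (r * r) * (w \<bullet>c w)"
        by (simp add: cscalar_prod_sum[OF w] sum_distrib_left)
      also have "\<dots> = w $ i * cnj (w $ j)"
      proof (cases "r = 0")
        case True
        then have "w \<bullet>c w = 0" using ww by simp
        then have "w = 0\<^sub>v n" using conjugate_square_eq_0_vec[OF w] by simp
        then show ?thesis using ij by simp
      qed (simp add: ww)
      finally show "(?P * ?P) $$ (i, j) = pure_state w $$ (i, j)"
        using ij w by (simp add: pure_state_def)
    qed (use w in \<open>auto simp: pure_state_def\<close>)
  qed
  moreover have "mat_trace ?P = complex_of_real (1 / r) * (w \<bullet>c w)"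
    using w by (auto simp: mat_trace_def pure_state_def cscalar_prod_sum[OF w] sum_distrib_left)
  then have "mat_trace ?P = complex_of_real r" by (simp add: ww)
  ultimately have "fidelity A (pure_state v) = r"
    unfolding fidelity_def C_def by simp
  moreover have "qform n A (\<lambda>i. v $ i) = complex_of_real (r * r)"
  proof -
    have "qform n A (\<lambda>i. v $ i) = (C *\<^sub>v w) \<bullet>c v"
      using assoc_mult_mat_vec[OF C(1,1) v] qform_vec[OF A(1) v] by (simp add: C(3) w_def)
    also have "\<dots> = w \<bullet>c w"
      using cscalar_prod_mat_adjoint[OF C(1) w v] by (simp add: herm w_def)
    finally show ?thesis by (simp add: ww)
  qed
  ultimately show ?thesis using r by simp
qed

lemma Cauchy_Schwarz_real:
  fixes f g :: "'a \<Rightarrow> real"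
  shows "(\<Sum>i\<in>A. f i * g i)\<^sup>2 \<le> (\<Sum>i\<in>A. (f i)\<^sup>2) * (\<Sum>i\<in>A. (g i)\<^sup>2)"
proof -
  \<comment> \<open>Lagrange's identity: half of this sum of squares is exactly the defect of the
    inequality.\<close>
  have "0 \<le> (\<Sum>i\<in>A. \<Sum>j\<in>A. (f i * g j - f j * g i)\<^sup>2)"
    by (intro sum_nonneg) auto
  also have "\<dots> = (\<Sum>i\<in>A. \<Sum>j\<in>A. (f i)\<^sup>2 * (g j)\<^sup>2) + (\<Sum>i\<in>A. \<Sum>j\<in>A. (f j)\<^sup>2 * (g i)\<^sup>2)
      - 2 * (\<Sum>i\<in>A. \<Sum>j\<in>A. (f i * g i) * (f j * g j))"
    by (simp add: power2_eq_square algebra_simps sum.distrib sum_subtractf sum_distrib_left)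
  also have "(\<Sum>i\<in>A. \<Sum>j\<in>A. (f j)\<^sup>2 * (g i)\<^sup>2) = (\<Sum>i\<in>A. \<Sum>j\<in>A. (f i)\<^sup>2 * (g j)\<^sup>2)"
    by (rule sum.swap)
  finally show ?thesis by (simp add: sum_product power2_eq_square)
qed

lemma Cauchy_Schwarz_complex:
  fixes f g :: "'a \<Rightarrow> complex"
  shows "(cmod (\<Sum>i\<in>A. f i * g i))\<^sup>2 \<le> (\<Sum>i\<in>A. (cmod (f i))\<^sup>2) * (\<Sum>i\<in>A. (cmod (g i))\<^sup>2)"
proof -
  have "(cmod (\<Sum>i\<in>A. f i * g i))\<^sup>2 \<le> (\<Sum>i\<in>A. cmod (f i) * cmod (g i))\<^sup>2"
    by (intro power_mono order.trans[OF norm_sum]) (auto simp: norm_mult)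
  also have "\<dots> \<le> (\<Sum>i\<in>A. (cmod (f i))\<^sup>2) * (\<Sum>i\<in>A. (cmod (g i))\<^sup>2)"
    by (rule Cauchy_Schwarz_real)
  finally show ?thesis .
qed

text \<open>The largest eigenvalue is at most the trace. For \<open>A = C * C\<close> this is
  Cauchy-Schwarz in each row of \<open>C\<close>, the trace being the squared Frobenius norm of
  \<open>C\<close>. It later bounds overlaps by 1.\<close>

lemma qform_psd_le_trace:
  assumes A: "A \<in> carrier_mat n n" "psd A"
  shows "Re (qform n A f) \<le> Re (mat_trace A) * (\<Sum>i<n. (cmod (f i))\<^sup>2)"
proof -
  obtain C where C: "C \<in> carrier_mat n n" "psd C" "C * C = A"
    using psd_sqrt_exists[OF A] by blast
  have herm: "adj C = C" using C(2) by (simp add: psd_def)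
  have "Re (qform n A f) = (\<Sum>k<n. (cmod (\<Sum>i<n. C $$ (k, i) * f i))\<^sup>2)"
    using qform_gram[OF C(1), of f] C(3) herm by simp
  also have "\<dots> \<le> (\<Sum>k<n. (\<Sum>i<n. (cmod (C $$ (k, i)))\<^sup>2) * (\<Sum>i<n. (cmod (f i))\<^sup>2))"
    by (intro sum_mono Cauchy_Schwarz_complex)
  also have "\<dots> = Re (mat_trace A) * (\<Sum>i<n. (cmod (f i))\<^sup>2)"
  proof -
    have "Re (mat_trace A) = (\<Sum>i<n. \<Sum>k<n. (cmod (C $$ (k, i)))\<^sup>2)"
      using mat_trace_gram[OF C(1)] by (simp add: herm C(3))
    also have "\<dots> = (\<Sum>k<n. \<Sum>i<n. (cmod (C $$ (k, i)))\<^sup>2)" by (rule sum.swap)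
    finally have "Re (mat_trace A) = \<dots>" .
    then show ?thesis by (simp add: sum_distrib_right)
  qed
  finally show ?thesis .
qed

section \<open>Channels in Kraus form\<close>

lemma mult_add_less:
  fixes x n k r :: nat
  assumes "x < n" "k < r"
  shows "x * r + k < n * r"
proof -
  have "x * r + k < Suc x * r" using assms by simp
  also have "\<dots> \<le> n * r" using assms by (intro mult_le_mono1) simp
  finally show ?thesis .
qed

lemma sum_lessThan_mult:
  fixes f :: "nat \<Rightarrow> 'a::comm_monoid_add"
  shows "(\<Sum>p<n * r. f p) = (\<Sum>i<n. \<Sum>k<r. f (i * r + k))"
proof -
  have "(\<Sum>p<n * r. f p) = (\<Sum>i<n. sum f {i * r..<i * r + r})"
    by (rule sum.nat_group[symmetric])
  also have "\<dots> = (\<Sum>i<n. \<Sum>k<r. f (i * r + k))"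
  proof (rule sum.cong[OF refl])
    fix i
    show "sum f {i * r..<i * r + r} = (\<Sum>k<r. f (i * r + k))"
      using sum.shift_bounds_nat_ivl[of f 0 "i * r" r] by (simp add: lessThan_atLeast0 add.commute)
  qed
  finally show ?thesis .
qed

lemma sum_bij_betw_Times:
  fixes f :: "'b \<Rightarrow> 'c::comm_monoid_add"
  assumes "bij_betw (\<lambda>(p, r). e p r) (A \<times> B) C"
  shows "(\<Sum>y\<in>C. f y) = (\<Sum>p\<in>A. \<Sum>r\<in>B. f (e p r))"
  unfolding sum.reindex_bij_betw[OF assms, of f, symmetric] sum.cartesian_product
  by (simp add: split_def)

text \<open>Compared with \<open>kraus_map\<close>, the operators may be rectangular and the index
  set is arbitrary: composing channels multiplies index sets, and completing a contraction to a
  channel takes a disjoint union.\<close>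

definition kraus_sum ::
  "nat \<Rightarrow> 'a set \<Rightarrow> ('a \<Rightarrow> complex mat) \<Rightarrow> complex mat \<Rightarrow> complex mat" where
  "kraus_sum n I E X = mat n n (\<lambda>xy. \<Sum>a\<in>I. (E a * X * adj (E a)) $$ xy)"

lemma kraus_sum_carrier [simp]: "kraus_sum n I E X \<in> carrier_mat n n"
  by (simp add: kraus_sum_def)

lemma conj_mat_index:
  assumes E: "E \<in> carrier_mat n m" and X: "X \<in> carrier_mat m m" and pq: "p < n" "q < n"
  shows "(E * X * adj E) $$ (p, q)
    = (\<Sum>j<m. \<Sum>i<m. E $$ (p, i) * X $$ (i, j) * cnj (E $$ (q, j)))"
proof -
  have EX: "E * X \<in> carrier_mat n m" and E': "adj E \<in> carrier_mat m n"
    using E X by auto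
  show ?thesis
    unfolding index_mult_mat_sum[OF EX E' pq]
  proof (rule sum.cong[OF refl])
    fix j assume "j \<in> {..<m}"
    then show "(E * X) $$ (p, j) * adj E $$ (j, q)
        = (\<Sum>i<m. E $$ (p, i) * X $$ (i, j) * cnj (E $$ (q, j)))"
      using E pq by (simp add: index_mult_mat_sum[OF E X pq(1)] mat_adjoint_index
          sum_distrib_right del: index_mult_mat(1))
  qed
qed

lemma kraus_sum_index:
  assumes "\<And>a. a \<in> I \<Longrightarrow> E a \<in> carrier_mat n m" "X \<in> carrier_mat m m" "p < n" "q < n"
  shows "kraus_sum n I E X $$ (p, q)
    = (\<Sum>a\<in>I. \<Sum>j<m. \<Sum>i<m. E a $$ (p, i) * X $$ (i, j) * cnj (E a $$ (q, j)))"
proof -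
  have "kraus_sum n I E X $$ (p, q) = (\<Sum>a\<in>I. (E a * X * adj (E a)) $$ (p, q))"
    using assms by (simp add: kraus_sum_def del: index_mult_mat(1))
  then show ?thesis using conj_mat_index[OF assms(1) assms(2-4)] by simp
qed

text \<open>Moving \<open>E a \<otimes> 1\<close> to the other side of the form replaces
  \<open>f\<close> by its image under the adjoint. Positivity thus passes from \<open>X\<close> to
  its image under every extension, which is complete positivity.\<close>

lemma qform_tensor_id_kraus_sum:
  assumes E: "\<And>a. a \<in> I \<Longrightarrow> E a \<in> carrier_mat n m" and X: "X \<in> carrier_mat (m * r) (m * r)"
  shows "qform (n * r) (tensor_id m n r (kraus_sum n I E) X) f
    = (\<Sum>a\<in>I. qform (m * r) X (\<lambda>q. \<Sum>x<n. cnj (E a $$ (x, q div r)) * f (x * r + q mod r)))"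
    (is "_ = (\<Sum>a\<in>I. qform _ _ (?g a))")
proof -
  note lt = mult_add_less
  have T: "tensor_id m n r (kraus_sum n I E) X $$ (x * r + k, y * r + l)
      = (\<Sum>a\<in>I. \<Sum>j<m. \<Sum>i<m. E a $$ (x, i) * X $$ (i * r + k, j * r + l) * cnj (E a $$ (y, j)))"
    if "x < n" "y < n" "k < r" "l < r" for x y k l
    using that by (simp add: tensor_id_def lt kraus_sum_index[OF E])
  have "qform (n * r) (tensor_id m n r (kraus_sum n I E) X) f
      = (\<Sum>x<n. \<Sum>k<r. \<Sum>y<n. \<Sum>l<r. \<Sum>a\<in>I. \<Sum>j<m. \<Sum>i<m. cnj (f (x * r + k)) *
          (E a $$ (x, i) * X $$ (i * r + k, j * r + l) * cnj (E a $$ (y, j))) * f (y * r + l))"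
    unfolding qform_def sum_lessThan_mult using T
    by (intro sum.cong refl) (simp add: sum_distrib_left sum_distrib_right)
  also have "\<dots> = (\<Sum>a\<in>I. \<Sum>i<m. \<Sum>k<r. \<Sum>j<m. \<Sum>l<r. \<Sum>x<n. \<Sum>y<n. cnj (f (x * r + k)) *
          (E a $$ (x, i) * X $$ (i * r + k, j * r + l) * cnj (E a $$ (y, j))) * f (y * r + l))"
    apply (simp only: sum.cartesian_product)
    apply (rule sum.reindex_bij_witness[where
          i = "\<lambda>(a, i, k, j, l, x, y). (x, k, y, l, a, j, i)" and
          j = "\<lambda>(x, k, y, l, a, j, i). (a, i, k, j, l, x, y)"])
    by auto
  also have "\<dots> = (\<Sum>a\<in>I. qform (m * r) X (?g a))"
    unfolding qform_def sum_lessThan_mult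
  proof (intro sum.cong refl)
    fix a i k j l assume "k \<in> {..<r}" "l \<in> {..<r}"
    then show "(\<Sum>x<n. \<Sum>y<n. cnj (f (x * r + k)) *
          (E a $$ (x, i) * X $$ (i * r + k, j * r + l) * cnj (E a $$ (y, j))) * f (y * r + l))
        = cnj (?g a (i * r + k)) * X $$ (i * r + k, j * r + l) * ?g a (j * r + l)"
      by (simp add: sum_distrib_left sum_distrib_right mult_ac)
  qed
  finally show ?thesis .
qed

text \<open>The condition \<open>tp\<close> is the entrywise form of completeness, the sum of all
  \<open>adj (E a) * E a\<close> being the identity.\<close>

lemma quantum_channel_kraus_sum:
  assumes E: "\<And>a. a \<in> I \<Longrightarrow> E a \<in> carrier_mat n m"
    and tp: "\<And>i j. i < m \<Longrightarrow> j < m \<Longrightarrow>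
      (\<Sum>a\<in>I. \<Sum>x<n. E a $$ (x, i) * cnj (E a $$ (x, j))) = (if i = j then 1 else 0)"
  shows "quantum_channel m n (kraus_sum n I E)"
proof -
  have "mat_trace (kraus_sum n I E X) = mat_trace X" if X: "X \<in> carrier_mat m m" for X
  proof -
    have "mat_trace (kraus_sum n I E X)
        = (\<Sum>p<n. \<Sum>a\<in>I. \<Sum>j<m. \<Sum>i<m. E a $$ (p, i) * X $$ (i, j) * cnj (E a $$ (p, j)))"
      unfolding mat_trace_def using kraus_sum_index[OF E X]
      by (auto simp: kraus_sum_carrier[THEN carrier_matD(1)] intro!: sum.cong)
    also have "\<dots> = (\<Sum>j<m. \<Sum>i<m. \<Sum>a\<in>I. \<Sum>p<n. E a $$ (p, i) * X $$ (i, j) * cnj (E a $$ (p, j)))"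
      apply (simp only: sum.cartesian_product)
      apply (rule sum.reindex_bij_witness[where
            i = "\<lambda>(j, i, a, p). (p, a, j, i)" and j = "\<lambda>(p, a, j, i). (j, i, a, p)"])
      by auto
    also have "\<dots> = (\<Sum>j<m. \<Sum>i<m. X $$ (i, j) * (\<Sum>a\<in>I. \<Sum>p<n. E a $$ (p, i) * cnj (E a $$ (p, j))))"
      by (simp add: sum_distrib_left mult_ac)
    also have "\<dots> = (\<Sum>j<m. X $$ (j, j))"
      by (rule sum.cong[OF refl]) (simp add: tp if_distrib cong: if_cong)
    finally show ?thesis using X by (simp add: mat_trace_def)
  qed
  moreover have "kraus_sum n I E (X + Y) = kraus_sum n I E X + kraus_sum n I E Y"
    if "X \<in> carrier_mat m m" "Y \<in> carrier_mat m m" for X Y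
    using that
    by (intro eq_matI) (auto simp: kraus_sum_index[OF E] kraus_sum_carrier[THEN carrier_matD(1)]
        kraus_sum_carrier[THEN carrier_matD(2)] sum.distrib distrib_left distrib_right)
  moreover have "kraus_sum n I E (c \<cdot>\<^sub>m X) = c \<cdot>\<^sub>m kraus_sum n I E X"
    if "X \<in> carrier_mat m m" for c X
    using that
    by (intro eq_matI) (auto simp: kraus_sum_index[OF E] kraus_sum_carrier[THEN carrier_matD(1)]
        kraus_sum_carrier[THEN carrier_matD(2)] sum_distrib_left mult_ac)
  moreover have "psd (tensor_id m n r (kraus_sum n I E) X)"
    if X: "X \<in> carrier_mat (m * r) (m * r)" "psd X" for r X
  proof -
    have T: "tensor_id m n r (kraus_sum n I E) X \<in> carrier_mat (n * r) (n * r)"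
      by (simp add: tensor_id_def)
    have herm: "adj X = X" using X(2) by (simp add: psd_def)
    have lt: "x * r + k mod r < n * r" if "x < n" "k < n' * r" for x k n n'
      using that by (cases "r = 0") (auto intro!: mult_add_less)
    have "adj (tensor_id m n r (kraus_sum n I E) X) = tensor_id m n r (kraus_sum n I E) X"
    proof (rule hermitianI[OF T])
      fix p q assume pq: "p < n * r" "q < n * r"
      have d: "p div r < n" "q div r < n" using pq by (auto simp: less_mult_imp_div_less)
      have Xc: "cnj (X $$ (j * r + q mod r, i * r + p mod r)) = X $$ (i * r + p mod r, j * r + q mod r)"
        if "i < m" "j < m" for i j
        using hermitian_index[OF herm X(1) lt[OF that(1) pq(1)] lt[OF that(2) pq(2)]] by simp
      have "cnj (tensor_id m n r (kraus_sum n I E) X $$ (q, p))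
        = (\<Sum>a\<in>I. \<Sum>j<m. \<Sum>i<m. cnj (E a $$ (q div r, i)) *
           X $$ (j * r + p mod r, i * r + q mod r) * E a $$ (p div r, j))"
        using pq d by (simp add: tensor_id_def kraus_sum_index[OF E] Xc)
      also have "\<dots> = (\<Sum>a\<in>I. \<Sum>i<m. \<Sum>j<m. cnj (E a $$ (q div r, i)) *
           X $$ (j * r + p mod r, i * r + q mod r) * E a $$ (p div r, j))"
        by (intro sum.cong refl sum.swap)
      also have "\<dots> = tensor_id m n r (kraus_sum n I E) X $$ (p, q)"
        using pq d by (simp add: tensor_id_def kraus_sum_index[OF E] mult_ac)
      finally show "cnj (tensor_id m n r (kraus_sum n I E) X $$ (q, p))
          = tensor_id m n r (kraus_sum n I E) X $$ (p, q)" .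
    qed
    then show ?thesis
      using X by (subst psd_iff_qform[OF T])
        (auto simp: qform_tensor_id_kraus_sum[OF E X(1)] psd_iff_qform[OF X(1)] intro!: sum_nonneg)
  qed
  ultimately show ?thesis unfolding quantum_channel_def by auto
qed

lemma kraus_sum_kraus_sum:
  assumes E: "\<And>a. a \<in> I \<Longrightarrow> E a \<in> carrier_mat k n" and F: "\<And>b. b \<in> L \<Longrightarrow> F b \<in> carrier_mat n m"
    and X: "X \<in> carrier_mat m m"
  shows "kraus_sum k I E (kraus_sum n L F X) = kraus_sum k (I \<times> L) (\<lambda>(a, b). E a * F b) X"
proof (rule eq_matI)
  fix p q assume "p < dim_row (kraus_sum k (I \<times> L) (\<lambda>(a, b). E a * F b) X)"
    "q < dim_col (kraus_sum k (I \<times> L) (\<lambda>(a, b). E a * F b) X)"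
  then have pq: "p < k" "q < k" by (auto simp: kraus_sum_def)
  have FXF: "F b * X * adj (F b) \<in> carrier_mat n n" if "b \<in> L" for b
    using F[OF that] X by auto
  have *: "(E a * F b) * X * adj (E a * F b)
      = E a * (F b * X * adj (F b)) * adj (E a)" if "a \<in> I" "b \<in> L" for a b
  proof -
    have c: "adj (E a) \<in> carrier_mat n k" "adj (F b) \<in> carrier_mat m n"
      using E[OF that(1)] F[OF that(2)] by auto
    then show ?thesis
      using E[OF that(1)] F[OF that(2)] X
      by (simp add: mat_adjoint_mult[of _ k n _ m] assoc_mult_mat[of _ k n _ m _ m]
          assoc_mult_mat[of _ k n _ n _ k] assoc_mult_mat[of _ k n _ m _ k]
          assoc_mult_mat[of _ k m _ n _ k] assoc_mult_mat[of _ n m _ m _ n]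
          assoc_mult_mat[of _ n m _ m _ k] assoc_mult_mat[of _ n m _ n _ k]
          assoc_mult_mat[of _ m m _ n _ k]
          mult_carrier_mat[of _ k n _ m] mult_carrier_mat[of _ n m _ m]
          mult_carrier_mat[of _ n m _ n] mult_carrier_mat[of _ m n _ k]
          mult_carrier_mat[of _ m m _ k] mult_carrier_mat[of _ m m _ n])
  qed
  have "kraus_sum k I E (kraus_sum n L F X) $$ (p, q) = (\<Sum>a\<in>I. \<Sum>j<n. \<Sum>i<n. \<Sum>b\<in>L.
      E a $$ (p, i) * (F b * X * adj (F b)) $$ (i, j) * cnj (E a $$ (q, j)))"
    using pq by (simp add: kraus_sum_index[OF E] sum_distrib_left sum_distrib_right)
      (simp add: kraus_sum_def sum_distrib_left sum_distrib_right)
  also have "\<dots> = (\<Sum>a\<in>I. \<Sum>b\<in>L. \<Sum>j<n. \<Sum>i<n.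
      E a $$ (p, i) * (F b * X * adj (F b)) $$ (i, j) * cnj (E a $$ (q, j)))"
    apply (simp only: sum.cartesian_product)
    apply (rule sum.reindex_bij_witness[where
          i = "\<lambda>(a, b, j, i). (a, j, i, b)" and j = "\<lambda>(a, j, i, b). (a, b, j, i)"])
    by auto
  also have "\<dots> = (\<Sum>a\<in>I. \<Sum>b\<in>L. ((E a * F b) * X * adj (E a * F b)) $$ (p, q))"
    using * conj_mat_index[OF E FXF pq] by (intro sum.cong refl) simp
  also have "\<dots> = kraus_sum k (I \<times> L) (\<lambda>(a, b). E a * F b) X $$ (p, q)"
    using pq by (simp add: kraus_sum_def sum.cartesian_product split_def)
  finally show "kraus_sum k I E (kraus_sum n L F X) $$ (p, q)
      = kraus_sum k (I \<times> L) (\<lambda>(a, b). E a * F b) X $$ (p, q)" .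
qed (auto simp: kraus_sum_def)


section \<open>Extensions by a reference system, composition and encoding\<close>

lemma tensor_id_carrier [simp]: "tensor_id m n r E X \<in> carrier_mat (n * r) (n * r)"
  by (simp add: tensor_id_def)

lemma tensor_id_id:
  assumes "X \<in> carrier_mat (m * r) (m * r)"
  shows "tensor_id m m r (\<lambda>\<rho>. \<rho>) X = X"
  using assms
  by (intro eq_matI) (auto simp: tensor_id_def less_mult_imp_div_less)

lemma mat_trace_tensor_id:
  assumes E: "quantum_channel m n E" and X: "X \<in> carrier_mat (m * r) (m * r)"
  shows "mat_trace (tensor_id m n r E X) = mat_trace X"
proof -
  note lt = mult_add_less
  let ?S = "\<lambda>k. mat m m (\<lambda>(i, j). X $$ (i * r + k, j * r + k))"
  have S: "E (?S k) \<in> carrier_mat n n" "mat_trace (E (?S k)) = mat_trace (?S k)" for k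
    using E by (auto simp: quantum_channel_def)
  have "mat_trace (tensor_id m n r E X) = (\<Sum>x<n. \<Sum>k<r. E (?S k) $$ (x, x))"
    by (simp add: mat_trace_def tensor_id_def sum_lessThan_mult lt)
  also have "\<dots> = (\<Sum>k<r. \<Sum>x<n. E (?S k) $$ (x, x))" by (rule sum.swap)
  also have "\<dots> = (\<Sum>k<r. mat_trace (E (?S k)))"
    using S(1)[THEN carrier_matD(1)] by (simp add: mat_trace_def)
  also have "\<dots> = (\<Sum>k<r. \<Sum>x<m. X $$ (x * r + k, x * r + k))"
    by (simp add: S(2)) (simp add: mat_trace_def)
  also have "\<dots> = (\<Sum>x<m. \<Sum>k<r. X $$ (x * r + k, x * r + k))" by (rule sum.swap)
  also have "\<dots> = mat_trace X" using X by (simp add: mat_trace_def sum_lessThan_mult)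
  finally show ?thesis .
qed

text \<open>Extension by the identity is functorial: each block of the extended \<open>F\<close> at
  fixed reference indices is \<open>F\<close> of the corresponding block, so complete positivity
  composes.\<close>

lemma quantum_channel_comp:
  assumes E: "quantum_channel n k E" and F: "quantum_channel m n F"
  shows "quantum_channel m k (E \<circ> F)"
proof -
  have FX: "F X \<in> carrier_mat n n" if "X \<in> carrier_mat m m" for X
    using F that by (auto simp: quantum_channel_def)
  have "tensor_id m k r (E \<circ> F) X = tensor_id n k r E (tensor_id m n r F X)" for r X
  proof (rule eq_matI)
    fix p q assume "p < dim_row (tensor_id n k r E (tensor_id m n r F X))"
      "q < dim_col (tensor_id n k r E (tensor_id m n r F X))"
    then have pq: "p < k * r" "q < k * r" by (auto simp: tensor_id_def)
    let ?S = "mat m m (\<lambda>(i, j). X $$ (i * r + p mod r, j * r + q mod r))"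
    have r: "r > 0" using pq by (cases r) auto
    have lt: "i * r + l mod r < n * r" if "i < n" for i l
      using that r by (intro mult_add_less) auto
    have dm: "(i * r + l mod r) div r = i" "(i * r + l mod r) mod r = l mod r" for i l
      using r by auto
    have "mat n n (\<lambda>(i, j). tensor_id m n r F X $$ (i * r + p mod r, j * r + q mod r)) = F ?S"
      using FX[of ?S] by (intro eq_matI) (auto simp: tensor_id_def lt dm)
    then show "tensor_id m k r (E \<circ> F) X $$ (p, q) = tensor_id n k r E (tensor_id m n r F X) $$ (p, q)"
      using pq by (simp add: tensor_id_def[of m k] tensor_id_def[of n k])
  qed (auto simp: tensor_id_def)
  then show ?thesis
    using E F unfolding quantum_channel_def by (auto simp: FX)
qed

lemma quantum_channel_cong:
  assumes "\<And>X. X \<in> carrier_mat m m \<Longrightarrow> E X = F X"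
  shows "quantum_channel m n E \<longleftrightarrow> quantum_channel m n F"
proof -
  have "tensor_id m n r E X = tensor_id m n r F X" for r X
    by (simp add: tensor_id_def assms)
  then show ?thesis unfolding quantum_channel_def
    using assms by auto
qed

lemma encoding_map_kraus_sum:
  assumes "V \<in> carrier_mat D m" "X \<in> carrier_mat m m"
  shows "encoding_map V X = kraus_sum D {()} (\<lambda>_. V) X"
  using assms by (auto simp: encoding_map_def kraus_sum_def intro!: eq_matI)

lemma quantum_channel_encoding_map:
  assumes V: "V \<in> carrier_mat D m" "adj V * V = 1\<^sub>m m"
  shows "quantum_channel m D (encoding_map V)"
proof -
  have V': "adj V \<in> carrier_mat m D" using V by auto
  have "quantum_channel m D (kraus_sum D {()} (\<lambda>_. V))"
  proof (rule quantum_channel_kraus_sum)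
    fix i j assume ij: "i < m" "j < m"
    have "(\<Sum>x<D. V $$ (x, i) * cnj (V $$ (x, j))) = (adj V * V) $$ (j, i)"
      unfolding index_mult_mat_sum[OF V' V(1) ij(2,1)]
      using V(1) ij by (intro sum.cong refl) (simp add: mat_adjoint_index)
    then show "(\<Sum>a\<in>{()}. \<Sum>x<D. V $$ (x, i) * cnj (V $$ (x, j))) = (if i = j then 1 else 0)"
      using ij by (simp add: V(2))
  qed (use V in auto)
  then show ?thesis
    using quantum_channel_cong[of m "encoding_map V"] encoding_map_kraus_sum[OF V(1)] by metis
qed

section \<open>From overlaps to the code inaccuracy\<close>

lemma channel_overlap_bounds:
  assumes E: "quantum_channel m m E" and v: "v \<in> carrier_vec (m * m)" "v \<bullet>c v = 1"
  shows "fidelity (tensor_id m m m E (pure_state v)) (tensor_id m m m (\<lambda>\<rho>. \<rho>) (pure_state v))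
      = sqrt (Re (qform (m * m) (tensor_id m m m E (pure_state v)) (\<lambda>i. v $ i)))"
    "0 \<le> Re (qform (m * m) (tensor_id m m m E (pure_state v)) (\<lambda>i. v $ i))"
    "Re (qform (m * m) (tensor_id m m m E (pure_state v)) (\<lambda>i. v $ i)) \<le> 1"
proof -
  let ?T = "tensor_id m m m E (pure_state v)"
  have T: "?T \<in> carrier_mat (m * m) (m * m)" by simp
  have psd: "psd ?T"
    using E psd_pure_state[OF v(1)] pure_state_carrier[OF v(1)] by (auto simp: quantum_channel_def)
  show "fidelity ?T (tensor_id m m m (\<lambda>\<rho>. \<rho>) (pure_state v)) = sqrt (Re (qform (m * m) ?T (\<lambda>i. v $ i)))"
    using fidelity_pure_state[OF T psd v(1)] tensor_id_id[OF pure_state_carrier[OF v(1)]] by simp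
  show "0 \<le> Re (qform (m * m) ?T (\<lambda>i. v $ i))"
    using psd psd_iff_qform[OF T] by blast
  have "mat_trace ?T = 1"
    using mat_trace_tensor_id[OF E pure_state_carrier[OF v(1)]] mat_trace_pure_state[OF v(1)] v(2)
    by simp
  moreover have "(\<Sum>i<m * m. (cmod (v $ i))\<^sup>2) = 1"
    using cscalar_prod_self[OF v(1)] v(2) by (metis of_real_eq_1_iff)
  ultimately show "Re (qform (m * m) ?T (\<lambda>i. v $ i)) \<le> 1"
    using qform_psd_le_trace[OF T psd, of "\<lambda>i. v $ i"] by simp
qed

text \<open>Against the identity every fidelity is the square root of an overlap in the unit
  interval, so the family under \<open>SUP\<close> is bounded, and \<open>m > 0\<close> supplies a
  unit vector that makes it nonempty.\<close>

lemma purified_distance_channel_id: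
  assumes E: "quantum_channel m m E" and m: "m > 0"
  shows "0 \<le> purified_distance m E (\<lambda>\<rho>. \<rho>)"
    and "(\<And>v. v \<in> carrier_vec (m * m) \<Longrightarrow> v \<bullet>c v = 1 \<Longrightarrow>
        Re (qform (m * m) (tensor_id m m m E (pure_state v)) (\<lambda>i. v $ i)) \<ge> 1 - c)
      \<Longrightarrow> purified_distance m E (\<lambda>\<rho>. \<rho>) \<le> sqrt c"
proof -
  let ?A = "{v. v \<in> carrier_vec (m * m) \<and> v \<bullet>c v = (1 :: complex)}"
  let ?q = "\<lambda>v. Re (qform (m * m) (tensor_id m m m E (pure_state v)) (\<lambda>i. v $ i))"
  let ?f = "\<lambda>v. sqrt (1 - (fidelity (tensor_id m m m E (pure_state v))
                            (tensor_id m m m (\<lambda>\<rho>. \<rho>) (pure_state v)))\<^sup>2)"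
  have f: "?f v = sqrt (1 - ?q v)" if "v \<in> ?A" for v
    using channel_overlap_bounds[OF E] that by simp
  have unit: "unit_vec (m * m) 0 \<in> ?A" using m by auto
  have "bdd_above (?f ` ?A)"
    using f channel_overlap_bounds(2)[OF E] by (intro bdd_aboveI2[of _ _ 1]) auto
  moreover have "0 \<le> ?f (unit_vec (m * m) 0)"
    using f[OF unit] channel_overlap_bounds(3)[OF E, of "unit_vec (m * m) 0"] unit by simp
  ultimately show "0 \<le> purified_distance m E (\<lambda>\<rho>. \<rho>)"
    unfolding purified_distance_def by (intro cSUP_upper2[OF _ unit])
  assume *: "\<And>v. v \<in> carrier_vec (m * m) \<Longrightarrow> v \<bullet>c v = 1 \<Longrightarrow> ?q v \<ge> 1 - c"
  show "purified_distance m E (\<lambda>\<rho>. \<rho>) \<le> sqrt c"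
    unfolding purified_distance_def
  proof (rule cSUP_least)
    show "?f v \<le> sqrt c" if "v \<in> ?A" for v
      unfolding f[OF that] using *[of v] that by simp
  qed (use unit in blast)
qed

text \<open>Any recovery bounds the infimum from above once the distances are bounded below, which
  nonnegativity of the purified distance provides.\<close>

lemma code_inaccuracy_le:
  assumes V: "V \<in> carrier_mat D m" "adj V * V = 1\<^sub>m m" and m: "m > 0"
    and Noise: "quantum_channel D D Noise" and R: "quantum_channel D m R"
    and q: "\<And>v. v \<in> carrier_vec (m * m) \<Longrightarrow> v \<bullet>c v = 1 \<Longrightarrow>
        Re (qform (m * m) (tensor_id m m m (R \<circ> Noise \<circ> encoding_map V) (pure_state v)) (\<lambda>i. v $ i))
          \<ge> 1 - c"
  shows "code_inaccuracy m D V Noise \<le> sqrt c"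
proof -
  have ch: "quantum_channel m m (R' \<circ> Noise \<circ> encoding_map V)" if "quantum_channel D m R'" for R'
    using quantum_channel_comp[OF quantum_channel_comp[OF that Noise] quantum_channel_encoding_map[OF V]] .
  have "bdd_below ((\<lambda>Rec. purified_distance m (Rec \<circ> Noise \<circ> encoding_map V) (\<lambda>\<rho>. \<rho>))
      ` {Rec. quantum_channel D m Rec})"
    using purified_distance_channel_id(1)[OF ch m] by (intro bdd_belowI2[of _ 0]) auto
  then have "code_inaccuracy m D V Noise \<le> purified_distance m (R \<circ> Noise \<circ> encoding_map V) (\<lambda>\<rho>. \<rho>)"
    unfolding code_inaccuracy_def using R by (intro cINF_lower) auto
  also have "\<dots> \<le> sqrt c" by (rule purified_distance_channel_id(2)[OF ch[OF R] m q])
  finally show ?thesis .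
qed

text \<open>Entanglement fidelity: the inner sum over \<open>k\<close> is the reduced state of
  \<open>v\<close>, and each Kraus operator contributes the squared modulus of its trace against
  that state.\<close>

lemma qform_tensor_id_pure_state:
  assumes E: "\<And>a. a \<in> I \<Longrightarrow> E a \<in> carrier_mat m m" and v: "v \<in> carrier_vec (m * m)"
  shows "Re (qform (m * m) (tensor_id m m m (kraus_sum m I E) (pure_state v)) (\<lambda>i. v $ i))
    = (\<Sum>a\<in>I. (cmod (\<Sum>i<m. \<Sum>x<m. E a $$ (x, i) * (\<Sum>k<m. cnj (v $ (x * m + k)) * v $ (i * m + k))))\<^sup>2)"
proof -
  have "(\<Sum>q<m * m. cnj (\<Sum>x<m. cnj (E a $$ (x, q div m)) * v $ (x * m + q mod m)) * v $ q)
      = (\<Sum>i<m. \<Sum>x<m. E a $$ (x, i) * (\<Sum>k<m. cnj (v $ (x * m + k)) * v $ (i * m + k)))" for a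
  proof -
    have "(\<Sum>q<m * m. cnj (\<Sum>x<m. cnj (E a $$ (x, q div m)) * v $ (x * m + q mod m)) * v $ q)
        = (\<Sum>i<m. \<Sum>k<m. \<Sum>x<m. E a $$ (x, i) * (cnj (v $ (x * m + k)) * v $ (i * m + k)))"
      by (simp add: sum_lessThan_mult sum_distrib_left sum_distrib_right mult_ac)
    also have "\<dots> = (\<Sum>i<m. \<Sum>x<m. \<Sum>k<m. E a $$ (x, i) * (cnj (v $ (x * m + k)) * v $ (i * m + k)))"
      by (intro sum.cong refl sum.swap)
    finally show ?thesis by (simp add: sum_distrib_left)
  qed
  then show ?thesis
    by (simp add: qform_tensor_id_kraus_sum[OF E pure_state_carrier[OF v]] qform_pure_state[OF v]
        del: of_real_power)
qed

section \<open>Recovery from noise on a tensor factor\<close>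

text \<open>The missing weight \<open>Q\<close>, the identity minus all
  \<open>adj (R a) * R a\<close>, is positive by \<open>contr\<close>. Each row of its root becomes
  an operator that maps everything to the logical basis vector 0; together these contribute exactly
  \<open>Q\<close>.\<close>

lemma kraus_completion:
  fixes R :: "'a \<Rightarrow> complex mat"
  assumes fin: "finite I" and m: "m > 0" and R: "\<And>a. a \<in> I \<Longrightarrow> R a \<in> carrier_mat m D"
    and contr: "\<And>f. (\<Sum>a\<in>I. \<Sum>l<m. (cmod (\<Sum>y<D. R a $$ (l, y) * f y))\<^sup>2) \<le> (\<Sum>y<D. (cmod (f y))\<^sup>2)"
  obtains E :: "'a + nat \<Rightarrow> complex mat" where
    "\<And>b. b \<in> I <+> {..<D} \<Longrightarrow> E b \<in> carrier_mat m D"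
    "\<And>a. a \<in> I \<Longrightarrow> E (Inl a) = R a"
    "quantum_channel D m (kraus_sum m (I <+> {..<D}) E)"
proof -
  define Q where "Q = mat D D (\<lambda>(y, z). (if y = z then 1 else 0)
      - (\<Sum>a\<in>I. (adj (R a) * R a) $$ (y, z)))"
  have Q: "Q \<in> carrier_mat D D" by (simp add: Q_def)
  have RR: "adj (R a) * R a \<in> carrier_mat D D" "adj (adj (R a) * R a) = adj (R a) * R a" if "a \<in> I" for a
    using R[OF that] psd_gram[OF R[OF that]] by (auto simp: psd_def)
  have "adj Q = Q"
  proof (rule hermitianI[OF Q])
    fix y z assume yz: "y < D" "z < D"
    have "(\<Sum>a\<in>I. (adj (R a) * R a) $$ (y, z)) = cnj (\<Sum>a\<in>I. (adj (R a) * R a) $$ (z, y))"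
      unfolding cnj_sum by (rule sum.cong[OF refl], rule hermitian_index[OF RR(2,1) yz])
    then show "cnj (Q $$ (z, y)) = Q $$ (y, z)"
      using yz by (simp add: Q_def del: index_mult_mat(1))
  qed
  moreover have "Re (qform D Q f) \<ge> 0" for f
  proof -
    have "qform D Q f = (\<Sum>y<D. \<Sum>z<D. (if z = y then cnj (f y) * f z else 0)
        - (\<Sum>a\<in>I. cnj (f y) * (adj (R a) * R a) $$ (y, z) * f z))"
      unfolding qform_def
      by (intro sum.cong refl) (simp add: Q_def left_diff_distrib right_diff_distrib
          sum_distrib_left sum_distrib_right del: index_mult_mat(1))
    also have "\<dots> = (\<Sum>y<D. cnj (f y) * f y) - (\<Sum>a\<in>I. qform D (adj (R a) * R a) f)"
      unfolding qform_def sum_rotate[of _ _ _ I] by (simp add: sum_subtractf del: index_mult_mat(1))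
    also have "\<dots> = complex_of_real ((\<Sum>y<D. (cmod (f y))\<^sup>2)
        - (\<Sum>a\<in>I. \<Sum>l<m. (cmod (\<Sum>y<D. R a $$ (l, y) * f y))\<^sup>2))"
      using qform_gram[OF R] by (simp add: complex_norm_square mult.commute flip: of_real_power)
    finally show ?thesis using contr[of f] by simp
  qed
  ultimately have "psd Q" using psd_iff_qform[OF Q] by blast
  then obtain W where W: "W \<in> carrier_mat D D" "psd W" "W * W = Q"
    using psd_sqrt_exists[OF Q] by blast
  have herm: "adj W = W" using W(2) by (simp add: psd_def)
  define E where "E b = (case b of Inl a \<Rightarrow> R a
      | Inr x \<Rightarrow> mat m D (\<lambda>(l, y). if l = 0 then W $$ (x, y) else 0))" for b
  have E: "E b \<in> carrier_mat m D" if "b \<in> I <+> {..<D}" for b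
    using that R by (auto simp: E_def)
  have "(\<Sum>b\<in>I <+> {..<D}. \<Sum>x<m. E b $$ (x, i) * cnj (E b $$ (x, j))) = (if i = j then 1 else 0)"
    if ij: "i < D" "j < D" for i j
  proof -
    have "(\<Sum>b\<in>I <+> {..<D}. \<Sum>x<m. E b $$ (x, i) * cnj (E b $$ (x, j)))
        = (\<Sum>a\<in>I. \<Sum>x<m. R a $$ (x, i) * cnj (R a $$ (x, j)))
        + (\<Sum>y<D. \<Sum>x<m. E (Inr y) $$ (x, i) * cnj (E (Inr y) $$ (x, j)))"
      using fin by (simp add: sum.Plus) (simp add: E_def)
    also have "(\<Sum>y<D. \<Sum>x<m. E (Inr y) $$ (x, i) * cnj (E (Inr y) $$ (x, j)))
        = (\<Sum>y<D. W $$ (y, i) * cnj (W $$ (y, j)))"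
    proof (rule sum.cong[OF refl])
      fix y
      have "(\<Sum>x<m. E (Inr y) $$ (x, i) * cnj (E (Inr y) $$ (x, j)))
          = (\<Sum>x<m. if x = 0 then W $$ (y, i) * cnj (W $$ (y, j)) else 0)"
        using ij by (intro sum.cong refl) (simp add: E_def)
      then show "(\<Sum>x<m. E (Inr y) $$ (x, i) * cnj (E (Inr y) $$ (x, j)))
          = W $$ (y, i) * cnj (W $$ (y, j))"
        using m by simp
    qed
    also have "\<dots> = (\<Sum>y<D. W $$ (j, y) * W $$ (y, i))"
    proof (rule sum.cong[OF refl])
      fix y assume "y \<in> {..<D}"
      then have "W $$ (j, y) = cnj (W $$ (y, j))"
        using hermitian_index[OF herm W(1) ij(2)] by simp
      then show "W $$ (y, i) * cnj (W $$ (y, j)) = W $$ (j, y) * W $$ (y, i)" by simp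
    qed
    also have "\<dots> = Q $$ (j, i)"
      unfolding W(3)[symmetric] by (rule index_mult_mat_sum[OF W(1,1) ij(2,1), symmetric])
    also have "\<dots> = (if i = j then 1 else 0) - (\<Sum>a\<in>I. \<Sum>l<m. R a $$ (l, i) * cnj (R a $$ (l, j)))"
    proof -
      have "(adj (R a) * R a) $$ (j, i) = (\<Sum>l<m. R a $$ (l, i) * cnj (R a $$ (l, j)))" if "a \<in> I" for a
        unfolding index_mult_mat_sum[OF mat_adjoint_carrier[OF R[OF that]] R[OF that] ij(2,1)]
        using R[OF that] ij by (intro sum.cong refl) (simp add: mat_adjoint_index mult.commute)
      then show ?thesis using ij by (auto simp: Q_def simp del: index_mult_mat(1))
    qed
    finally show ?thesis by simp
  qed
  then have "quantum_channel D m (kraus_sum m (I <+> {..<D}) E)"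
    by (intro quantum_channel_kraus_sum E)
  moreover have "E (Inl a) = R a" for a by (simp add: E_def)
  ultimately show ?thesis using that E by blast
qed

text \<open>Inserting a root \<open>S\<close> of \<open>H\<close> turns the trace of
  \<open>H * M\<close> into the sum of the forms of \<open>M\<close> at the columns of
  \<open>S\<close>.\<close>

lemma trace_mult_psd:
  assumes H: "H \<in> carrier_mat n n" "psd H" and M: "M \<in> carrier_mat n n"
    and pos: "\<And>f. Re (qform n M f) \<ge> 0"
  shows "Re (\<Sum>p<n. \<Sum>q<n. H $$ (p, q) * M $$ (q, p)) \<ge> 0"
proof -
  obtain S where S: "S \<in> carrier_mat n n" "psd S" "S * S = H"
    using psd_sqrt_exists[OF H] by blast
  have herm: "adj S = S" using S(2) by (simp add: psd_def)
  note Sc = hermitian_index[OF herm S(1)]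
  have "(\<Sum>p<n. \<Sum>q<n. H $$ (p, q) * M $$ (q, p))
      = (\<Sum>p<n. \<Sum>q<n. \<Sum>t<n. S $$ (p, t) * S $$ (t, q) * M $$ (q, p))"
    unfolding S(3)[symmetric]
    by (intro sum.cong refl) (simp add: index_mult_mat_sum[OF S(1,1)] sum_distrib_right del: index_mult_mat(1))
  also have "\<dots> = (\<Sum>t<n. \<Sum>q<n. \<Sum>p<n. S $$ (p, t) * S $$ (t, q) * M $$ (q, p))"
    apply (simp only: sum.cartesian_product)
    apply (rule sum.reindex_bij_witness[where
          i = "\<lambda>(t, q, p). (p, q, t)" and j = "\<lambda>(p, q, t). (t, q, p)"])
    by auto
  also have "\<dots> = (\<Sum>t<n. qform n M (\<lambda>p. S $$ (p, t)))"
    unfolding qform_def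
  proof (intro sum.cong refl)
    fix t q p assume "t \<in> {..<n}" "q \<in> {..<n}"
    then have "S $$ (t, q) = cnj (S $$ (q, t))" by (intro Sc) auto
    then show "S $$ (p, t) * S $$ (t, q) * M $$ (q, p) = cnj (S $$ (q, t)) * M $$ (q, p) * S $$ (p, t)"
      by (simp only: mult_ac)
  qed
  finally show ?thesis using pos by (simp add: sum_nonneg)
qed

text \<open>The lower bound excludes a kernel. The inverse is hermitian, and
  \<open>H = adj H * G * H\<close> is a congruence of \<open>G\<close>, hence positive.\<close>

lemma pos_def_inverse:
  assumes G: "G \<in> carrier_mat n n" "adj G = G"
    and pos: "\<And>f. Re (qform n G f) \<ge> d * (\<Sum>i<n. (cmod (f i))\<^sup>2)" and d: "d > 0"
  obtains H where "H \<in> carrier_mat n n" "psd H" "H * G = 1\<^sub>m n" "G * H = 1\<^sub>m n"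
proof -
  have "det G \<noteq> 0"
  proof
    assume "det G = 0"
    then obtain v where v: "v \<in> carrier_vec n" "v \<noteq> 0\<^sub>v n" "G *\<^sub>v v = 0\<^sub>v n"
      using det_0_iff_vec_prod_zero_field[OF G(1)] by auto
    have "d * (\<Sum>i<n. (cmod (v $ i))\<^sup>2) \<le> 0"
      using pos[of "\<lambda>i. v $ i"] qform_vec[OF G(1) v(1)] v by simp
    then have "(\<Sum>i<n. (cmod (v $ i))\<^sup>2) \<le> 0"
      using d by (simp add: mult_le_0_iff)
    moreover have "(\<Sum>i<n. (cmod (v $ i))\<^sup>2) \<ge> 0" by (intro sum_nonneg) auto
    ultimately have "v \<bullet>c v = 0" using cscalar_prod_self[OF v(1)] by simp
    then show False using v conjugate_square_eq_0_vec[OF v(1)] by simp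
  qed
  then obtain H where H: "H \<in> carrier_mat n n" "H * G = 1\<^sub>m n" "G * H = 1\<^sub>m n"
    using det_non_zero_imp_unit[OF G(1), of "TYPE(complex)"]
    by (auto simp: Units_def ring_mat_simps)
  have H': "adj H \<in> carrier_mat n n" using H by auto
  have "adj H * G = 1\<^sub>m n"
    using mat_adjoint_mult[OF G(1) H(1)] H(3) G(2) by simp
  then have "adj H = adj H * (G * H)" using H H' by simp
  also have "\<dots> = (adj H * G) * H" using G H H' by (simp add: assoc_mult_mat[of _ n n _ n _ n])
  also have "\<dots> = H" using H \<open>adj H * G = 1\<^sub>m n\<close> by simp
  finally have herm: "adj H = H" .
  have "psd G"
  proof -
    have "0 \<le> d * (\<Sum>i<n. (cmod (f i))\<^sup>2)" for f :: "nat \<Rightarrow> complex"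
      using d by (intro mult_nonneg_nonneg sum_nonneg) auto
    then have "Re (qform n G f) \<ge> 0" for f using pos[of f] order.trans by blast
    then show ?thesis using G(2) by (simp add: psd_iff_qform[OF G(1)])
  qed
  then have "psd (adj H * G * H)" by (rule psd_conj[OF G(1) _ H(1)])
  then have "psd H" using H herm by simp
  with H that show ?thesis by blast
qed

lemma orthonormal_coefficient:
  fixes k :: "'i \<Rightarrow> complex vec"
  assumes "finite L" and k: "\<And>j. j \<in> L \<Longrightarrow> k j \<in> carrier_vec D"
    and orth: "\<And>i j. i \<in> L \<Longrightarrow> j \<in> L \<Longrightarrow> k i \<bullet>c k j = (if i = j then 1 else 0)" and i: "i \<in> L"
  shows "(\<Sum>y<D. (\<Sum>j\<in>L. a j * k j $ y) * cnj (k i $ y)) = a i"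
proof -
  have "(\<Sum>y<D. (\<Sum>j\<in>L. a j * k j $ y) * cnj (k i $ y)) = (\<Sum>j\<in>L. a j * (k j \<bullet>c k i))"
    unfolding sum_distrib_right
    by (subst sum.swap) (simp add: cscalar_prod_sum[OF k[OF i]] sum_distrib_left mult.assoc)
  also have "\<dots> = (\<Sum>j\<in>L. if j = i then a j else 0)"
    using orth i by (intro sum.cong) auto
  finally show ?thesis using i assms(1) by simp
qed

text \<open>
  The physical space is \<open>C^nS \<otimes> C^nR\<close> with product basis \<open>e p r\<close>, the noise acts on the first
  factor, and the code is spanned by the orthonormal vectors \<open>k i\<close>. Hypothesis \<open>cross\<close> says that
  no operator on the first factor connects different \<open>k i\<close>.
\<close>

locale factor_code =
  fixes nS nR D m :: nat and e :: "nat \<Rightarrow> nat \<Rightarrow> nat" and L :: "'i set" and k :: "'i \<Rightarrow> complex vec"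
    and V :: "complex mat"
  assumes bij: "bij_betw (\<lambda>(p, r). e p r) ({..<nS} \<times> {..<nR}) {..<D}"
    and finL: "finite L"
    and k: "\<And>i. i \<in> L \<Longrightarrow> k i \<in> carrier_vec D"
    and orth: "\<And>i j. i \<in> L \<Longrightarrow> j \<in> L \<Longrightarrow> k i \<bullet>c k j = (if i = j then 1 else 0)"
    and cross: "\<And>i j p q. i \<in> L \<Longrightarrow> j \<in> L \<Longrightarrow> i \<noteq> j \<Longrightarrow> p < nS \<Longrightarrow> q < nS \<Longrightarrow>
      (\<Sum>r<nR. cnj (k i $ e p r) * k j $ e q r) = 0"
    and V: "V \<in> carrier_mat D m" "adj V * V = 1\<^sub>m m"
    and rangeV: "\<And>i. i \<in> L \<Longrightarrow> k i \<in> (\<lambda>x. V *\<^sub>v x) ` carrier_vec m"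
    and spanV: "\<And>x. x \<in> carrier_vec m \<Longrightarrow> \<exists>a. \<forall>y<D. (V *\<^sub>v x) $ y = (\<Sum>i\<in>L. a i * k i $ y)"
begin

lemma e_less: "p < nS \<Longrightarrow> r < nR \<Longrightarrow> e p r < D"
  using bij by (auto simp: bij_betw_def)

lemma e_inj: "p < nS \<Longrightarrow> r < nR \<Longrightarrow> q < nS \<Longrightarrow> t < nR \<Longrightarrow> e p r = e q t \<longleftrightarrow> p = q \<and> r = t"
  using bij by (auto simp: bij_betw_def inj_on_def)

lemmas sum_D = sum_bij_betw_Times[OF bij]

definition T :: "'i \<Rightarrow> complex mat" where
  "T i = mat nR nS (\<lambda>(r, p). k i $ e p r)"

text \<open>The complex conjugate of the reduced state of \<open>k i\<close> on the first factor;
  conjugation affects neither its trace nor positivity.\<close>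

definition Gm :: "'i \<Rightarrow> complex mat" where
  "Gm i = adj (T i) * T i"

lemma T_carrier [simp]: "T i \<in> carrier_mat nR nS" by (simp add: T_def)

lemma T_adj_carrier [simp]: "adj (T i) \<in> carrier_mat nS nR" by (simp add: T_def)

lemma Gm_carrier [simp]: "Gm i \<in> carrier_mat nS nS" 
  unfolding Gm_def using T_adj_carrier T_carrier by (rule mult_carrier_mat)

text \<open>This is \<open>cross\<close> in matrix form: the ranges of different \<open>T i\<close>
  in the untouched factor are orthogonal. A recovery acting there alone can therefore tell the code
  words apart coherently.\<close>

lemma T_adj_T:
  assumes "i \<in> L" "j \<in> L"
  shows "adj (T i) * T j = (if i = j then Gm i else 0\<^sub>m nS nS)"
proof (cases "i = j")
  case False
  then show ?thesis
  proof (intro eq_matI)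
    fix p q assume "p < dim_row (if i = j then Gm i else 0\<^sub>m nS nS)"
      "q < dim_col (if i = j then Gm i else 0\<^sub>m nS nS)"
    then have pq: "p < nS" "q < nS" using False by auto
    have "(adj (T i) * T j) $$ (p, q) = (\<Sum>r<nR. cnj (k i $ e p r) * k j $ e q r)"
      unfolding index_mult_mat_sum[OF T_adj_carrier T_carrier pq]
      using pq by (intro sum.cong refl) (subst mat_adjoint_index, auto simp: T_def)
    then show "(adj (T i) * T j) $$ (p, q) = (if i = j then Gm i else 0\<^sub>m nS nS) $$ (p, q)"
      using cross[OF assms False pq] False pq by simp
  qed (auto simp: T_def Gm_def)
qed (simp add: Gm_def)

lemma Gm_index:
  "p < nS \<Longrightarrow> q < nS \<Longrightarrow> Gm i $$ (p, q) = (\<Sum>r<nR. cnj (k i $ e p r) * k i $ e q r)"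
  unfolding Gm_def
  by (subst index_mult_mat_sum[OF T_adj_carrier T_carrier], simp, simp, intro sum.cong refl,
      subst mat_adjoint_index, auto simp: T_def)

lemma trace_Gm:
  assumes "i \<in> L"
  shows "(\<Sum>p<nS. Gm i $$ (p, p)) = 1"
proof -
  have "(\<Sum>p<nS. Gm i $$ (p, p)) = k i \<bullet>c k i"
    by (simp add: Gm_index cscalar_prod_sum[OF k[OF assms]] sum_D mult.commute)
  then show ?thesis using orth[OF assms assms] by simp
qed

lemma Gm_herm: "adj (Gm i) = Gm i"
  using psd_gram[OF T_carrier] by (simp add: Gm_def psd_def)

lemma qform_Gm: "qform nS (Gm i) f = complex_of_real (\<Sum>r<nR. (cmod (\<Sum>p<nS. k i $ e p r * f p))\<^sup>2)"
  unfolding Gm_def qform_gram[OF T_carrier] by (simp add: T_def)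

text \<open>The logical preimage of \<open>k i\<close>; these vectors turn out to be an orthonormal
  basis of the logical space.\<close>

definition c :: "'i \<Rightarrow> complex vec" where
  "c i = adj V *\<^sub>v k i"

lemma c_carrier [simp]: "i \<in> L \<Longrightarrow> c i \<in> carrier_vec m"
  using mult_mat_vec_carrier[OF mat_adjoint_carrier[OF V(1)] k] by (simp add: c_def)

lemma V_c: "i \<in> L \<Longrightarrow> V *\<^sub>v c i = k i"
proof -
  assume i: "i \<in> L"
  obtain x where x: "x \<in> carrier_vec m" "k i = V *\<^sub>v x" using rangeV[OF i] by auto
  have "c i = (adj V * V) *\<^sub>v x"
    unfolding c_def x(2) by (rule assoc_mult_mat_vec[symmetric, OF mat_adjoint_carrier[OF V(1)] V(1) x(1)])
  then show ?thesis using V(2) x by simp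
qed

lemma c_orth: "i \<in> L \<Longrightarrow> j \<in> L \<Longrightarrow> (\<Sum>l<m. c i $ l * cnj (c j $ l)) = (if i = j then 1 else 0)"
proof -
  assume ij: "i \<in> L" "j \<in> L"
  have "c i \<bullet>c c j = (V *\<^sub>v c i) \<bullet>c k j"
    using cscalar_prod_mat_adjoint[OF V(1) c_carrier[OF ij(1)] k[OF ij(2)]] by (simp add: c_def)
  then show ?thesis using V_c[OF ij(1)] orth[OF ij] cscalar_prod_sum[OF c_carrier[OF ij(2)]] by metis
qed

text \<open>Every column of \<open>V\<close> lies in the span of the \<open>k i\<close>, and
  orthonormality identifies its coefficients, so that \<open>V\<close> is the sum of all
  \<open>|k i><c i|\<close>.\<close>

lemma V_index:
  assumes y: "y < D" and l: "l < m"
  shows "V $$ (y, l) = (\<Sum>i\<in>L. k i $ y * cnj (c i $ l))"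
proof -
  let ?u = "unit_vec m l :: complex vec"
  obtain a where a: "\<And>y. y < D \<Longrightarrow> (V *\<^sub>v ?u) $ y = (\<Sum>i\<in>L. a i * k i $ y)"
    using spanV[of ?u] by auto
  have "a i = cnj (c i $ l)" if i: "i \<in> L" for i
  proof -
    have "a i = (V *\<^sub>v ?u) \<bullet>c k i"
      using orthonormal_coefficient[OF finL k orth i, of a]
      by (simp add: cscalar_prod_sum[OF k[OF i]] a del: index_mult_mat_vec)
    then have "a i = ?u \<bullet>c c i"
      using cscalar_prod_mat_adjoint[OF V(1) _ k[OF i], of ?u] by (simp add: c_def)
    also have "\<dots> = (\<Sum>x<m. if x = l then cnj (c i $ x) else 0)"
      unfolding cscalar_prod_sum[OF c_carrier[OF i]] using l by (intro sum.cong) auto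
    finally show ?thesis using l by simp
  qed
  then have "(V *\<^sub>v ?u) $ y = (\<Sum>i\<in>L. k i $ y * cnj (c i $ l))"
    using a[OF y] by (simp add: mult.commute)
  moreover have "(V *\<^sub>v ?u) $ y = V $$ (y, l)" using V(1) y l by simp
  ultimately show ?thesis by simp
qed

lemma c_complete:
  assumes xl: "x < m" "l < m"
  shows "(\<Sum>i\<in>L. c i $ x * cnj (c i $ l)) = (if x = l then 1 else 0)"
proof -
  have V': "adj V \<in> carrier_mat m D" using V by auto
  have "(adj V * V) $$ (x, l) = (\<Sum>y<D. \<Sum>i\<in>L. adj V $$ (x, y) * (k i $ y * cnj (c i $ l)))"
    unfolding index_mult_mat_sum[OF V' V(1) xl] using xl
    by (intro sum.cong refl) (simp add: V_index sum_distrib_left)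
  also have "\<dots> = (\<Sum>i\<in>L. (\<Sum>y<D. adj V $$ (x, y) * k i $ y) * cnj (c i $ l))"
    by (subst sum.swap) (simp add: sum_distrib_right mult.assoc)
  also have "\<dots> = (\<Sum>i\<in>L. c i $ x * cnj (c i $ l))"
    unfolding c_def using index_mult_mat_vec_sum[OF V' k xl(1)]
    by (intro sum.cong refl) simp
  finally show ?thesis using V(2) xl by simp
qed

lemma c_parseval:
  shows "(\<Sum>l<m. (cmod (\<Sum>i\<in>L. c i $ l * a i))\<^sup>2) = (\<Sum>i\<in>L. (cmod (a i))\<^sup>2)"
proof -
  have "complex_of_real (\<Sum>l<m. (cmod (\<Sum>i\<in>L. c i $ l * a i))\<^sup>2)
      = (\<Sum>l<m. (\<Sum>i\<in>L. c i $ l * a i) * (\<Sum>j\<in>L. cnj (c j $ l * a j)))"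
    by (simp add: complex_norm_square flip: of_real_power)
  also have "\<dots> = (\<Sum>l<m. \<Sum>i\<in>L. \<Sum>j\<in>L. a i * cnj (a j) * (c i $ l * cnj (c j $ l)))"
    by (simp only: sum_product) (simp add: mult_ac)
  also have "\<dots> = (\<Sum>i\<in>L. \<Sum>j\<in>L. \<Sum>l<m. a i * cnj (a j) * (c i $ l * cnj (c j $ l)))"
    by (rule sum_rotate)
  also have "\<dots> = (\<Sum>i\<in>L. \<Sum>j\<in>L. if j = i then a i * cnj (a i) else 0)"
    by (intro sum.cong refl) (simp add: c_orth flip: sum_distrib_left)
  also have "\<dots> = complex_of_real (\<Sum>i\<in>L. (cmod (a i))\<^sup>2)"
    using finL by (simp add: complex_norm_square flip: of_real_power)
  finally show ?thesis by (simp only: of_real_eq_iff)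
qed


lemma qform_shift:
  fixes \<delta> :: real
  shows "qform nS (Gm i0 + complex_of_real \<delta> \<cdot>\<^sub>m 1\<^sub>m nS) f
    = qform nS (Gm i0) f + complex_of_real (\<delta> * (\<Sum>p<nS. (cmod (f p))\<^sup>2))"
proof -
  have "qform nS (Gm i0 + complex_of_real \<delta> \<cdot>\<^sub>m 1\<^sub>m nS) f
      = (\<Sum>p<nS. \<Sum>q<nS. cnj (f p) * Gm i0 $$ (p, q) * f q
          + (if q = p then complex_of_real \<delta> * (cnj (f p) * f p) else 0))"
    unfolding qform_def by (intro sum.cong refl) (auto simp: algebra_simps)
  also have "\<dots> = qform nS (Gm i0) f + (\<Sum>p<nS. complex_of_real \<delta> * (cnj (f p) * f p))"
    by (simp add: sum.distrib qform_def)
  also have "(\<Sum>p<nS. complex_of_real \<delta> * (cnj (f p) * f p))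
      = complex_of_real (\<delta> * (\<Sum>p<nS. (cmod (f p))\<^sup>2))"
    by (simp add: sum_distrib_left complex_norm_square mult_ac flip: of_real_power)
  finally show ?thesis .
qed

context
  fixes i0 :: 'i and \<delta> :: real and H :: "complex mat"
  assumes i0: "i0 \<in> L" and \<delta>: "\<delta> > 0"
    and H: "H \<in> carrier_mat nS nS" "psd H"
    and HG: "H * (Gm i0 + complex_of_real \<delta> \<cdot>\<^sub>m 1\<^sub>m nS) = 1\<^sub>m nS"
      "(Gm i0 + complex_of_real \<delta> \<cdot>\<^sub>m 1\<^sub>m nS) * H = 1\<^sub>m nS"
    and near: "\<And>i f. i \<in> L \<Longrightarrow>
      Re (qform nS (Gm i) f) \<le> Re (qform nS (Gm i0) f) + \<delta> * (\<Sum>p<nS. (cmod (f p))\<^sup>2)"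
begin

section \<open>The recovery and its error for a strictly positive tolerance\<close>

definition B :: "'i \<Rightarrow> complex mat" where
  "B i = T i0 * (H * adj (T i))"

lemma HT_carrier [simp]: "H * adj (T i) \<in> carrier_mat nS nR"
  using H(1) T_adj_carrier by (rule mult_carrier_mat)

lemma B_carrier [simp]: "B i \<in> carrier_mat nR nR"
  unfolding B_def using T_carrier HT_carrier by (rule mult_carrier_mat)

text \<open>
  With \<open>y i = H (T i)\<^sup>\<dagger> u\<close> and \<open>w = \<Sum> T i (y i)\<close>, both \<open>\<parallel>w\<parallel>\<^sup>2\<close> and the left-hand side are at
  most \<open>s = \<langle>u, w\<rangle>\<close>, so that \<open>s \<le> \<parallel>u\<parallel> \<surd>s\<close>.
\<close>

lemma B_contraction:
  assumes u: "u \<in> carrier_vec nR"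
  shows "(\<Sum>i\<in>L. \<Sum>r<nR. (cmod ((B i *\<^sub>v u) $ r))\<^sup>2) \<le> (\<Sum>r<nR. (cmod (u $ r))\<^sup>2)"
proof -
  let ?G = "Gm i0 + complex_of_real \<delta> \<cdot>\<^sub>m 1\<^sub>m nS"
  have G: "?G \<in> carrier_mat nS nS" by simp
  define z where "z i = adj (T i) *\<^sub>v u" for i
  define y where "y i = H *\<^sub>v z i" for i
  have z: "z i \<in> carrier_vec nS" for i
    unfolding z_def using T_adj_carrier u by (rule mult_mat_vec_carrier)
  have y: "y i \<in> carrier_vec nS" for i
    unfolding y_def using H(1) z by (rule mult_mat_vec_carrier)
  have Ty: "T j *\<^sub>v y i \<in> carrier_vec nR" for i j
    using T_carrier y by (rule mult_mat_vec_carrier)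
  have Bu: "B i *\<^sub>v u = T i0 *\<^sub>v y i" for i
    unfolding B_def y_def z_def
    using assoc_mult_mat_vec[OF T_carrier HT_carrier u] assoc_mult_mat_vec[OF H(1) T_adj_carrier u]
    by simp
  have Gy: "?G *\<^sub>v y i = z i" for i
    unfolding y_def using assoc_mult_mat_vec[OF G H(1) z] HG(2) z by simp
  have qT: "complex_of_real (\<Sum>r<nR. (cmod ((T j *\<^sub>v y i) $ r))\<^sup>2) = qform nS (Gm j) (\<lambda>p. y i $ p)" for i j
    unfolding Gm_def qform_gram[OF T_carrier]
    by (simp add: index_mult_mat_vec_sum[OF T_carrier y] del: index_mult_mat_vec)
  have qG: "qform nS ?G (\<lambda>p. y i $ p) = z i \<bullet>c y i" for i
    using qform_vec[OF G y] Gy by simp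
  define w where "w r = (\<Sum>i\<in>L. (T i *\<^sub>v y i) $ r)" for r
  define s where "s = (\<Sum>i\<in>L. Re (qform nS ?G (\<lambda>p. y i $ p)))"
  have le_s: "Re (qform nS (Gm j) (\<lambda>p. y i $ p)) \<le> Re (qform nS ?G (\<lambda>p. y i $ p))"
    if "j \<in> L" for i j
    using near[OF that, of "\<lambda>p. y i $ p"] by (simp add: qform_shift)
  have 1: "(\<Sum>i\<in>L. \<Sum>r<nR. (cmod ((B i *\<^sub>v u) $ r))\<^sup>2) \<le> s"
    unfolding s_def
  proof (rule sum_mono)
    fix i
    have "(\<Sum>r<nR. (cmod ((B i *\<^sub>v u) $ r))\<^sup>2) = Re (qform nS (Gm i0) (\<lambda>p. y i $ p))"
      unfolding Bu qT[symmetric] by simp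
    then show "(\<Sum>r<nR. (cmod ((B i *\<^sub>v u) $ r))\<^sup>2) \<le> Re (qform nS ?G (\<lambda>p. y i $ p))"
      using le_s[OF i0] by simp
  qed
  \<comment> \<open>The ranges of different \<open>T i\<close> are orthogonal, so the cross terms in
    the squared norm of \<open>w\<close> drop out.\<close>
  have ortho: "(T i *\<^sub>v y i) \<bullet>c (T j *\<^sub>v y j) = (if j = i then qform nS (Gm i) (\<lambda>p. y i $ p) else 0)"
    if ij: "i \<in> L" "j \<in> L" for i j
  proof -
    have "(T i *\<^sub>v y i) \<bullet>c (T j *\<^sub>v y j)
        = (adj (T j) *\<^sub>v (T i *\<^sub>v y i)) \<bullet>c y j"
      using cscalar_prod_mat_adjoint[OF T_adj_carrier Ty y, of j i i j] by simp
    also have "adj (T j) *\<^sub>v (T i *\<^sub>v y i) = (adj (T j) * T i) *\<^sub>v y i"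
      by (rule assoc_mult_mat_vec[symmetric, OF T_adj_carrier T_carrier y])
    also have "\<dots> \<bullet>c y j = (if j = i then qform nS (Gm i) (\<lambda>p. y i $ p) else 0)"
    proof -
      have "0\<^sub>m nS nS *\<^sub>v y i = 0\<^sub>v nS" using y by (intro eq_vecI) auto
      then show ?thesis using T_adj_T[OF ij(2,1)] qform_vec[OF Gm_carrier y] y by auto
    qed
    finally show ?thesis .
  qed
  have "complex_of_real (\<Sum>r<nR. (cmod (w r))\<^sup>2) = (\<Sum>i\<in>L. \<Sum>j\<in>L. (T i *\<^sub>v y i) \<bullet>c (T j *\<^sub>v y j))"
  proof -
    have "complex_of_real (\<Sum>r<nR. (cmod (w r))\<^sup>2) = (\<Sum>r<nR. (\<Sum>i\<in>L. (T i *\<^sub>v y i) $ r) * (\<Sum>j\<in>L. cnj ((T j *\<^sub>v y j) $ r)))"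
      by (simp add: w_def complex_norm_square flip: of_real_power)
    also have "\<dots> = (\<Sum>r<nR. \<Sum>i\<in>L. \<Sum>j\<in>L. (T i *\<^sub>v y i) $ r * cnj ((T j *\<^sub>v y j) $ r))"
      by (simp only: sum_product)
    also have "\<dots> = (\<Sum>i\<in>L. \<Sum>j\<in>L. \<Sum>r<nR. (T i *\<^sub>v y i) $ r * cnj ((T j *\<^sub>v y j) $ r))"
      by (rule sum_rotate)
    also have "\<dots> = (\<Sum>i\<in>L. \<Sum>j\<in>L. (T i *\<^sub>v y i) \<bullet>c (T j *\<^sub>v y j))"
      by (simp only: cscalar_prod_sum[OF Ty])
    finally show ?thesis .
  qed
  also have "\<dots> = (\<Sum>i\<in>L. qform nS (Gm i) (\<lambda>p. y i $ p))"
    using finL by (simp add: ortho cong: sum.cong)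
  finally have ww: "(\<Sum>r<nR. (cmod (w r))\<^sup>2) = Re (\<Sum>i\<in>L. qform nS (Gm i) (\<lambda>p. y i $ p))"
    by (metis Re_complex_of_real)
  then have 2: "(\<Sum>r<nR. (cmod (w r))\<^sup>2) \<le> s"
    using le_s by (auto simp: s_def intro!: sum_mono)
  have "0 \<le> (\<Sum>r<nR. (cmod (w r))\<^sup>2)" by (intro sum_nonneg) auto
  then have s0: "s \<ge> 0" using 2 by linarith
  have "s = Re (\<Sum>i\<in>L. z i \<bullet>c y i)" by (simp add: s_def qG)
  also have "(\<Sum>i\<in>L. z i \<bullet>c y i) = (\<Sum>i\<in>L. u \<bullet>c (T i *\<^sub>v y i))"
    using cscalar_prod_mat_adjoint[OF T_adj_carrier u y] by (simp add: z_def)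
  also have "\<dots> = (\<Sum>r<nR. u $ r * cnj (w r))"
    unfolding cscalar_prod_sum[OF Ty] w_def by (subst sum.swap) (simp add: sum_distrib_left)
  finally have "s \<le> cmod (\<Sum>r<nR. u $ r * cnj (w r))" using complex_Re_le_cmod by metis
  then have "s\<^sup>2 \<le> (cmod (\<Sum>r<nR. u $ r * cnj (w r)))\<^sup>2" using s0 by (rule power_mono)
  also have "\<dots> \<le> (\<Sum>r<nR. (cmod (u $ r))\<^sup>2) * (\<Sum>r<nR. (cmod (w r))\<^sup>2)"
    using Cauchy_Schwarz_complex[of "\<lambda>r. u $ r" "\<lambda>r. cnj (w r)" "{..<nR}"] by simp
  also have "\<dots> \<le> (\<Sum>r<nR. (cmod (u $ r))\<^sup>2) * s" using 2 by (intro mult_left_mono sum_nonneg) auto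
  finally have "s * s \<le> (\<Sum>r<nR. (cmod (u $ r))\<^sup>2) * s" by (simp add: power2_eq_square)
  then have "s \<le> (\<Sum>r<nR. (cmod (u $ r))\<^sup>2)"
    using s0 by (cases "s = 0") (auto simp: sum_nonneg)
  with 1 show ?thesis by linarith
qed

text \<open>Kraus operators of tracing out all but the logical system after the sum of
  \<open>|c i> \<otimes> B i\<close>: \<open>t\<close> is the state found on the first factor,
  \<open>r'\<close> the one found on the second. The inner sum over \<open>r\<close> with
  \<open>y = e t r\<close> stands in for the inverse of the pairing \<open>e\<close>.\<close>

definition R :: "nat \<times> nat \<Rightarrow> complex mat" where
  "R = (\<lambda>(t, r'). mat m D (\<lambda>(l, y). \<Sum>i\<in>L. c i $ l *
     (\<Sum>r<nR. if y = e t r then B i $$ (r', r) else 0)))"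

lemma R_carrier [simp]: "R a \<in> carrier_mat m D"
  by (simp add: R_def split: prod.split)

lemma R_index:
  assumes "l < m" "t < nS" "r < nR" "p < nS"
  shows "R (t, r') $$ (l, e p r) = (if p = t then \<Sum>i\<in>L. c i $ l * B i $$ (r', r) else 0)"
proof -
  have "(\<Sum>r2<nR. if e p r = e t r2 then B i $$ (r', r2) else 0)
      = (\<Sum>r2<nR. if r2 = r then (if p = t then B i $$ (r', r2) else 0) else 0)" for i
    using assms by (intro sum.cong refl) (auto simp: e_inj)
  then show ?thesis using assms e_less by (simp add: R_def)
qed

text \<open>Orthonormality of the \<open>c i\<close> turns the squared norm over logical indices
  into a sum over code words; for each fixed \<open>t\<close> the contraction property of the
  \<open>B i\<close> then applies.\<close>

lemma R_contraction:
  "(\<Sum>a\<in>{..<nS} \<times> {..<nR}. \<Sum>l<m. (cmod (\<Sum>y<D. R a $$ (l, y) * f y))\<^sup>2) \<le> (\<Sum>y<D. (cmod (f y))\<^sup>2)"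
proof -
  define u where "u t = vec nR (\<lambda>r. f (e t r))" for t
  have u: "u t \<in> carrier_vec nR" for t by (simp add: u_def)
  have "(\<Sum>y<D. R (t, r') $$ (l, y) * f y) = (\<Sum>i\<in>L. c i $ l * (B i *\<^sub>v u t) $ r')"
    if "t < nS" "r' < nR" "l < m" for t r' l
  proof -
    have "(\<Sum>y<D. R (t, r') $$ (l, y) * f y)
        = (\<Sum>p<nS. if p = t then \<Sum>r<nR. (\<Sum>i\<in>L. c i $ l * B i $$ (r', r)) * f (e p r) else 0)"
      unfolding sum_D using that by (intro sum.cong refl) (auto simp: R_index)
    also have "\<dots> = (\<Sum>r<nR. \<Sum>i\<in>L. c i $ l * (B i $$ (r', r) * u t $ r))"
      using that by (simp add: u_def sum_distrib_left sum_distrib_right mult_ac)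
    also have "\<dots> = (\<Sum>i\<in>L. c i $ l * (B i *\<^sub>v u t) $ r')"
      by (subst sum.swap) (simp add: index_mult_mat_vec_sum[OF B_carrier u that(2)] sum_distrib_left
          del: index_mult_mat_vec)
    finally show ?thesis .
  qed
  note * = this
  have "(\<Sum>a\<in>{..<nS} \<times> {..<nR}. \<Sum>l<m. (cmod (\<Sum>y<D. R a $$ (l, y) * f y))\<^sup>2)
      = (\<Sum>t<nS. \<Sum>r<nR. \<Sum>l<m. (cmod (\<Sum>y<D. R (t, r) $$ (l, y) * f y))\<^sup>2)"
    by (rule trans[OF _ sum.cartesian_product[symmetric]]) (simp add: split_def)
  also have "\<dots> = (\<Sum>t<nS. \<Sum>r<nR. \<Sum>l<m. (cmod (\<Sum>i\<in>L. c i $ l * (B i *\<^sub>v u t) $ r))\<^sup>2)"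
    by (intro sum.cong refl) (simp only: * lessThan_iff)
  also have "\<dots> = (\<Sum>t<nS. \<Sum>i\<in>L. \<Sum>r<nR. (cmod ((B i *\<^sub>v u t) $ r))\<^sup>2)"
    unfolding c_parseval by (intro sum.cong refl sum.swap)
  also have "\<dots> \<le> (\<Sum>t<nS. \<Sum>r<nR. (cmod (u t $ r))\<^sup>2)"
    by (intro sum_mono B_contraction u)
  also have "\<dots> = (\<Sum>y<D. (cmod (f y))\<^sup>2)"
    unfolding sum_D by (simp add: u_def)
  finally show ?thesis .
qed

lemma B_T:
  assumes "i \<in> L" "j \<in> L"
  shows "B i * T j = (if i = j then T i0 * (H * Gm i) else 0\<^sub>m nR nS)"
proof -
  have "B i * T j = T i0 * ((H * adj (T i)) * T j)"
    unfolding B_def by (rule assoc_mult_mat[OF T_carrier HT_carrier T_carrier])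
  also have "(H * adj (T i)) * T j = H * (adj (T i) * T j)"
    by (rule assoc_mult_mat[OF H(1) T_adj_carrier T_carrier])
  finally show ?thesis
    using T_adj_T[OF assms] H(1) T_carrier[of i0] by (auto simp: right_mult_zero_mat)
qed

text \<open>This is \<open>B i * T i\<close>, what the recovery leaves on the second factor for code
  word \<open>i\<close>. The target is \<open>T i0\<close> for every \<open>i\<close>, so that
  nothing left there reveals the code word.\<close>

definition Y :: "'i \<Rightarrow> complex mat" where
  "Y i = T i0 * (H * Gm i)"

lemma HGm_carrier [simp]: "H * Gm i \<in> carrier_mat nS nS"
  using H(1) Gm_carrier by (rule mult_carrier_mat)

lemma Y_carrier [simp]: "Y i \<in> carrier_mat nR nS"
  unfolding Y_def using T_carrier HGm_carrier by (rule mult_carrier_mat)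

text \<open>The noise acts only on the first factor and \<open>B i * T j\<close> vanishes for
  \<open>i \<noteq> j\<close>, so recovery after noise stays diagonal in the basis
  \<open>c i\<close>. Only the dependence of the diagonal amplitudes on \<open>i\<close> remains as
  an error.\<close>

lemma R_K_V_index:
  assumes K: "K \<in> carrier_mat D D"
    and A: "\<And>p q r r'. p < nS \<Longrightarrow> q < nS \<Longrightarrow> r < nR \<Longrightarrow> r' < nR \<Longrightarrow>
      K $$ (e p r, e q r') = (if r = r' then A p q else 0)"
    and t: "t < nS" "r' < nR" and lx: "l < m" "x < m"
  shows "(R (t, r') * (K * V)) $$ (l, x)
    = (\<Sum>i\<in>L. c i $ l * cnj (c i $ x) * (\<Sum>p<nS. A t p * Y i $$ (r', p)))"
proof -
  have KV: "K * V \<in> carrier_mat D m" using K V(1) by (rule mult_carrier_mat)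
  have KVi: "(K * V) $$ (e t r, x) = (\<Sum>p<nS. \<Sum>j\<in>L. A t p * (T j $$ (r, p) * cnj (c j $ x)))"
    if r: "r < nR" for r
  proof -
    have "(K * V) $$ (e t r, x)
        = (\<Sum>p<nS. \<Sum>r2<nR. K $$ (e t r, e p r2) * V $$ (e p r2, x))"
      unfolding index_mult_mat_sum[OF K V(1) e_less[OF t(1) r] lx(2)] sum_D ..
    also have "\<dots> = (\<Sum>p<nS. \<Sum>r2<nR. if r2 = r then A t p * V $$ (e p r2, x) else 0)"
      using t r by (intro sum.cong refl) (auto simp: A)
    also have "\<dots> = (\<Sum>p<nS. A t p * V $$ (e p r, x))" using r by simp
    also have "\<dots> = (\<Sum>p<nS. \<Sum>j\<in>L. A t p * (T j $$ (r, p) * cnj (c j $ x)))"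
      using r lx e_less by (intro sum.cong refl) (simp add: V_index T_def sum_distrib_left)
    finally show ?thesis .
  qed
  have "(R (t, r') * (K * V)) $$ (l, x)
      = (\<Sum>p<nS. \<Sum>r<nR. R (t, r') $$ (l, e p r) * (K * V) $$ (e p r, x))"
    unfolding index_mult_mat_sum[OF R_carrier KV lx] sum_D ..
  also have "\<dots> = (\<Sum>p<nS. if p = t then \<Sum>r<nR. (\<Sum>i\<in>L. c i $ l * B i $$ (r', r)) * (K * V) $$ (e p r, x) else 0)"
    using lx t by (intro sum.cong refl) (auto simp: R_index simp del: index_mult_mat(1))
  also have "\<dots> = (\<Sum>r<nR. (\<Sum>i\<in>L. c i $ l * B i $$ (r', r)) * (K * V) $$ (e t r, x))"
    using t by simp
  also have "\<dots> = (\<Sum>r<nR. \<Sum>i\<in>L. \<Sum>p<nS. \<Sum>j\<in>L.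
      c i $ l * B i $$ (r', r) * (A t p * (T j $$ (r, p) * cnj (c j $ x))))"
    by (intro sum.cong refl) (simp only: KVi lessThan_iff sum_distrib_right, simp only: sum_distrib_left)
  also have "\<dots> = (\<Sum>i\<in>L. \<Sum>j\<in>L. \<Sum>p<nS. \<Sum>r<nR.
      c i $ l * B i $$ (r', r) * (A t p * (T j $$ (r, p) * cnj (c j $ x))))"
    apply (simp only: sum.cartesian_product)
    apply (rule sum.reindex_bij_witness[where
          i = "\<lambda>(i, j, p, r). (r, i, p, j)" and j = "\<lambda>(r, i, p, j). (i, j, p, r)"])
    by auto
  also have "\<dots> = (\<Sum>i\<in>L. \<Sum>j\<in>L. if j = i
      then c i $ l * cnj (c i $ x) * (\<Sum>p<nS. A t p * Y i $$ (r', p)) else 0)"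
  proof (intro sum.cong refl)
    fix i j assume ij: "i \<in> L" "j \<in> L"
    have "(\<Sum>p<nS. \<Sum>r<nR. c i $ l * B i $$ (r', r) * (A t p * (T j $$ (r, p) * cnj (c j $ x))))
        = (\<Sum>p<nS. c i $ l * cnj (c j $ x) * (A t p * (B i * T j) $$ (r', p)))"
      using t by (intro sum.cong refl)
        (simp add: index_mult_mat_sum[OF B_carrier T_carrier] sum_distrib_left mult_ac del: index_mult_mat(1))
    then show "(\<Sum>p<nS. \<Sum>r<nR. c i $ l * B i $$ (r', r) * (A t p * (T j $$ (r, p) * cnj (c j $ x))))
        = (if j = i then c i $ l * cnj (c i $ x) * (\<Sum>p<nS. A t p * Y i $$ (r', p)) else 0)"
      using t by (auto simp: B_T[OF ij] Y_def[symmetric] sum_distrib_left mult_ac simp del: index_mult_mat(1))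
  qed
  also have "\<dots> = (\<Sum>i\<in>L. c i $ l * cnj (c i $ x) * (\<Sum>p<nS. A t p * Y i $$ (r', p)))"
    using finL by simp
  finally show ?thesis .
qed

text \<open>Writing \<open>Gm i0 * H\<close> as the identity minus \<open>\<delta>\<close> times
  \<open>H\<close> reduces the loss to \<open>\<delta>\<close> times the trace of
  \<open>H * Gm i\<close>. As the inverse of \<open>H\<close> dominates \<open>Gm i\<close>, that
  trace is at most the trace of the identity; this is the origin of the dimension factor in the
  error.\<close>

lemma trace_overlap:
  assumes i: "i \<in> L"
  shows "Re (\<Sum>p<nS. (adj (T i0) * Y i) $$ (p, p)) \<ge> 1 - \<delta> * real nS"
proof -
  let ?d = "complex_of_real \<delta>"
  let ?G = "Gm i0 + ?d \<cdot>\<^sub>m 1\<^sub>m nS"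
  have G: "?G \<in> carrier_mat nS nS" by simp
  have "adj (T i0) * Y i = Gm i0 * (H * Gm i)"
    unfolding Y_def Gm_def[of i0] by (rule assoc_mult_mat[symmetric, OF T_adj_carrier T_carrier HGm_carrier])
  also have "\<dots> = (Gm i0 * H) * Gm i"
    by (rule assoc_mult_mat[symmetric, OF Gm_carrier H(1) Gm_carrier])
  also have "Gm i0 * H = 1\<^sub>m nS - ?d \<cdot>\<^sub>m H"
  proof -
    have "?G * H = Gm i0 * H + ?d \<cdot>\<^sub>m H"
      using H(1) by (simp add: add_mult_distrib_mat[OF Gm_carrier _ H(1)] mult_smult_assoc_mat[of _ nS nS _ nS])
    then have "1\<^sub>m nS - ?d \<cdot>\<^sub>m H = Gm i0 * H + ?d \<cdot>\<^sub>m H - ?d \<cdot>\<^sub>m H"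
      by (simp only: HG(2))
    also have "\<dots> = Gm i0 * H"
      using H(1) mult_carrier_mat[OF Gm_carrier H(1), of i0] by (intro eq_matI) auto
    finally show ?thesis ..
  qed
  also have "(1\<^sub>m nS - ?d \<cdot>\<^sub>m H) * Gm i = Gm i - ?d \<cdot>\<^sub>m (H * Gm i)"
    using H(1) by (simp add: minus_mult_distrib_mat[of _ nS nS _ _ nS] mult_smult_assoc_mat[of _ nS nS _ nS]
        left_mult_one_mat[OF Gm_carrier])
  finally have "(\<Sum>p<nS. (adj (T i0) * Y i) $$ (p, p))
      = (\<Sum>p<nS. Gm i $$ (p, p) - ?d * (H * Gm i) $$ (p, p))"
    using H(1) carrier_matD[OF Gm_carrier[of i]] by (simp del: index_mult_mat(1))
  also have "\<dots> = 1 - ?d * (\<Sum>p<nS. \<Sum>q<nS. H $$ (p, q) * Gm i $$ (q, p))"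
    using trace_Gm[OF i]
    by (simp add: sum_subtractf index_mult_mat_sum[OF H(1) Gm_carrier] sum_distrib_left del: index_mult_mat(1))
  finally have eq: "Re (\<Sum>p<nS. (adj (T i0) * Y i) $$ (p, p))
      = 1 - \<delta> * Re (\<Sum>p<nS. \<Sum>q<nS. H $$ (p, q) * Gm i $$ (q, p))"
    by simp
  have "Re (qform nS (?G - Gm i) f) \<ge> 0" for f
  proof -
    have "qform nS (?G - Gm i) f = qform nS ?G f - qform nS (Gm i) f"
      unfolding qform_def using Gm_carrier[of i, THEN carrier_matD(1)] Gm_carrier[of i, THEN carrier_matD(2)]
      by (simp add: left_diff_distrib right_diff_distrib sum_subtractf)
    then show ?thesis using near[OF i, of f] by (simp add: qform_shift)
  qed
  then have "0 \<le> Re (\<Sum>p<nS. \<Sum>q<nS. H $$ (p, q) * (?G - Gm i) $$ (q, p))"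
    by (intro trace_mult_psd H) (auto intro!: minus_carrier_mat)
  also have "(\<Sum>p<nS. \<Sum>q<nS. H $$ (p, q) * (?G - Gm i) $$ (q, p))
      = (\<Sum>p<nS. \<Sum>q<nS. H $$ (p, q) * ?G $$ (q, p)) - (\<Sum>p<nS. \<Sum>q<nS. H $$ (p, q) * Gm i $$ (q, p))"
    using Gm_carrier[of i, THEN carrier_matD(1)] Gm_carrier[of i, THEN carrier_matD(2)]
    by (simp add: right_diff_distrib sum_subtractf)
  also have "(\<Sum>p<nS. \<Sum>q<nS. H $$ (p, q) * ?G $$ (q, p)) = (\<Sum>p<nS. (H * ?G) $$ (p, p))"
    by (intro sum.cong refl) (simp add: index_mult_mat_sum[OF H(1) G] del: index_mult_mat(1) index_add_mat(1))
  also have "\<dots> = of_nat nS" by (simp add: HG(1))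
  finally have "Re (\<Sum>p<nS. \<Sum>q<nS. H $$ (p, q) * Gm i $$ (q, p)) \<le> real nS" by simp
  then show ?thesis unfolding eq using \<delta> by (simp add: mult_left_mono)
qed


text \<open>Testing trace preservation on matrix units whose second-factor state is fixed to 0
  transfers completeness from the \<open>K j\<close> to their first-factor parts
  \<open>A j\<close>.\<close>

lemma trace_preserving_factor:
  assumes K: "\<And>j. j \<in> J \<Longrightarrow> K j \<in> carrier_mat D D"
    and A: "\<And>j p q r r'. j \<in> J \<Longrightarrow> p < nS \<Longrightarrow> q < nS \<Longrightarrow> r < nR \<Longrightarrow> r' < nR \<Longrightarrow>
      K j $$ (e p r, e q r') = (if r = r' then A j p q else 0)"
    and tp: "\<And>X. X \<in> carrier_mat D D \<Longrightarrow> mat_trace (kraus_sum D J K X) = mat_trace X"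
    and nR: "nR > 0" and pq: "p < nS" "q < nS"
  shows "(\<Sum>j\<in>J. \<Sum>t<nS. cnj (A j t p) * A j t q) = (if p = q then 1 else 0)"
proof -
  define X :: "complex mat" where "X = mat D D (\<lambda>(x, y). if x = e q 0 \<and> y = e p 0 then 1 else 0)"
  have X: "X \<in> carrier_mat D D" by (simp add: X_def)
  have el: "e q 0 < D" "e p 0 < D" using e_less pq nR by auto
  have "mat_trace (kraus_sum D J K X) = (\<Sum>y<D. \<Sum>j\<in>J. K j $$ (y, e q 0) * cnj (K j $$ (y, e p 0)))"
  proof -
    have "(\<Sum>b<D. \<Sum>a<D. K j $$ (y, a) * X $$ (a, b) * cnj (K j $$ (y, b)))
        = K j $$ (y, e q 0) * cnj (K j $$ (y, e p 0))" for j y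
    proof -
      have "(\<Sum>b<D. \<Sum>a<D. K j $$ (y, a) * X $$ (a, b) * cnj (K j $$ (y, b)))
          = (\<Sum>b<D. \<Sum>a<D. if a = e q 0 then (if b = e p 0 then K j $$ (y, a) * cnj (K j $$ (y, b)) else 0) else 0)"
        by (intro sum.cong refl) (simp add: X_def)
      then show ?thesis using el by simp
    qed
    then show ?thesis
      unfolding mat_trace_def by (simp add: kraus_sum_carrier[THEN carrier_matD(1)] kraus_sum_index[OF K X])
  qed
  also have "\<dots> = (\<Sum>j\<in>J. \<Sum>y<D. K j $$ (y, e q 0) * cnj (K j $$ (y, e p 0)))"
    by (rule sum.swap)
  also have "\<dots> = (\<Sum>j\<in>J. \<Sum>t<nS. cnj (A j t p) * A j t q)"
  proof (rule sum.cong[OF refl])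
    fix j assume j: "j \<in> J"
    have "(\<Sum>r<nR. K j $$ (e t r, e q 0) * cnj (K j $$ (e t r, e p 0)))
        = (\<Sum>r<nR. if r = 0 then cnj (A j t p) * A j t q else 0)" if "t < nS" for t
      using A[OF j that] pq nR by (intro sum.cong refl) auto
    then show "(\<Sum>y<D. K j $$ (y, e q 0) * cnj (K j $$ (y, e p 0))) = (\<Sum>t<nS. cnj (A j t p) * A j t q)"
      unfolding sum_D using nR by (intro sum.cong refl) simp
  qed
  finally have "(\<Sum>j\<in>J. \<Sum>t<nS. cnj (A j t p) * A j t q) = mat_trace X" using tp[OF X] by simp
  also have "\<dots> = (\<Sum>y<D. if y = e q 0 then (if p = q then 1 else 0) else 0)"
    unfolding mat_trace_def using X pq nR by (auto simp: X_def e_inj intro!: sum.cong)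
  finally show ?thesis using el by simp
qed

text \<open>By completeness of the \<open>A j\<close>, the noise together with its environment acts
  on the first factor as an isometry and preserves inner products. This is why one recovery serves
  all noise on these sites.\<close>

lemma factor_overlap:
  assumes tpA: "\<And>p q. p < nS \<Longrightarrow> q < nS \<Longrightarrow>
      (\<Sum>j\<in>J. \<Sum>t<nS. cnj (A j t p) * A j t q) = (if p = q then 1 else 0)"
    and M: "M1 \<in> carrier_mat nR nS" "M2 \<in> carrier_mat nR nS"
  shows "(\<Sum>j\<in>J. \<Sum>t<nS. \<Sum>r<nR. cnj (\<Sum>p<nS. A j t p * M1 $$ (r, p)) * (\<Sum>q<nS. A j t q * M2 $$ (r, q)))
    = (\<Sum>p<nS. (adj M1 * M2) $$ (p, p))"
proof -
  have "(\<Sum>j\<in>J. \<Sum>t<nS. \<Sum>r<nR. cnj (\<Sum>p<nS. A j t p * M1 $$ (r, p)) * (\<Sum>q<nS. A j t q * M2 $$ (r, q)))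
      = (\<Sum>j\<in>J. \<Sum>t<nS. \<Sum>r<nR. \<Sum>p<nS. \<Sum>q<nS.
          cnj (M1 $$ (r, p)) * M2 $$ (r, q) * (cnj (A j t p) * A j t q))"
    by (simp only: cnj_sum sum_product) (simp add: mult_ac)
  also have "\<dots> = (\<Sum>r<nR. \<Sum>p<nS. \<Sum>q<nS. \<Sum>j\<in>J. \<Sum>t<nS.
          cnj (M1 $$ (r, p)) * M2 $$ (r, q) * (cnj (A j t p) * A j t q))"
    apply (simp only: sum.cartesian_product)
    apply (rule sum.reindex_bij_witness[where
          i = "\<lambda>(r, p, q, j, t). (j, t, r, p, q)" and j = "\<lambda>(j, t, r, p, q). (r, p, q, j, t)"])
    by auto
  also have "\<dots> = (\<Sum>r<nR. \<Sum>p<nS. \<Sum>q<nS. if q = p then cnj (M1 $$ (r, p)) * M2 $$ (r, p) else 0)"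
    by (intro sum.cong refl) (simp add: tpA flip: sum_distrib_left)
  also have "\<dots> = (\<Sum>p<nS. \<Sum>r<nR. cnj (M1 $$ (r, p)) * M2 $$ (r, p))"
    by (subst sum.swap) simp
  also have "\<dots> = (\<Sum>p<nS. (adj M1 * M2) $$ (p, p))"
  proof (rule sum.cong[OF refl])
    fix p assume "p \<in> {..<nS}"
    then have p: "p < nS" by simp
    show "(\<Sum>r<nR. cnj (M1 $$ (r, p)) * M2 $$ (r, p)) = (adj M1 * M2) $$ (p, p)"
      unfolding index_mult_mat_sum[OF mat_adjoint_carrier[OF M(1)] M(2) p p]
      using M(1) p by (intro sum.cong refl) (simp add: mat_adjoint_index)
  qed
  finally show ?thesis .
qed

text \<open>The Kraus amplitudes of the recovered channel form a vector \<open>zz\<close>, a mixture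
  of the \<open>ep i\<close> with weights \<open>pr i\<close>. Projecting it on the unit vector
  \<open>es\<close> reduces the entanglement fidelity to the overlaps of
  \<open>trace_overlap\<close>.\<close>

lemma inaccuracy_le_sqrt_aux:
  assumes K: "\<And>j. j \<in> J \<Longrightarrow> K j \<in> carrier_mat D D" and finJ: "finite J"
    and A: "\<And>j p q r r'. j \<in> J \<Longrightarrow> p < nS \<Longrightarrow> q < nS \<Longrightarrow> r < nR \<Longrightarrow> r' < nR \<Longrightarrow>
      K j $$ (e p r, e q r') = (if r = r' then A j p q else 0)"
    and ch: "quantum_channel D D (kraus_sum D J K)"
  shows "code_inaccuracy m D V (kraus_sum D J K) \<le> sqrt (2 * (\<delta> * real nS))"
proof -
  have m: "m > 0" using c_orth[OF i0 i0] by (cases m) auto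
  have nR: "nR > 0"
  proof (rule ccontr)
    assume "\<not> nR > 0"
    then have "(\<Sum>p<nS. Gm i0 $$ (p, p)) = 0" by (intro sum.neutral ballI) (subst Gm_index, auto)
    then show False using trace_Gm[OF i0] by simp
  qed
  let ?I = "{..<nS} \<times> {..<nR}"
  obtain E :: "(nat \<times> nat) + nat \<Rightarrow> complex mat" where
    E: "\<And>b. b \<in> ?I <+> {..<D} \<Longrightarrow> E b \<in> carrier_mat m D"
    and ER: "\<And>a. a \<in> ?I \<Longrightarrow> E (Inl a) = R a"
    and Ech: "quantum_channel D m (kraus_sum m (?I <+> {..<D}) E)"
    using kraus_completion[OF _ m R_carrier R_contraction] by auto
  have tpA: "(\<Sum>j\<in>J. \<Sum>t<nS. cnj (A j t p) * A j t q) = (if p = q then 1 else 0)"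
    if "p < nS" "q < nS" for p q
  proof (rule trace_preserving_factor[OF K A _ nR that])
    show "mat_trace (kraus_sum D J K X) = mat_trace X" if "X \<in> carrier_mat D D" for X
      using ch that by (auto simp: quantum_channel_def)
  qed auto
  show ?thesis
  proof (rule code_inaccuracy_le[OF V m ch Ech])
    fix v :: "complex vec" assume v: "v \<in> carrier_vec (m * m)" "v \<bullet>c v = 1"
    let ?T = "tensor_id m m m (kraus_sum m (?I <+> {..<D}) E \<circ> kraus_sum D J K \<circ> encoding_map V) (pure_state v)"
    let ?A = "J \<times> {..<nS} \<times> {..<nR}"
    define rho where "rho x i = (\<Sum>k<m. cnj (v $ (x * m + k)) * v $ (i * m + k))" for x i
    let ?F = "\<lambda>(b, j, u :: unit). E b * (K j * V)"
    let ?IF = "(?I <+> {..<D}) \<times> J \<times> {()}"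
    have KV: "K j * V \<in> carrier_mat D m" if "j \<in> J" for j
      using K[OF that] V(1) by (rule mult_carrier_mat)
    have F: "?F a \<in> carrier_mat m m" if "a \<in> ?IF" for a
      using that E KV by (auto intro!: mult_carrier_mat[of _ m D _ m])
    have comp: "(kraus_sum m (?I <+> {..<D}) E \<circ> kraus_sum D J K \<circ> encoding_map V) X = kraus_sum m ?IF ?F X"
      if X: "X \<in> carrier_mat m m" for X
    proof -
      have "kraus_sum D J K (encoding_map V X) = kraus_sum D (J \<times> {()}) (\<lambda>(j, u). K j * V) X"
        using encoding_map_kraus_sum[OF V(1) X] kraus_sum_kraus_sum[where E = K and L = "{()}" and F = "\<lambda>_. V" and I = J, OF K _ X] V(1)
        by simp
      then show ?thesis
        using kraus_sum_kraus_sum[where E = E and L = "J \<times> {()}" and F = "\<lambda>(j, u). K j * V"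
              and I = "?I <+> {..<D}", OF E _ X] KV
        by (auto simp: split_def)
    qed
    let ?amp = "\<lambda>a. (cmod (\<Sum>i<m. \<Sum>x<m. ?F a $$ (x, i) * rho x i))\<^sup>2"
    let ?ge = "\<Sum>(j, t, r)\<in>?A. (cmod (\<Sum>i<m. \<Sum>x<m. (R (t, r) * (K j * V)) $$ (x, i) * rho x i))\<^sup>2"
    let ?inc = "\<lambda>(j, t, r). (Inl (t, r), j, ())"
    from comp have "?T = tensor_id m m m (kraus_sum m ?IF ?F) (pure_state v)"
      by (simp add: tensor_id_def)
    then have "Re (qform (m * m) ?T (\<lambda>i. v $ i)) = sum ?amp ?IF"
      unfolding rho_def using qform_tensor_id_pure_state[OF F v(1)] by simp
    \<comment> \<open>The completing Kraus operators contribute nonnegative terms, which are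
      dropped.\<close>
    also have "\<dots> \<ge> sum ?amp (?inc ` ?A)"
      using finJ by (intro sum_mono2) auto
    also have "sum ?amp (?inc ` ?A) = ?ge"
      by (subst sum.reindex) (auto simp: inj_on_def ER intro!: sum.cong)
    finally have ge: "Re (qform (m * m) ?T (\<lambda>i. v $ i)) \<ge> ?ge" .
    \<comment> \<open>The weight of code word \<open>i\<close> in the reduced state of the input;
      \<open>pr1\<close> is completeness of the \<open>c i\<close>.\<close>
    define pr where "pr i = (\<Sum>k<m. (cmod (\<Sum>l<m. cnj (c i $ l) * v $ (l * m + k)))\<^sup>2)" for i
    have pr0: "pr i \<ge> 0" for i by (simp add: pr_def sum_nonneg)
    have pr: "(\<Sum>l<m. \<Sum>x<m. c i $ x * cnj (c i $ l) * rho x l) = complex_of_real (pr i)" for i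
    proof -
      have "complex_of_real (pr i) = (\<Sum>k<m. (\<Sum>l<m. cnj (c i $ l) * v $ (l * m + k)) * (\<Sum>x<m. c i $ x * cnj (v $ (x * m + k))))"
        by (simp add: pr_def complex_norm_square flip: of_real_power)
      also have "\<dots> = (\<Sum>k<m. \<Sum>l<m. \<Sum>x<m. c i $ x * cnj (c i $ l) * (cnj (v $ (x * m + k)) * v $ (l * m + k)))"
        by (simp only: sum_product) (simp add: mult_ac)
      also have "\<dots> = (\<Sum>l<m. \<Sum>x<m. \<Sum>k<m. c i $ x * cnj (c i $ l) * (cnj (v $ (x * m + k)) * v $ (l * m + k)))"
        by (rule sum_rotate)
      finally show ?thesis by (simp add: rho_def sum_distrib_left)
    qed
    have pr1: "(\<Sum>i\<in>L. pr i) = 1"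
    proof -
      have "complex_of_real (\<Sum>i\<in>L. pr i) = (\<Sum>i\<in>L. \<Sum>l<m. \<Sum>x<m. c i $ x * cnj (c i $ l) * rho x l)"
        by (simp add: pr)
      also have "\<dots> = (\<Sum>l<m. \<Sum>x<m. \<Sum>i\<in>L. c i $ x * cnj (c i $ l) * rho x l)"
        by (rule sum_rotate)
      also have "\<dots> = (\<Sum>l<m. \<Sum>x<m. if x = l then rho l l else 0)"
        by (intro sum.cong refl) (simp add: c_complete flip: sum_distrib_right)
      also have "\<dots> = v \<bullet>c v"
        unfolding cscalar_prod_sum[OF v(1)] sum_lessThan_mult by (simp add: rho_def mult.commute)
      finally show ?thesis using v(2) by (metis of_real_eq_1_iff)
    qed
    \<comment> \<open>The amplitudes that would arise if every code word left \<open>T i0\<close>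
      behind.\<close>
    define es where "es = (\<lambda>(j, t, r). \<Sum>p<nS. A j t p * T i0 $$ (r, p))"
    define ep where "ep i = (\<lambda>(j, t, r). \<Sum>p<nS. A j t p * Y i $$ (r, p))" for i
    define zz where "zz a = (\<Sum>i\<in>L. complex_of_real (pr i) * ep i a)" for a
    have amp: "(\<Sum>i<m. \<Sum>x<m. (R (t, r) * (K j * V)) $$ (x, i) * rho x i) = zz (j, t, r)"
      if "j \<in> J" "t < nS" "r < nR" for j t r
    proof -
      have "(\<Sum>l<m. \<Sum>x<m. (R (t, r) * (K j * V)) $$ (x, l) * rho x l)
          = (\<Sum>l<m. \<Sum>x<m. \<Sum>i\<in>L. ep i (j, t, r) * (c i $ x * cnj (c i $ l) * rho x l))"
        using that
        by (intro sum.cong refl)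
          (simp only: R_K_V_index[OF K A] lessThan_iff ep_def prod.case sum_distrib_right[of _ L],
            simp only: mult_ac)
      also have "\<dots> = (\<Sum>i\<in>L. \<Sum>l<m. \<Sum>x<m. ep i (j, t, r) * (c i $ x * cnj (c i $ l) * rho x l))"
        by (rule sum_rotate[symmetric])
      also have "\<dots> = zz (j, t, r)"
        by (simp only: sum_distrib_left[symmetric] pr zz_def) (simp only: mult.commute)
      finally show ?thesis .
    qed
    have es1: "(\<Sum>a\<in>?A. (cmod (es a))\<^sup>2) = 1"
    proof -
      have "complex_of_real (\<Sum>a\<in>?A. (cmod (es a))\<^sup>2) = (\<Sum>a\<in>?A. cnj (es a) * es a)"
        by (simp add: complex_norm_square mult.commute flip: of_real_power)
      also have "\<dots> = (\<Sum>p<nS. (adj (T i0) * T i0) $$ (p, p))"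
        using factor_overlap[OF tpA T_carrier T_carrier, of i0 i0]
        by (simp add: es_def split_def sum.cartesian_product)
      also have "\<dots> = 1" using trace_Gm[OF i0] by (simp add: Gm_def)
      finally show ?thesis by (metis of_real_eq_1_iff)
    qed
    have ov: "(\<Sum>a\<in>?A. cnj (es a) * ep i a) = (\<Sum>p<nS. (adj (T i0) * Y i) $$ (p, p))" for i
      using factor_overlap[OF tpA T_carrier Y_carrier, of i0 i]
      by (simp add: es_def ep_def split_def sum.cartesian_product)
    have "(\<Sum>a\<in>?A. cnj (es a) * zz a) = (\<Sum>i\<in>L. complex_of_real (pr i) * (\<Sum>a\<in>?A. cnj (es a) * ep i a))"
      unfolding zz_def sum_distrib_left by (subst sum.swap) (simp add: mult_ac)
    then have "Re (\<Sum>a\<in>?A. cnj (es a) * zz a)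
        = (\<Sum>i\<in>L. pr i * Re (\<Sum>p<nS. (adj (T i0) * Y i) $$ (p, p)))"
      by (simp add: ov)
    also have "\<dots> \<ge> (\<Sum>i\<in>L. pr i * (1 - \<delta> * real nS))"
      by (intro sum_mono mult_left_mono trace_overlap pr0)
    also have "(\<Sum>i\<in>L. pr i * (1 - \<delta> * real nS)) = 1 - \<delta> * real nS"
      by (simp add: pr1 flip: sum_distrib_right)
    finally have re: "1 - \<delta> * real nS \<le> Re (\<Sum>a\<in>?A. cnj (es a) * zz a)" .
    have cs: "(cmod (\<Sum>a\<in>?A. cnj (es a) * zz a))\<^sup>2 \<le> (\<Sum>a\<in>?A. (cmod (zz a))\<^sup>2)"
      using Cauchy_Schwarz_complex[of "\<lambda>a. cnj (es a)" zz ?A] es1 by simp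
    have "1 - 2 * (\<delta> * real nS) \<le> (cmod (\<Sum>a\<in>?A. cnj (es a) * zz a))\<^sup>2"
    \<comment> \<open>The lower bound may be squared only when it is nonnegative; otherwise the
      left-hand side is already negative.\<close>
    proof (cases "1 - \<delta> * real nS \<ge> 0")
      case True
      have "1 - 2 * (\<delta> * real nS) \<le> (1 - \<delta> * real nS)\<^sup>2" by (simp add: power2_diff)
      also have "\<dots> \<le> (cmod (\<Sum>a\<in>?A. cnj (es a) * zz a))\<^sup>2"
        using re complex_Re_le_cmod order_trans by (intro power_mono True) blast
      finally show ?thesis .
    next
      case False
      then have "1 - 2 * (\<delta> * real nS) \<le> 0" by linarith
      then show ?thesis by (meson order_trans zero_le_power2)
    qed
    also note cs
    also have "(\<Sum>a\<in>?A. (cmod (zz a))\<^sup>2) = ?ge"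
      using amp by (intro sum.cong refl) auto
    also note ge
    finally show "1 - 2 * (\<delta> * real nS) \<le> Re (qform (m * m) ?T (\<lambda>i. v $ i))" .
  qed
qed

end

text \<open>Letting the tolerance of the previous bound decrease to \<open>\<delta>\<close> includes the case \<open>\<delta> = 0\<close>.\<close>

lemma inaccuracy_le_sqrt:
  assumes i0: "i0 \<in> L" and \<delta>: "\<delta> \<ge> 0"
    and near: "\<And>i f. i \<in> L \<Longrightarrow>
      Re (qform nS (Gm i) f) \<le> Re (qform nS (Gm i0) f) + \<delta> * (\<Sum>p<nS. (cmod (f p))\<^sup>2)"
    and K: "\<And>j. j \<in> J \<Longrightarrow> K j \<in> carrier_mat D D" and finJ: "finite J"
    and A: "\<And>j p q r r'. j \<in> J \<Longrightarrow> p < nS \<Longrightarrow> q < nS \<Longrightarrow> r < nR \<Longrightarrow> r' < nR \<Longrightarrow>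
      K j $$ (e p r, e q r') = (if r = r' then A j p q else 0)"
    and ch: "quantum_channel D D (kraus_sum D J K)"
  shows "code_inaccuracy m D V (kraus_sum D J K) \<le> sqrt (2 * (\<delta> * real nS))"
proof -
  have bound: "code_inaccuracy m D V (kraus_sum D J K) \<le> sqrt (2 * (d * real nS))" if d: "d > \<delta>" for d
  proof -
    have d0: "d > 0" using d \<delta> by simp
    let ?G = "Gm i0 + complex_of_real d \<cdot>\<^sub>m 1\<^sub>m nS"
    have G: "?G \<in> carrier_mat nS nS" by simp
    have herm: "adj ?G = ?G"
    proof (rule hermitianI[OF G])
      fix p q assume pq: "p < nS" "q < nS"
      have "cnj (Gm i0 $$ (q, p)) = Gm i0 $$ (p, q)"
        using hermitian_index[OF Gm_herm Gm_carrier pq] by simp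
      then show "cnj (?G $$ (q, p)) = ?G $$ (p, q)" using pq by simp
    qed
    have "Re (qform nS ?G f) \<ge> d * (\<Sum>i<nS. (cmod (f i))\<^sup>2)" for f
      by (simp add: qform_shift qform_Gm sum_nonneg)
    then obtain H where "H \<in> carrier_mat nS nS" "psd H" "H * ?G = 1\<^sub>m nS" "?G * H = 1\<^sub>m nS"
      using pos_def_inverse[OF G herm _ d0] by blast
    then show ?thesis
    proof (rule inaccuracy_le_sqrt_aux[OF i0 d0 _ _ _ _ _ K finJ A ch])
      fix i f assume "i \<in> L"
      then have "Re (qform nS (Gm i) f) \<le> Re (qform nS (Gm i0) f) + \<delta> * (\<Sum>p<nS. (cmod (f p))\<^sup>2)"
        by (rule near)
      also have "\<dots> \<le> Re (qform nS (Gm i0) f) + d * (\<Sum>p<nS. (cmod (f p))\<^sup>2)"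
        using d by (intro add_left_mono mult_right_mono sum_nonneg) auto
      finally show "Re (qform nS (Gm i) f) \<le> Re (qform nS (Gm i0) f) + d * (\<Sum>p<nS. (cmod (f p))\<^sup>2)" .
    qed auto
  qed
  have "(\<lambda>n. sqrt (2 * ((\<delta> + 1 / real (Suc n)) * real nS))) \<longlonglongrightarrow> sqrt (2 * ((\<delta> + 0) * real nS))"
    by (intro tendsto_intros LIMSEQ_Suc lim_1_over_n)
  moreover have "code_inaccuracy m D V (kraus_sum D J K) \<le> sqrt (2 * ((\<delta> + 1 / real (Suc n)) * real nS))" for n
    by (rule bound) simp
  ultimately show ?thesis using LIMSEQ_le_const by fastforce
qed

end

section \<open>Slow variation of local expectation values along a multiplet\<close>

text \<open>
  The hypothesis is the expectation value of the double commutator \<open>[[A, Q\<^sup>+], Q\<^sup>-]\<close> in the states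
  of a multiplet, \<open>i = J + M\<close>. The boundary terms vanish at both ends, so the increments can be
  bounded by summing the hypothesis either from below or from above.
\<close>

lemma ladder_increment_bound:
  fixes g :: "nat \<Rightarrow> real"
  assumes w: "\<And>i. i \<le> L \<Longrightarrow> \<bar>real i * (real L - real i + 1) * (g i - g (i - 1))
      + (real L - real i) * (real i + 1) * (g i - g (i + 1))\<bar> \<le> K"
    and i: "i < L"
  shows "\<bar>g (i + 1) - g i\<bar> \<le> 2 * K / (real L + 1)"
proof -
  \<comment> \<open>The flux of the Sturm-Liouville expression, whose increments the hypothesis
    bounds. Its weight vanishes at \<open>i = L\<close>, and at \<open>i = 0\<close> the truncated
    \<open>i - 1\<close> meets the coefficient 0; these ends start the inductions
    \<open>above\<close> and \<open>below\<close>.\<close>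
  define h where "h i = (real L - real i) * (real i + 1) * (g (i + 1) - g i)" for i
  have K0: "K \<ge> 0" using w[of 0] by linarith
  have step: "\<bar>h (Suc j) - h j\<bar> \<le> K" if "Suc j \<le> L" for j
  proof -
    have "real (Suc j) * (real L - real (Suc j) + 1) * (g (Suc j) - g (Suc j - 1))
      + (real L - real (Suc j)) * (real (Suc j) + 1) * (g (Suc j) - g (Suc j + 1)) = h j - h (Suc j)"
      by (simp add: h_def algebra_simps)
    then show ?thesis using w[OF that] by (simp add: abs_minus_commute)
  qed
  have below: "\<bar>h j\<bar> \<le> K * (real j + 1)" if "j \<le> L" for j
    using that
  proof (induction j)
    case 0
    have "h 0 = - (real 0 * (real L - real 0 + 1) * (g 0 - g (0 - 1))
      + (real L - real 0) * (real 0 + 1) * (g 0 - g (0 + 1)))" by (simp add: h_def algebra_simps)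
    then show ?case using w[of 0] by simp
  next
    case (Suc j)
    then show ?case using step[of j] by (simp add: algebra_simps)
  qed
  have above: "\<bar>h (L - j)\<bar> \<le> K * real j" if "j \<le> L" for j
    using that
  proof (induction j)
    case 0
    show ?case by (simp add: h_def)
  next
    case (Suc j)
    then have "Suc (L - Suc j) = L - j" by simp
    then show ?case using step[of "L - Suc j"] Suc by (simp add: algebra_simps)
  qed
  have up: "\<bar>h i\<bar> \<le> K * (real L - real i)" using above[of "L - i"] i by (simp add: of_nat_diff)
  have hi: "\<bar>h i\<bar> = (real L - real i) * (real i + 1) * \<bar>g (i + 1) - g i\<bar>"
    using i by (simp add: h_def abs_mult)
  have "(real i + 1) * \<bar>g (i + 1) - g i\<bar> \<le> K"
  proof -
    have "(real L - real i) * ((real i + 1) * \<bar>g (i + 1) - g i\<bar>) \<le> (real L - real i) * K"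
      using up unfolding hi by (simp add: mult_ac)
    then show ?thesis using i by (simp add: mult_le_cancel_left)
  qed
  moreover have "(real L - real i) * \<bar>g (i + 1) - g i\<bar> \<le> K"
  proof -
    have "(real i + 1) * ((real L - real i) * \<bar>g (i + 1) - g i\<bar>) \<le> (real i + 1) * K"
      using below[of i] i unfolding hi by (simp add: mult_ac)
    then show ?thesis by (simp add: mult_le_cancel_left)
  qed
  \<comment> \<open>Summation from above controls \<open>i + 1\<close> times the increment,
    summation from below \<open>L - i\<close> times it. The weights add up to \<open>L + 1\<close>,
    so nothing is lost near either end.\<close>
  ultimately have "(real L + 1) * \<bar>g (i + 1) - g i\<bar> \<le> 2 * K"
    by (simp add: algebra_simps)
  then show ?thesis by (simp add: field_simps)
qed

lemma increments_bound:
  fixes g :: "nat \<Rightarrow> real"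
  assumes "\<And>i. i < L \<Longrightarrow> \<bar>g (i + 1) - g i\<bar> \<le> B" and "i \<le> L" "j \<le> L"
  shows "\<bar>g i - g j\<bar> \<le> B * \<bar>real i - real j\<bar>"
proof -
  have le: "\<bar>g (i + k) - g i\<bar> \<le> B * real k" if "i + k \<le> L" for i k
    using that
  proof (induction k)
    case (Suc k)
    then show ?case using assms(1)[of "i + k"] by (simp add: algebra_simps)
  qed simp
  show ?thesis
  proof (cases "i \<le> j")
    case True
    then show ?thesis using le[of i "j - i"] assms(3) by (simp add: of_nat_diff abs_minus_commute)
  next
    case False
    then show ?thesis using le[of j "i - j"] assms(2) by (simp add: of_nat_diff)
  qed
qed

text \<open>Cauchy-Schwarz after splitting each \<open>|K p q|\<close> into two square roots. Row
  and column sums suit ladder kernels, whose rows are sparse, and give a norm linear in the number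
  of sites.\<close>

lemma schur_test:
  fixes K :: "nat \<Rightarrow> nat \<Rightarrow> complex"
  assumes row: "\<And>p. p < n \<Longrightarrow> (\<Sum>q<n. cmod (K p q)) \<le> \<kappa>"
    and col: "\<And>q. q < n \<Longrightarrow> (\<Sum>p<n. cmod (K p q)) \<le> \<kappa>"
  shows "(\<Sum>p<n. (cmod (\<Sum>q<n. K p q * f q))\<^sup>2) \<le> \<kappa>\<^sup>2 * (\<Sum>q<n. (cmod (f q))\<^sup>2)"
proof (cases "n = 0")
  case False
  then have "0 \<le> (\<Sum>q<n. cmod (K 0 q))" "(\<Sum>q<n. cmod (K 0 q)) \<le> \<kappa>"
    using row[of 0] by (auto intro: sum_nonneg)
  then have \<kappa>: "\<kappa> \<ge> 0" by linarith
  have "(\<Sum>p<n. (cmod (\<Sum>q<n. K p q * f q))\<^sup>2) \<le> (\<Sum>p<n. \<kappa> * (\<Sum>q<n. cmod (K p q) * (cmod (f q))\<^sup>2))"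
  proof (rule sum_mono)
    fix p assume "p \<in> {..<n}"
    then have p: "p < n" by simp
    have "(cmod (\<Sum>q<n. K p q * f q))\<^sup>2 \<le> (\<Sum>q<n. cmod (K p q) * cmod (f q))\<^sup>2"
      by (intro power_mono order.trans[OF norm_sum]) (auto simp: norm_mult)
    also have "(\<Sum>q<n. cmod (K p q) * cmod (f q))
        = (\<Sum>q<n. sqrt (cmod (K p q)) * (sqrt (cmod (K p q)) * cmod (f q)))"
      by (simp flip: mult.assoc)
    also have "\<dots>\<^sup>2 \<le> (\<Sum>q<n. (sqrt (cmod (K p q)))\<^sup>2) * (\<Sum>q<n. (sqrt (cmod (K p q)) * cmod (f q))\<^sup>2)"
      by (rule Cauchy_Schwarz_real)
    also have "\<dots> = (\<Sum>q<n. cmod (K p q)) * (\<Sum>q<n. cmod (K p q) * (cmod (f q))\<^sup>2)"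
      by (simp add: power_mult_distrib)
    also have "\<dots> \<le> \<kappa> * (\<Sum>q<n. cmod (K p q) * (cmod (f q))\<^sup>2)"
      by (intro mult_right_mono row p sum_nonneg) auto
    finally show "(cmod (\<Sum>q<n. K p q * f q))\<^sup>2 \<le> \<kappa> * (\<Sum>q<n. cmod (K p q) * (cmod (f q))\<^sup>2)" .
  qed
  also have "\<dots> = \<kappa> * (\<Sum>q<n. (\<Sum>p<n. cmod (K p q)) * (cmod (f q))\<^sup>2)"
    unfolding sum_distrib_left[symmetric] sum_distrib_right by (subst sum.swap) simp
  also have "\<dots> \<le> \<kappa> * (\<Sum>q<n. \<kappa> * (cmod (f q))\<^sup>2)"
    by (intro mult_left_mono sum_mono mult_right_mono col \<kappa>) auto
  also have "\<dots> = \<kappa>\<^sup>2 * (\<Sum>q<n. (cmod (f q))\<^sup>2)"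
    by (simp add: power2_eq_square sum_distrib_left mult_ac)
  finally show ?thesis .
qed simp

text \<open>
  States of a bipartite system as functions of two indices. \<open>Sp\<close>, \<open>Sm\<close> and \<open>Rp\<close>, \<open>Rm\<close> are the
  ladder operators of the two parts, and \<open>x i\<close> is the multiplet state with \<open>M = i - L / 2\<close>.
\<close>

locale bipartite_multiplet =
  fixes nS nR L :: nat and Sp Sm Rp Rm :: "nat \<Rightarrow> nat \<Rightarrow> complex" and \<kappa> :: real
    and x :: "nat \<Rightarrow> nat \<Rightarrow> nat \<Rightarrow> complex"
  assumes adjS: "\<And>p q. p < nS \<Longrightarrow> q < nS \<Longrightarrow> Sm q p = cnj (Sp p q)"
    and adjR: "\<And>p q. p < nR \<Longrightarrow> q < nR \<Longrightarrow> Rm q p = cnj (Rp p q)"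
    and row: "\<And>p. p < nS \<Longrightarrow> (\<Sum>q<nS. cmod (Sp p q)) \<le> \<kappa>"
    and col: "\<And>q. q < nS \<Longrightarrow> (\<Sum>p<nS. cmod (Sp p q)) \<le> \<kappa>"
    and \<kappa>: "\<kappa> \<ge> 0"
    and norm_x: "\<And>i. i \<le> L \<Longrightarrow> (\<Sum>p<nS. \<Sum>r<nR. (cmod (x i p r))\<^sup>2) = 1"
    and plus: "\<And>i p r. i \<le> L \<Longrightarrow> p < nS \<Longrightarrow> r < nR \<Longrightarrow>
      (\<Sum>q<nS. Sp p q * x i q r) + (\<Sum>t<nR. Rp r t * x i p t)
        = of_real (sqrt ((real L - real i) * (real i + 1))) * x (i + 1) p r"
    and minus: "\<And>i p r. i \<le> L \<Longrightarrow> p < nS \<Longrightarrow> r < nR \<Longrightarrow>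
      (\<Sum>q<nS. Sm p q * x i q r) + (\<Sum>t<nR. Rm r t * x i p t)
        = of_real (sqrt (real i * (real L - real i + 1))) * x (i - 1) p r"
begin

section \<open>Operators and inner products on the two parts\<close>

definition opS :: "(nat \<Rightarrow> nat \<Rightarrow> complex) \<Rightarrow> (nat \<Rightarrow> nat \<Rightarrow> complex) \<Rightarrow> nat \<Rightarrow> nat \<Rightarrow> complex" where
  "opS K f = (\<lambda>p r. \<Sum>q<nS. K p q * f q r)"

definition opR :: "(nat \<Rightarrow> nat \<Rightarrow> complex) \<Rightarrow> (nat \<Rightarrow> nat \<Rightarrow> complex) \<Rightarrow> nat \<Rightarrow> nat \<Rightarrow> complex" where
  "opR K f = (\<lambda>p r. \<Sum>t<nR. K r t * f p t)"

definition ip :: "(nat \<Rightarrow> nat \<Rightarrow> complex) \<Rightarrow> (nat \<Rightarrow> nat \<Rightarrow> complex) \<Rightarrow> complex" where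
  "ip f g = (\<Sum>p<nS. \<Sum>r<nR. cnj (f p r) * g p r)"

definition nsq :: "(nat \<Rightarrow> nat \<Rightarrow> complex) \<Rightarrow> real" where
  "nsq f = (\<Sum>p<nS. \<Sum>r<nR. (cmod (f p r))\<^sup>2)"

lemma op_add:
  "opS K (f + g) = opS K f + opS K g" "opR K (f + g) = opR K f + opR K g"
  by (simp_all add: opS_def opR_def fun_eq_iff distrib_left sum.distrib)

lemma op_commute: "opR K (opS M f) = opS M (opR K f)"
proof (intro ext)
  fix p r
  have "opR K (opS M f) p r = (\<Sum>t<nR. \<Sum>q<nS. K r t * (M p q * f q t))"
    by (simp add: opR_def opS_def sum_distrib_left)
  also have "\<dots> = (\<Sum>q<nS. \<Sum>t<nR. K r t * (M p q * f q t))" by (rule sum.swap)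
  also have "\<dots> = opS M (opR K f) p r"
    by (simp add: opR_def opS_def sum_distrib_left mult_ac)
  finally show "opR K (opS M f) p r = opS M (opR K f) p r" .
qed

lemma ip_add: "ip f (g + h) = ip f g + ip f h" and ip_diff: "ip f (g - h) = ip f g - ip f h"
  by (simp_all add: ip_def distrib_left right_diff_distrib sum.distrib sum_subtractf)

lemma ip_cong:
  assumes "\<And>p r. p < nS \<Longrightarrow> r < nR \<Longrightarrow> f p r = f' p r" "\<And>p r. p < nS \<Longrightarrow> r < nR \<Longrightarrow> g p r = g' p r"
  shows "ip f g = ip f' g'"
  using assms by (simp add: ip_def)

definition Qp :: "(nat \<Rightarrow> nat \<Rightarrow> complex) \<Rightarrow> nat \<Rightarrow> nat \<Rightarrow> complex" where
  "Qp f = opS Sp f + opR Rp f"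

definition Qm :: "(nat \<Rightarrow> nat \<Rightarrow> complex) \<Rightarrow> nat \<Rightarrow> nat \<Rightarrow> complex" where
  "Qm f = opS Sm f + opR Rm f"

lemma ip_opS:
  assumes "\<And>p q. p < nS \<Longrightarrow> q < nS \<Longrightarrow> M q p = cnj (K p q)"
  shows "ip (opS M f) g = ip f (opS K g)"
proof -
  have "ip (opS M f) g = (\<Sum>p<nS. \<Sum>r<nR. \<Sum>q<nS. cnj (f q r) * (K q p * g p r))"
    by (simp add: ip_def opS_def sum_distrib_left sum_distrib_right assms mult_ac)
  also have "\<dots> = (\<Sum>p<nS. \<Sum>q<nS. \<Sum>r<nR. cnj (f q r) * (K q p * g p r))"
    by (intro sum.cong refl sum.swap)
  also have "\<dots> = (\<Sum>q<nS. \<Sum>r<nR. \<Sum>p<nS. cnj (f q r) * (K q p * g p r))"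
    by (rule sum_rotate)
  also have "\<dots> = ip f (opS K g)" by (simp add: ip_def opS_def sum_distrib_left)
  finally show ?thesis .
qed

lemma ip_opR:
  assumes "\<And>p q. p < nR \<Longrightarrow> q < nR \<Longrightarrow> M q p = cnj (K p q)"
  shows "ip (opR M f) g = ip f (opR K g)"
proof -
  have "ip (opR M f) g = (\<Sum>p<nS. \<Sum>r<nR. \<Sum>t<nR. cnj (f p t) * (K t r * g p r))"
    by (simp add: ip_def opR_def sum_distrib_left sum_distrib_right assms mult_ac)
  also have "\<dots> = (\<Sum>p<nS. \<Sum>t<nR. \<Sum>r<nR. cnj (f p t) * (K t r * g p r))"
    by (intro sum.cong refl sum.swap)
  also have "\<dots> = ip f (opR K g)" by (simp add: ip_def opR_def sum_distrib_left)
  finally show ?thesis .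
qed

lemma ip_add_left: "ip (f + g) h = ip f h + ip g h"
  by (simp add: ip_def distrib_right sum.distrib)

lemma ip_Qm: "ip (Qm f) g = ip f (Qp g)" and ip_Qp: "ip (Qp f) g = ip f (Qm g)"
  unfolding Qm_def Qp_def ip_add_left ip_add
  by (simp_all add: ip_opS[of Sm Sp] ip_opR[of Rm Rp] ip_opS[of Sp Sm] ip_opR[of Rp Rm] adjS adjR)

text \<open>Operators of the two parts commute, so every term containing \<open>Rp\<close> or
  \<open>Rm\<close> cancels and only the ladder operators of the first part survive. The bound then
  scales with the noisy sites instead of all sites.\<close>

lemma double_commutator:
  "opS A (Qp (Qm f)) - Qp (opS A (Qm f)) - Qm (opS A (Qp f)) + Qm (Qp (opS A f))
    = opS A (opS Sp (opS Sm f)) - opS Sp (opS A (opS Sm f)) - opS Sm (opS A (opS Sp f))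
      + opS Sm (opS Sp (opS A f))"
  by (simp add: Qp_def Qm_def op_add op_commute algebra_simps)

lemma nsq_opS:
  assumes "\<And>g. (\<Sum>p<nS. (cmod (\<Sum>q<nS. K p q * g q))\<^sup>2) \<le> B\<^sup>2 * (\<Sum>q<nS. (cmod (g q))\<^sup>2)"
  shows "nsq (opS K f) \<le> B\<^sup>2 * nsq f"
proof -
  have "nsq (opS K f) = (\<Sum>r<nR. \<Sum>p<nS. (cmod (\<Sum>q<nS. K p q * f q r))\<^sup>2)"
    unfolding nsq_def opS_def by (rule sum.swap)
  also have "\<dots> \<le> (\<Sum>r<nR. B\<^sup>2 * (\<Sum>q<nS. (cmod (f q r))\<^sup>2))"
    by (intro sum_mono assms)
  also have "\<dots> = B\<^sup>2 * nsq f"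
    unfolding nsq_def sum_distrib_left[symmetric] by (subst sum.swap) simp
  finally show ?thesis .
qed

lemma nsq_Sp: "nsq (opS Sp f) \<le> \<kappa>\<^sup>2 * nsq f" and nsq_Sm: "nsq (opS Sm f) \<le> \<kappa>\<^sup>2 * nsq f"
proof -
  show "nsq (opS Sp f) \<le> \<kappa>\<^sup>2 * nsq f" by (intro nsq_opS schur_test row col)
  show "nsq (opS Sm f) \<le> \<kappa>\<^sup>2 * nsq f"
  proof (intro nsq_opS schur_test)
    show "(\<Sum>q<nS. cmod (Sm p q)) \<le> \<kappa>" if "p < nS" for p
      using col[OF that] that by (simp add: adjS)
    show "(\<Sum>p<nS. cmod (Sm p q)) \<le> \<kappa>" if "q < nS" for q
      using row[OF that] that by (simp add: adjS)
  qed
qed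

lemma cmod_ip: "cmod (ip f g) \<le> sqrt (nsq f) * sqrt (nsq g)"
proof -
  have "ip f g = (\<Sum>(p, r)\<in>{..<nS} \<times> {..<nR}. cnj (f p r) * g p r)"
    "nsq f = (\<Sum>(p, r)\<in>{..<nS} \<times> {..<nR}. (cmod (f p r))\<^sup>2)"
    "nsq g = (\<Sum>(p, r)\<in>{..<nS} \<times> {..<nR}. (cmod (g p r))\<^sup>2)"
    by (simp_all add: ip_def nsq_def sum.cartesian_product)
  then have "(cmod (ip f g))\<^sup>2 \<le> nsq f * nsq g"
    using Cauchy_Schwarz_complex[of "\<lambda>(p, r). cnj (f p r)" "\<lambda>(p, r). g p r" "{..<nS} \<times> {..<nR}"]
    by (simp add: split_def)
  then have "cmod (ip f g) \<le> sqrt (nsq f * nsq g)" by (rule real_le_rsqrt)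
  then show ?thesis by (simp add: real_sqrt_mult)
qed

text \<open>A multiple of the projection onto the conjugate of \<open>a\<close>; the conjugation
  makes its expectation value equal to the form of \<open>Gm\<close> at \<open>a\<close>,
  \<open>Gm\<close> being a conjugated reduced state.\<close>

definition proj :: "(nat \<Rightarrow> complex) \<Rightarrow> nat \<Rightarrow> nat \<Rightarrow> complex" where
  "proj a = (\<lambda>p q. cnj (a p) * a q)"

definition expect :: "(nat \<Rightarrow> complex) \<Rightarrow> nat \<Rightarrow> real" where
  "expect a i = (\<Sum>r<nR. (cmod (\<Sum>p<nS. x i p r * a p))\<^sup>2)"

lemma ip_proj: "ip (x i) (opS (proj a) (x i)) = complex_of_real (expect a i)"
proof -
  have "complex_of_real (expect a i)
      = (\<Sum>r<nR. (\<Sum>p<nS. cnj (x i p r * a p)) * (\<Sum>q<nS. x i q r * a q))"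
    by (simp add: expect_def complex_norm_square mult.commute flip: of_real_power)
  also have "\<dots> = (\<Sum>r<nR. \<Sum>p<nS. cnj (x i p r) * (\<Sum>q<nS. cnj (a p) * a q * x i q r))"
    by (simp only: sum_product) (simp add: sum_distrib_left mult_ac)
  also have "\<dots> = ip (x i) (opS (proj a) (x i))"
    by (subst sum.swap) (simp add: ip_def opS_def proj_def)
  finally show ?thesis by simp
qed

lemma nsq_proj: "nsq (opS (proj a) f) \<le> (\<Sum>p<nS. (cmod (a p))\<^sup>2)\<^sup>2 * nsq f"
proof (rule nsq_opS)
  fix g
  have "(\<Sum>p<nS. (cmod (\<Sum>q<nS. proj a p q * g q))\<^sup>2) = (\<Sum>p<nS. (cmod (a p))\<^sup>2 * (cmod (\<Sum>q<nS. a q * g q))\<^sup>2)"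
    by (simp add: proj_def mult.assoc norm_mult power_mult_distrib flip: sum_distrib_left)
  also have "\<dots> = (\<Sum>p<nS. (cmod (a p))\<^sup>2) * (cmod (\<Sum>q<nS. a q * g q))\<^sup>2"
    by (simp add: sum_distrib_right)
  also have "\<dots> \<le> (\<Sum>p<nS. (cmod (a p))\<^sup>2) * ((\<Sum>p<nS. (cmod (a p))\<^sup>2) * (\<Sum>q<nS. (cmod (g q))\<^sup>2))"
    by (intro mult_left_mono Cauchy_Schwarz_complex sum_nonneg) auto
  finally show "(\<Sum>p<nS. (cmod (\<Sum>q<nS. proj a p q * g q))\<^sup>2)
      \<le> (\<Sum>p<nS. (cmod (a p))\<^sup>2)\<^sup>2 * (\<Sum>q<nS. (cmod (g q))\<^sup>2)"
    by (simp add: power2_eq_square mult_ac)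
qed

lemma triple_bound:
  assumes "\<And>f. nsq (F f) \<le> a\<^sup>2 * nsq f" "\<And>f. nsq (G f) \<le> b\<^sup>2 * nsq f" "\<And>f. nsq (H f) \<le> c\<^sup>2 * nsq f"
    and "a \<ge> 0" "b \<ge> 0" "c \<ge> 0" and i: "i \<le> L"
  shows "cmod (ip (x i) (F (G (H (x i))))) \<le> a * b * c"
proof -
  have x1: "nsq (x i) = 1" using norm_x[OF i] by (simp add: nsq_def)
  have "nsq (F (G (H (x i)))) \<le> a\<^sup>2 * (b\<^sup>2 * (c\<^sup>2 * 1))"
    by (rule order_trans[OF assms(1)], intro mult_left_mono, rule order_trans[OF assms(2)],
        intro mult_left_mono) (use assms(3)[of "x i"] x1 in auto)
  also have "\<dots> = (a * b * c)\<^sup>2" by (simp add: power_mult_distrib)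
  finally have "sqrt (nsq (F (G (H (x i))))) \<le> a * b * c"
    using assms(4-6) by (intro real_le_lsqrt) auto
  then show ?thesis using cmod_ip[of "x i" "F (G (H (x i)))"] x1 by simp
qed

lemma opS_cong:
  assumes "\<And>p. p < nS \<Longrightarrow> f p r = g p r"
  shows "opS K f p r = opS K g p r"
  using assms by (simp add: opS_def)

lemma Qp_cong:
  assumes "\<And>p r. p < nS \<Longrightarrow> r < nR \<Longrightarrow> f p r = g p r" "p < nS" "r < nR"
  shows "Qp f p r = Qp g p r"
  using assms by (simp add: Qp_def opS_def opR_def)

lemma Qm_cong:
  assumes "\<And>p r. p < nS \<Longrightarrow> r < nR \<Longrightarrow> f p r = g p r" "p < nS" "r < nR"
  shows "Qm f p r = Qm g p r"
  using assms by (simp add: Qm_def opS_def opR_def)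

lemma Qp_x: "i \<le> L \<Longrightarrow> p < nS \<Longrightarrow> r < nR \<Longrightarrow>
    Qp (x i) p r = of_real (sqrt ((real L - real i) * (real i + 1))) * x (i + 1) p r"
  using plus by (simp add: Qp_def opS_def opR_def)

lemma Qm_x: "i \<le> L \<Longrightarrow> p < nS \<Longrightarrow> r < nR \<Longrightarrow>
    Qm (x i) p r = of_real (sqrt (real i * (real L - real i + 1))) * x (i - 1) p r"
  using minus by (simp add: Qm_def opS_def opR_def)

lemma Q_scale:
  "Qp (\<lambda>p r. z * f p r) = (\<lambda>p r. z * Qp f p r)" "Qm (\<lambda>p r. z * f p r) = (\<lambda>p r. z * Qm f p r)"
  by (simp_all add: Qp_def Qm_def opS_def opR_def fun_eq_iff distrib_left sum_distrib_left mult_ac)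

lemma QpQm_x:
  assumes i: "i \<le> L" and pr: "p < nS" "r < nR"
  shows "Qp (Qm (x i)) p r = complex_of_real (real i * (real L - real i + 1)) * x i p r"
proof -
  let ?z = "of_real (sqrt (real i * (real L - real i + 1)))"
  have "Qp (Qm (x i)) p r = ?z * Qp (x (i - 1)) p r"
    using Qp_cong[of "Qm (x i)" "\<lambda>p r. ?z * x (i - 1) p r", OF _ pr] Qm_x[OF i] by (simp add: Q_scale)
  also have "\<dots> = ?z * ?z * x i p r"
  \<comment> \<open>At \<open>i = 0\<close> the coefficient vanishes, so the truncated index
    \<open>i - 1\<close> is harmless.\<close>
  proof (cases "i = 0")
    case False
    then have "(real L - real (i - 1)) * (real (i - 1) + 1) = real i * (real L - real i + 1)"
      by (simp add: of_nat_diff algebra_simps)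
    then show ?thesis using Qp_x[of "i - 1", OF _ pr] i False by simp
  qed simp
  also have "?z * ?z = complex_of_real (real i * (real L - real i + 1))"
    using i by (simp flip: of_real_mult add: real_sqrt_mult_self)
  finally show ?thesis .
qed

lemma QmQp_x:
  assumes i: "i \<le> L" and pr: "p < nS" "r < nR"
  shows "Qm (Qp (x i)) p r = complex_of_real ((real L - real i) * (real i + 1)) * x i p r"
proof -
  let ?z = "of_real (sqrt ((real L - real i) * (real i + 1)))"
  have "Qm (Qp (x i)) p r = ?z * Qm (x (i + 1)) p r"
    using Qm_cong[of "Qp (x i)" "\<lambda>p r. ?z * x (i + 1) p r", OF _ pr] Qp_x[OF i] by (simp add: Q_scale)
  also have "\<dots> = ?z * ?z * x i p r"
  \<comment> \<open>At \<open>i = L\<close> the vanishing coefficient removes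
    \<open>x (L + 1)\<close>, which is not a state of the multiplet.\<close>
  proof (cases "i = L")
    case False
    then have "real (i + 1) * (real L - real (i + 1) + 1) = (real L - real i) * (real i + 1)"
      by (simp add: algebra_simps)
    then show ?thesis using Qm_x[of "i + 1", OF _ pr] i False by simp
  qed simp
  also have "?z * ?z = complex_of_real ((real L - real i) * (real i + 1))"
    using i by (simp flip: of_real_mult add: real_sqrt_mult_self)
  finally show ?thesis .
qed

lemma ip_scale: "ip f (\<lambda>p r. z * g p r) = z * ip f g" "ip (\<lambda>p r. z * f p r) g = cnj z * ip f g"
  by (simp_all add: ip_def sum_distrib_left mult_ac)

lemma opS_scale: "opS K (\<lambda>p r. z * f p r) = (\<lambda>p r. z * opS K f p r)"
  by (simp add: opS_def sum_distrib_left mult_ac)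

text \<open>The expectation value of the double commutator is computed twice: the ladder relations
  give the Sturm-Liouville expression, and the four surviving terms are each at most
  \<open>\<kappa>\<^sup>2\<close> times the squared norm of \<open>a\<close>. The factor 8 is this 4
  times the 2 of \<open>ladder_increment_bound\<close>.\<close>

lemma expect_increment:
  assumes i: "i < L"
  shows "\<bar>expect a (i + 1) - expect a i\<bar> \<le> 8 * \<kappa>\<^sup>2 * (\<Sum>p<nS. (cmod (a p))\<^sup>2) / (real L + 1)"
proof -
  let ?A = "opS (proj a)"
  let ?a = "\<Sum>p<nS. (cmod (a p))\<^sup>2"
  have a0: "?a \<ge> 0" by (simp add: sum_nonneg)
  have "\<bar>expect a (i + 1) - expect a i\<bar> \<le> 2 * (4 * \<kappa>\<^sup>2 * ?a) / (real L + 1)"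
  proof (rule ladder_increment_bound[OF _ i])
    fix i assume i: "i \<le> L"
    let ?lo = "real i * (real L - real i + 1)" and ?hi = "(real L - real i) * (real i + 1)"
    have tri: "cmod (u - v - w + z) \<le> cmod u + cmod v + cmod w + cmod z" for u v w z
      using norm_triangle_ineq[of "u - v - w" z] norm_triangle_ineq4[of "u - v" w]
        norm_triangle_ineq4[of u v] by linarith
    have lo0: "?lo \<ge> 0" and hi0: "?hi \<ge> 0" using i by auto
    have 1: "ip (x i) (?A (Qp (Qm (x i)))) = complex_of_real (?lo * expect a i)"
    proof -
      have "ip (x i) (?A (Qp (Qm (x i)))) = ip (x i) (?A (\<lambda>p r. complex_of_real ?lo * x i p r))"
        by (intro ip_cong refl opS_cong QpQm_x i)
      then show ?thesis by (simp add: opS_scale ip_scale ip_proj)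
    qed
    have 2: "ip (x i) (Qp (?A (Qm (x i)))) = complex_of_real (?lo * expect a (i - 1))"
    proof -
      let ?z = "of_real (sqrt ?lo)"
      have "ip (x i) (Qp (?A (Qm (x i)))) = ip (Qm (x i)) (?A (Qm (x i)))" by (simp only: ip_Qm)
      also have "\<dots> = ip (\<lambda>p r. ?z * x (i - 1) p r) (?A (\<lambda>p r. ?z * x (i - 1) p r))"
        by (intro ip_cong opS_cong Qm_x i)
      also have "\<dots> = of_real (sqrt ?lo * sqrt ?lo * expect a (i - 1))"
        by (simp only: opS_scale ip_scale ip_proj complex_cnj_complex_of_real of_real_mult mult.assoc)
      finally show ?thesis using lo0 by (simp only: real_sqrt_mult_self abs_of_nonneg)
    qed
    have 3: "ip (x i) (Qm (?A (Qp (x i)))) = complex_of_real (?hi * expect a (i + 1))"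
    proof -
      let ?z = "of_real (sqrt ?hi)"
      have "ip (x i) (Qm (?A (Qp (x i)))) = ip (Qp (x i)) (?A (Qp (x i)))" by (simp only: ip_Qp)
      also have "\<dots> = ip (\<lambda>p r. ?z * x (i + 1) p r) (?A (\<lambda>p r. ?z * x (i + 1) p r))"
        by (intro ip_cong opS_cong Qp_x i)
      also have "\<dots> = of_real (sqrt ?hi * sqrt ?hi * expect a (i + 1))"
        by (simp only: opS_scale ip_scale ip_proj complex_cnj_complex_of_real of_real_mult mult.assoc)
      finally show ?thesis using hi0 by (simp only: real_sqrt_mult_self abs_of_nonneg)
    qed
    have 4: "ip (x i) (Qm (Qp (?A (x i)))) = complex_of_real (?hi * expect a i)"
    proof -
      have "ip (x i) (Qm (Qp (?A (x i)))) = ip (Qm (Qp (x i))) (?A (x i))" by (simp only: ip_Qp ip_Qm)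
      also have "\<dots> = ip (\<lambda>p r. complex_of_real ?hi * x i p r) (?A (x i))"
        by (intro ip_cong refl QmQp_x i)
      finally show ?thesis by (simp add: ip_scale ip_proj)
    qed
    let ?w = "?lo * (expect a i - expect a (i - 1)) + ?hi * (expect a i - expect a (i + 1))"
    let ?t1 = "ip (x i) (?A (opS Sp (opS Sm (x i))))" and ?t2 = "ip (x i) (opS Sp (?A (opS Sm (x i))))"
      and ?t3 = "ip (x i) (opS Sm (?A (opS Sp (x i))))" and ?t4 = "ip (x i) (opS Sm (opS Sp (?A (x i))))"
    have "complex_of_real ?w
        = ip (x i) (?A (Qp (Qm (x i))) - Qp (?A (Qm (x i))) - Qm (?A (Qp (x i))) + Qm (Qp (?A (x i))))"
      unfolding ip_add ip_diff 1 2 3 4 by (simp only: of_real_add[symmetric] of_real_diff[symmetric] of_real_eq_iff)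
        (simp only: right_diff_distrib)
    also have "\<dots> = ?t1 - ?t2 - ?t3 + ?t4"
      unfolding double_commutator ip_add ip_diff ..
    finally have eq: "complex_of_real ?w = ?t1 - ?t2 - ?t3 + ?t4" .
    have "\<bar>?w\<bar> = cmod (?t1 - ?t2 - ?t3 + ?t4)"
      unfolding eq[symmetric] by (rule norm_of_real[symmetric])
    also have "\<dots> \<le> cmod ?t1 + cmod ?t2 + cmod ?t3 + cmod ?t4"
      by (rule tri)
    also have "\<dots> \<le> ?a * \<kappa> * \<kappa> + \<kappa> * ?a * \<kappa> + \<kappa> * ?a * \<kappa> + \<kappa> * \<kappa> * ?a"
      by (intro add_mono
          triple_bound[where F = ?A and G = "opS Sp" and H = "opS Sm", OF nsq_proj nsq_Sp nsq_Sm a0 \<kappa> \<kappa> i]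
          triple_bound[where F = "opS Sp" and G = ?A and H = "opS Sm", OF nsq_Sp nsq_proj nsq_Sm \<kappa> a0 \<kappa> i]
          triple_bound[where F = "opS Sm" and G = ?A and H = "opS Sp", OF nsq_Sm nsq_proj nsq_Sp \<kappa> a0 \<kappa> i]
          triple_bound[where F = "opS Sm" and G = "opS Sp" and H = ?A, OF nsq_Sm nsq_Sp nsq_proj \<kappa> \<kappa> a0 i])
    also have "\<dots> = 4 * \<kappa>\<^sup>2 * ?a" by (simp add: power2_eq_square)
    finally show "\<bar>?w\<bar> \<le> 4 * \<kappa>\<^sup>2 * ?a" .
  qed
  then show ?thesis by simp
qed

lemma expect_variation:
  assumes "i \<le> L" "j \<le> L"
  shows "\<bar>expect a i - expect a j\<bar>
    \<le> 8 * \<kappa>\<^sup>2 * (\<Sum>p<nS. (cmod (a p))\<^sup>2) / (real L + 1) * \<bar>real i - real j\<bar>"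
  using expect_increment by (rule increments_bound[OF _ assms])

end

section \<open>Splitting the sites into a noisy set and its complement\<close>

lemma mod_eq_of_site_index_eq:
  assumes "\<And>j. j < N \<Longrightarrow> site_index n j x = site_index n j y"
  shows "x mod n ^ N = y mod n ^ N"
  using assms
proof (induction N)
  case (Suc N)
  have *: "z mod n ^ Suc N = n ^ N * site_index n N z + z mod n ^ N" for z
    using mod_mult2_eq[of z "n ^ N" n] by (simp add: site_index_def mult.commute)
  show ?case unfolding * using Suc by simp
qed simp

lemma eq_of_site_index_eq:
  assumes "x < n ^ N" "y < n ^ N" "\<And>j. j < N \<Longrightarrow> site_index n j x = site_index n j y"
  shows "x = y"
  using mod_eq_of_site_index_eq[of N n x y] assms by simp

lemma site_index_less: "0 < n \<Longrightarrow> site_index n j x < n"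
  by (simp add: site_index_def)

lemma PiE_eq_iff_inj:
  assumes h: "\<And>p. p < k \<Longrightarrow> h p \<in> T \<rightarrow>\<^sub>E F" "inj_on h {..<k :: nat}" and pq: "p < k" "q < k"
  shows "(\<forall>j\<in>T. h p j = h q j) \<longleftrightarrow> p = q"
proof
  assume *: "\<forall>j\<in>T. h p j = h q j"
  have "h p \<in> extensional T" "h q \<in> extensional T"
    using h(1)[OF pq(1)] h(1)[OF pq(2)] by (auto simp: PiE_def)
  then have "h p = h q" using * by (intro extensionalityI[of _ T]) auto
  then show "p = q" using h(2) pq by (auto simp: inj_on_def)
qed auto

text \<open>\<open>hS\<close> and \<open>hR\<close> enumerate the configurations on and off
  \<open>S\<close>, and \<open>e\<close> merges two of them into one index. Abstract bijections are
  used because \<open>S\<close> need not consist of consecutive digits.\<close>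

locale site_split =
  fixes n N d :: nat and S :: "nat set" and e :: "nat \<Rightarrow> nat \<Rightarrow> nat" and hS hR :: "nat \<Rightarrow> nat \<Rightarrow> nat"
  assumes n: "n > 0" and S: "S \<subseteq> {..<N}" "card S = d"
    and bij_e: "bij_betw (\<lambda>(p, r). e p r) ({..<n ^ d} \<times> {..<n ^ (N - d)}) {..<n ^ N}"
    and hS: "\<And>p. p < n ^ d \<Longrightarrow> hS p \<in> S \<rightarrow>\<^sub>E {..<n}" "inj_on hS {..<n ^ d}"
    and hR: "\<And>r. r < n ^ (N - d) \<Longrightarrow> hR r \<in> ({..<N} - S) \<rightarrow>\<^sub>E {..<n}" "inj_on hR {..<n ^ (N - d)}"
    and e_S: "\<And>p r j. p < n ^ d \<Longrightarrow> r < n ^ (N - d) \<Longrightarrow> j \<in> S \<Longrightarrow> site_index n j (e p r) = hS p j"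
    and e_R: "\<And>p r j. p < n ^ d \<Longrightarrow> r < n ^ (N - d) \<Longrightarrow> j \<in> {..<N} - S \<Longrightarrow> site_index n j (e p r) = hR r j"

text \<open>Reading the digits on and off \<open>S\<close> is injective between sets of
  \<open>n ^ N\<close> elements, hence bijective; \<open>e\<close> is its inverse composed with
  enumerations of the configurations.\<close>

lemma site_split_exists:
  assumes n: "n > 0" and S: "S \<subseteq> {..<N}" "card S = d"
  obtains e hS hR where "site_split n N d S e hS hR"
proof -
  have finS: "finite S" using S finite_subset by blast
  let ?T = "{..<N} - S"
  have cT: "card ?T = N - d" using S finS by (simp add: card_Diff_subset)
  let ?FS = "S \<rightarrow>\<^sub>E {..<n}" and ?FR = "?T \<rightarrow>\<^sub>E {..<n}"
  have cards: "card ?FS = n ^ d" "card ?FR = n ^ (N - d)"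
    using finS S cT by (simp_all add: card_PiE)
  have fins: "finite ?FS" "finite ?FR" using finS by (simp_all add: finite_PiE)
  obtain hS where hS: "bij_betw hS {..<n ^ d} ?FS"
    using ex_bij_betw_nat_finite[OF fins(1)] cards by (auto simp: lessThan_atLeast0)
  obtain hR where hR: "bij_betw hR {..<n ^ (N - d)} ?FR"
    using ex_bij_betw_nat_finite[OF fins(2)] cards by (auto simp: lessThan_atLeast0)
  define \<phi> where "\<phi> x = (\<lambda>j\<in>S. site_index n j x, \<lambda>j\<in>?T. site_index n j x)" for x
  have inj: "inj_on \<phi> {..<n ^ N}"
  proof (rule inj_onI)
    fix x y assume xy: "x \<in> {..<n ^ N}" "y \<in> {..<n ^ N}" "\<phi> x = \<phi> y"
    have "site_index n j x = site_index n j y" if "j < N" for j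
    proof (cases "j \<in> S")
      case True
      have "fst (\<phi> x) j = fst (\<phi> y) j" using xy by simp
      then show ?thesis using True by (simp add: \<phi>_def)
    next
      case False
      have "snd (\<phi> x) j = snd (\<phi> y) j" using xy by simp
      then show ?thesis using False that by (simp add: \<phi>_def)
    qed
    then show "x = y" using eq_of_site_index_eq xy by simp
  qed
  have sub: "\<phi> ` {..<n ^ N} \<subseteq> ?FS \<times> ?FR"
    using site_index_less[OF n] by (intro image_subsetI) (simp add: \<phi>_def restrict_PiE_iff)
  have "d \<le> N" using S card_mono[of "{..<N}" S] by simp
  then have "card (?FS \<times> ?FR) = n ^ N"
    by (simp add: card_cartesian_product cards flip: power_add)
  then have surj: "\<phi> ` {..<n ^ N} = ?FS \<times> ?FR"
    using sub fins by (intro card_subset_eq) (auto simp: card_image[OF inj])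
  define e where "e p r = inv_into {..<n ^ N} \<phi> (hS p, hR r)" for p r
  have mem: "(hS p, hR r) \<in> \<phi> ` {..<n ^ N}" if "p < n ^ d" "r < n ^ (N - d)" for p r
    unfolding surj using that hS hR by (auto simp: bij_betw_def)
  have \<phi>e: "\<phi> (e p r) = (hS p, hR r)" if "p < n ^ d" "r < n ^ (N - d)" for p r
    unfolding e_def by (rule f_inv_into_f[OF mem[OF that]])
  have e_lt: "e p r < n ^ N" if "p < n ^ d" "r < n ^ (N - d)" for p r
    using inv_into_into[OF mem[OF that]] by (simp add: e_def)
  have "site_split n N d S e hS hR"
  proof
    show "bij_betw (\<lambda>(p, r). e p r) ({..<n ^ d} \<times> {..<n ^ (N - d)}) {..<n ^ N}"
    proof (rule bij_betw_imageI)
      show "inj_on (\<lambda>(p, r). e p r) ({..<n ^ d} \<times> {..<n ^ (N - d)})"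
      proof (rule inj_onI, clarsimp)
        fix p r q t
        assume pr: "p < n ^ d" "r < n ^ (N - d)" "q < n ^ d" "t < n ^ (N - d)" "e p r = e q t"
        then have "hS p = hS q" "hR r = hR t" using \<phi>e[of p r] \<phi>e[of q t] by auto
        then show "p = q \<and> r = t" using pr hS hR by (auto simp: bij_betw_def inj_on_def)
      qed
      show "(\<lambda>(p, r). e p r) ` ({..<n ^ d} \<times> {..<n ^ (N - d)}) = {..<n ^ N}"
      proof (intro equalityI subsetI)
        fix x assume x: "x \<in> {..<n ^ N}"
        then have "\<phi> x \<in> ?FS \<times> ?FR" using surj by blast
        moreover have "hS ` {..<n ^ d} = ?FS" "hR ` {..<n ^ (N - d)} = ?FR"
          using hS hR by (auto simp: bij_betw_def)
        ultimately have "fst (\<phi> x) \<in> hS ` {..<n ^ d}" "snd (\<phi> x) \<in> hR ` {..<n ^ (N - d)}"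
          by (simp_all only: mem_Times_iff)
        then obtain p r where pr: "p < n ^ d" "r < n ^ (N - d)" "\<phi> x = (hS p, hR r)"
          by (auto simp only: image_iff lessThan_iff prod_eq_iff fst_conv snd_conv)
        then have "e p r = x"
          unfolding e_def pr(3)[symmetric] by (intro inv_into_f_f[OF inj x])
        then show "x \<in> (\<lambda>(p, r). e p r) ` ({..<n ^ d} \<times> {..<n ^ (N - d)})" using pr by force
      qed (use e_lt in auto)
    qed
    show "hS p \<in> ?FS" if "p < n ^ d" for p using hS that by (auto simp: bij_betw_def)
    show "hR r \<in> ?FR" if "r < n ^ (N - d)" for r using hR that by (auto simp: bij_betw_def)
    show "site_index n j (e p r) = hS p j" if "p < n ^ d" "r < n ^ (N - d)" "j \<in> S" for p r j
      using arg_cong[OF \<phi>e[OF that(1,2)], of "\<lambda>z. fst z j"] that(3) by (simp add: \<phi>_def)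
    show "site_index n j (e p r) = hR r j" if "p < n ^ d" "r < n ^ (N - d)" "j \<in> ?T" for p r j
      using arg_cong[OF \<phi>e[OF that(1,2)], of "\<lambda>z. snd z j"] that(3) by (simp add: \<phi>_def)
  qed (use n S hS hR in \<open>auto simp: bij_betw_def\<close>)
  then show ?thesis by (rule that)
qed

text \<open>The part of \<open>total_op\<close> that acts on the sites in \<open>T\<close>, as a
  matrix between the configurations enumerated by \<open>h\<close>.\<close>

definition site_kernel ::
  "nat set \<Rightarrow> (nat \<Rightarrow> nat \<Rightarrow> nat) \<Rightarrow> complex mat \<Rightarrow> nat \<Rightarrow> nat \<Rightarrow> complex" where
  "site_kernel T h Q p q
    = (\<Sum>j\<in>T. if \<forall>i\<in>T - {j}. h p i = h q i then Q $$ (h p j, h q j) else 0)"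

text \<open>For each site \<open>j\<close> at most one configuration \<open>q\<close> couples to
  \<open>p\<close>: \<open>one\<close> fixes its value at \<open>j\<close>, and the other sites must
  agree. The row sum is thus linear in the number of sites, although the number of configurations is
  exponential.\<close>

lemma site_kernel_sum_le:
  assumes inj: "inj_on h {..<k}" and h: "\<And>p. p < k \<Longrightarrow> h p \<in> T \<rightarrow>\<^sub>E {..<n}" and p: "p < k"
    and bound: "\<And>a b. a < n \<Longrightarrow> b < n \<Longrightarrow> cmod (Q $$ (a, b)) \<le> c" and c: "c \<ge> 0"
    and one: "\<And>a b b'. a < n \<Longrightarrow> b < n \<Longrightarrow> b' < n \<Longrightarrow> Q $$ (a, b) \<noteq> 0 \<Longrightarrow> Q $$ (a, b') \<noteq> 0 \<Longrightarrow> b = b'"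
  shows "(\<Sum>q<k. cmod (site_kernel T h Q p q)) \<le> real (card T) * c"
proof -
  let ?f = "\<lambda>j q. if \<forall>i\<in>T - {j}. h p i = h q i then Q $$ (h p j, h q j) else 0"
  have hlt: "h q j < n" if "q < k" "j \<in> T" for q j using h[OF that(1)] that(2) by auto
  have "(\<Sum>q<k. cmod (site_kernel T h Q p q)) \<le> (\<Sum>q<k. \<Sum>j\<in>T. cmod (?f j q))"
    unfolding site_kernel_def by (intro sum_mono norm_sum)
  also have "\<dots> = (\<Sum>j\<in>T. \<Sum>q<k. cmod (?f j q))" by (rule sum.swap)
  also have "\<dots> \<le> (\<Sum>j\<in>T. c)"
  proof (rule sum_mono)
    fix j assume j: "j \<in> T"
    show "(\<Sum>q<k. cmod (?f j q)) \<le> c"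
    proof (cases "\<exists>q<k. ?f j q \<noteq> 0")
      case False
      then have "(\<Sum>q<k. cmod (?f j q)) = 0" by (intro sum.neutral) auto
      then show ?thesis using c by simp
    next
      case True
      then obtain q where q: "q < k" "?f j q \<noteq> 0" by blast
      have "?f j q' = 0" if q': "q' \<in> {..<k} - {q}" for q'
      proof (rule ccontr)
        assume nz: "?f j q' \<noteq> 0"
        have "h q i = h q' i" if i: "i \<in> T" for i
        proof (cases "i = j")
          case True
          have "Q $$ (h p j, h q j) \<noteq> 0" "Q $$ (h p j, h q' j) \<noteq> 0"
            using nz q(2) by (auto split: if_splits)
          then show ?thesis using one hlt[OF p j] hlt[OF q(1) j] hlt[of q' j] q' j True by simp
        next
          case False
          then show ?thesis using nz q(2) i by (auto split: if_splits)
        qed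
        moreover have "h q \<in> extensional T" "h q' \<in> extensional T"
          using h[OF q(1)] h[of q'] q' by (auto simp: PiE_def)
        ultimately have "h q = h q'" by (intro extensionalityI[of _ T]) auto
        then show False using inj q(1) q' by (auto simp: inj_on_def)
      qed
      then have "(\<Sum>q<k. cmod (?f j q)) = (\<Sum>q\<in>{q}. cmod (?f j q))"
        using q by (intro sum.mono_neutral_right) auto
      also have "\<dots> \<le> c" using bound[OF hlt[OF p j] hlt[OF q(1) j]] q(2) by (auto split: if_splits)
      finally show ?thesis .
    qed
  qed
  also have "\<dots> = real (card T) * c" by simp
  finally show ?thesis .
qed

context site_split
begin

abbreviation (input) "nS \<equiv> n ^ d"
abbreviation (input) "nR \<equiv> n ^ (N - d)"
abbreviation (input) "Sc \<equiv> {..<N} - S"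

lemma e_lt: "p < nS \<Longrightarrow> r < nR \<Longrightarrow> e p r < n ^ N"
  using bij_e by (auto simp: bij_betw_def)

lemma hS_eq_iff:
  assumes "p < nS" "q < nS"
  shows "(\<forall>j\<in>S. hS p j = hS q j) \<longleftrightarrow> p = q"
  using PiE_eq_iff_inj[OF hS assms] .

lemma hR_eq_iff:
  assumes "p < nR" "q < nR"
  shows "(\<forall>j\<in>Sc. hR p j = hR q j) \<longleftrightarrow> p = q"
  using PiE_eq_iff_inj[OF hR assms] .

lemma embed_op_index:
  assumes "p < nS" "r < nR" "q < nS" "t < nR"
  shows "embed_op n N S A $$ (e p r, e q t) = (if r = t then A (hS p) (hS q) else 0)"
proof -
  have "(\<forall>j\<in>Sc. site_index n j (e p r) = site_index n j (e q t)) \<longleftrightarrow> r = t"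
    using hR_eq_iff[of r t] e_R assms by simp
  moreover have "(\<lambda>j\<in>S. site_index n j (e p r)) = hS p" if "p < nS" "r < nR" for p r
  proof (rule extensionalityI[of _ S])
    show "hS p \<in> extensional S" using hS(1)[OF that(1)] by (auto simp: PiE_def)
  qed (use e_S that in auto)
  ultimately show ?thesis using assms e_lt by (simp add: embed_op_def)
qed

text \<open>A site in \<open>S\<close> leaves the configuration off \<open>S\<close> unchanged and
  vice versa, which splits the sum into one operator on each factor.\<close>

lemma total_op_index:
  assumes a: "p < nS" "r < nR" "q < nS" "t < nR"
  shows "total_op n N Q $$ (e p r, e q t)
    = (if r = t then site_kernel S hS Q p q else 0)
      + (if p = q then site_kernel (Sc) hR Q r t else 0)"
proof -
  let ?x = "e p r" and ?y = "e q t"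
  have lt: "?x < n ^ N" "?y < n ^ N" using e_lt a by auto
  have E: "embed_op n N {j} (\<lambda>u v. Q $$ (u j, v j)) $$ (?x, ?y)
      = (if \<forall>i\<in>{..<N} - {j}. site_index n i ?x = site_index n i ?y
         then Q $$ (site_index n j ?x, site_index n j ?y) else 0)" for j
    using lt by (simp add: embed_op_def)
  have "total_op n N Q $$ (?x, ?y)
      = (\<Sum>j\<in>S. embed_op n N {j} (\<lambda>u v. Q $$ (u j, v j)) $$ (?x, ?y))
      + (\<Sum>j\<in>Sc. embed_op n N {j} (\<lambda>u v. Q $$ (u j, v j)) $$ (?x, ?y))"
    using lt S(1) by (simp add: total_op_def sum.subset_diff[OF S(1)] add.commute)
  also have "(\<Sum>j\<in>S. embed_op n N {j} (\<lambda>u v. Q $$ (u j, v j)) $$ (?x, ?y))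
      = (if r = t then site_kernel S hS Q p q else 0)"
  proof -
    have "(\<forall>i\<in>{..<N} - {j}. site_index n i ?x = site_index n i ?y)
        \<longleftrightarrow> r = t \<and> (\<forall>i\<in>S - {j}. hS p i = hS q i)" if j: "j \<in> S" for j
    proof -
      have "{..<N} - {j} = (Sc) \<union> (S - {j})" using S(1) j by auto
      then show ?thesis using hR_eq_iff[of r t] a e_S e_R by (auto simp: ball_Un)
    qed
    then show ?thesis unfolding E site_kernel_def using e_S a by (auto intro!: sum.cong)
  qed
  also have "(\<Sum>j\<in>Sc. embed_op n N {j} (\<lambda>u v. Q $$ (u j, v j)) $$ (?x, ?y))
      = (if p = q then site_kernel (Sc) hR Q r t else 0)"
  proof -
    have "(\<forall>i\<in>{..<N} - {j}. site_index n i ?x = site_index n i ?y)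
        \<longleftrightarrow> p = q \<and> (\<forall>i\<in>Sc - {j}. hR r i = hR t i)" if j: "j \<in> Sc" for j
    proof -
      have "{..<N} - {j} = (Sc - {j}) \<union> S" using S(1) j by auto
      then show ?thesis using hS_eq_iff[of p q] a e_S e_R by (auto simp: ball_Un)
    qed
    then show ?thesis unfolding E site_kernel_def using e_R a by (auto intro!: sum.cong)
  qed
  finally show ?thesis .
qed

lemmas sum_sites = sum_bij_betw_Times[OF bij_e]

lemma total_op_mult_vec:
  assumes v: "v \<in> carrier_vec (n ^ N)" and pr: "p < nS" "r < nR"
  shows "(total_op n N Q *\<^sub>v v) $ e p r
    = (\<Sum>q<nS. site_kernel S hS Q p q * v $ e q r)
      + (\<Sum>t<nR. site_kernel (Sc) hR Q r t * v $ e p t)"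
proof -
  have T: "total_op n N Q \<in> carrier_mat (n ^ N) (n ^ N)" by (simp add: total_op_def)
  have "(total_op n N Q *\<^sub>v v) $ e p r
      = (\<Sum>q<nS. \<Sum>t<nR. total_op n N Q $$ (e p r, e q t) * v $ e q t)"
    unfolding index_mult_mat_vec_sum[OF T v e_lt[OF pr]] sum_sites ..
  also have "\<dots> = (\<Sum>q<nS. \<Sum>t<nR. (if t = r then site_kernel S hS Q p q * v $ e q t else 0)
      + (if q = p then site_kernel (Sc) hR Q r t * v $ e q t else 0))"
    using pr by (intro sum.cong refl) (auto simp: total_op_index distrib_right)
  also have "\<dots> = (\<Sum>q<nS. site_kernel S hS Q p q * v $ e q r)
      + (\<Sum>q<nS. \<Sum>t<nR. if q = p then site_kernel (Sc) hR Q r t * v $ e q t else 0)"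
    using pr by (simp add: sum.distrib)
  also have "(\<Sum>q<nS. \<Sum>t<nR. if q = p then site_kernel (Sc) hR Q r t * v $ e q t else 0)
      = (\<Sum>t<nR. site_kernel (Sc) hR Q r t * v $ e p t)"
    by (subst sum.swap) (simp add: pr)
  finally show ?thesis .
qed

end

section \<open>Spin operators in the product basis\<close>

lemma qudit_dim_real:
  assumes "2 * s \<in> \<nat>"
  shows "real (qudit_dim s) = 2 * s + 1"
proof -
  obtain k :: nat where "2 * s = real k" using assms by (auto elim: Nats_cases)
  then show ?thesis by (simp add: qudit_dim_def)
qed

lemma total_z_mult_vec:
  assumes v: "v \<in> carrier_vec (qudit_dim s ^ N)" and y: "y < qudit_dim s ^ N"
  shows "(total_z s N *\<^sub>v v) $ y
    = complex_of_real (\<Sum>j<N. real (site_index (qudit_dim s) j y) - s) * v $ y"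
proof -
  let ?n = "qudit_dim s"
  have n: "?n > 0" by (simp add: qudit_dim_def)
  have T: "total_z s N \<in> carrier_mat (?n ^ N) (?n ^ N)" by (simp add: total_z_def total_op_def)
  have "total_z s N $$ (y, z) = (if z = y then complex_of_real (\<Sum>j<N. real (site_index ?n j y) - s) else 0)"
    if z: "z < ?n ^ N" for z
  proof -
    have "embed_op ?n N {j} (\<lambda>u v. spin_z s $$ (u j, v j)) $$ (y, z)
        = (if z = y then complex_of_real (real (site_index ?n j y) - s) else 0)" if j: "j < N" for j
    proof (cases "z = y")
      case True
      then show ?thesis using y site_index_less[OF n] by (simp add: embed_op_def spin_z_def)
    next
      case False
      then obtain i where "i < N" "site_index ?n i y \<noteq> site_index ?n i z"
        using eq_of_site_index_eq[OF y z] by metis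
      then show ?thesis using False y z site_index_less[OF n]
        by (cases "i = j") (auto simp: embed_op_def spin_z_def)
    qed
    then show ?thesis using y z by (simp add: total_z_def total_op_def)
  qed
  then have "(\<Sum>z<?n ^ N. total_z s N $$ (y, z) * v $ z) = (\<Sum>z<?n ^ N. if z = y then
      complex_of_real (\<Sum>j<N. real (site_index ?n j y) - s) * v $ z else 0)"
    by (intro sum.cong refl) simp
  then show ?thesis unfolding index_mult_mat_vec_sum[OF T v y] using y by simp
qed

lemma spin_plus_bound:
  assumes s: "2 * s \<in> \<nat>" and ab: "a < qudit_dim s" "b < qudit_dim s"
  shows "cmod (spin_plus s $$ (a, b)) \<le> 2 * s + 1"
proof -
  have n: "real (qudit_dim s) = 2 * s + 1" by (rule qudit_dim_real[OF s])
  have s0: "s \<ge> 0" using s by (auto elim: Nats_cases)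
  have b: "real b \<le> 2 * s" using ab(2) n by linarith
  have "(2 * s - real b) * (real b + 1) \<le> (2 * s + 1) * (2 * s + 1)"
    using b s0 by (intro mult_mono) auto
  then have "sqrt ((2 * s - real b) * (real b + 1)) \<le> 2 * s + 1"
    using s0 by (intro real_le_lsqrt) (auto simp: power2_eq_square)
  moreover have "ladder_plus s (real b - s) = sqrt ((2 * s - real b) * (real b + 1))"
    by (simp add: ladder_plus_def algebra_simps)
  moreover have "0 \<le> (2 * s - real b) * (real b + 1)" using b by simp
  ultimately show ?thesis using ab s0 by (simp add: spin_plus_def)
qed

lemma spin_minus_adjoint:
  assumes "a < qudit_dim s" "b < qudit_dim s"
  shows "spin_minus s $$ (b, a) = cnj (spin_plus s $$ (a, b))"
  using assms by (auto simp: spin_minus_def spin_plus_def ladder_minus_def ladder_plus_def algebra_simps)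

lemma site_kernel_spin_adjoint:
  assumes "\<And>p. p < k \<Longrightarrow> h p \<in> T \<rightarrow>\<^sub>E {..<qudit_dim s}" "p < k" "q < k"
  shows "site_kernel T h (spin_minus s) q p = cnj (site_kernel T h (spin_plus s) p q)"
proof -
  have "h p j < qudit_dim s" "h q j < qudit_dim s" if "j \<in> T" for j
    using assms(1)[OF assms(2)] assms(1)[OF assms(3)] that by auto
  then show ?thesis
    unfolding site_kernel_def cnj_sum by (intro sum.cong refl) (auto simp: spin_minus_adjoint)
qed

text \<open>Column sums of the raising kernel are row sums of the lowering kernel, its adjoint; both
  ladder matrices have at most one nonzero entry per row.\<close>

lemma site_kernel_spin_plus_sums:
  assumes s: "2 * s \<in> \<nat>" and inj: "inj_on h {..<k}"
    and h: "\<And>p. p < k \<Longrightarrow> h p \<in> T \<rightarrow>\<^sub>E {..<qudit_dim s}" and p: "p < k"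
  shows "(\<Sum>q<k. cmod (site_kernel T h (spin_plus s) p q)) \<le> real (card T) * (2 * s + 1)"
    "(\<Sum>q<k. cmod (site_kernel T h (spin_plus s) q p)) \<le> real (card T) * (2 * s + 1)"
proof -
  have s0: "2 * s + 1 \<ge> 0" using s by (auto elim: Nats_cases)
  show "(\<Sum>q<k. cmod (site_kernel T h (spin_plus s) p q)) \<le> real (card T) * (2 * s + 1)"
    by (rule site_kernel_sum_le[OF inj h p spin_plus_bound[OF s] s0])
      (auto simp: spin_plus_def split: if_splits)
  have "(\<Sum>q<k. cmod (site_kernel T h (spin_plus s) q p)) = (\<Sum>q<k. cmod (site_kernel T h (spin_minus s) p q))"
    using site_kernel_spin_adjoint[OF h _ p] by simp
  also have "\<dots> \<le> real (card T) * (2 * s + 1)"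
  proof (rule site_kernel_sum_le[OF inj h p _ s0])
    show "cmod (spin_minus s $$ (a, b)) \<le> 2 * s + 1" if "a < qudit_dim s" "b < qudit_dim s" for a b
      using spin_plus_bound[OF s that(2,1)] spin_minus_adjoint[OF that(2,1)] by simp
  qed (auto simp: spin_minus_def split: if_splits)
  finally show "(\<Sum>q<k. cmod (site_kernel T h (spin_plus s) q p)) \<le> real (card T) * (2 * s + 1)" .
qed

section \<open>The code space\<close>

lemma code_labels_image:
  assumes \<Delta>: "\<Delta> \<ge> 1" and Mmax: "Mmax = Mmin + real k * real \<Delta>"
  shows "code_labels Mmin Mmax \<Delta> = (\<lambda>i. Mmin + real i * real \<Delta>) ` {..k}"
proof -
  have "Mmin + real i * real \<Delta> \<le> Mmax \<longleftrightarrow> i \<le> k" for i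
    using \<Delta> unfolding Mmax by simp
  then show ?thesis by (auto simp: code_labels_def)
qed

text \<open>With \<open>Mmax\<close> itself a label, the width is an exact multiple of
  \<open>\<Delta>\<close> and the count needs no rounding.\<close>

lemma
  assumes \<Delta>: "\<Delta> \<ge> 1" and Mmax: "Mmax \<in> code_labels Mmin Mmax \<Delta>"
  shows finite_code_labels: "finite (code_labels Mmin Mmax \<Delta>)"
    and card_code_labels: "real (card (code_labels Mmin Mmax \<Delta>)) = (Mmax - Mmin) / real \<Delta> + 1"
proof -
  obtain k :: nat where k: "Mmax = Mmin + real k * real \<Delta>" using Mmax by (auto simp: code_labels_def)
  have eq: "code_labels Mmin Mmax \<Delta> = (\<lambda>i. Mmin + real i * real \<Delta>) ` {..k}"
    by (rule code_labels_image[OF \<Delta> k])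
  then show "finite (code_labels Mmin Mmax \<Delta>)" by simp
  have "inj (\<lambda>i. Mmin + real i * real \<Delta>)" using \<Delta> by (auto simp: inj_on_def)
  then have "card (code_labels Mmin Mmax \<Delta>) = k + 1"
    unfolding eq by (simp add: card_image inj_on_subset)
  then show "real (card (code_labels Mmin Mmax \<Delta>)) = (Mmax - Mmin) / real \<Delta> + 1"
    using \<Delta> k by simp
qed

lemma code_labels_distance:
  assumes "M \<in> code_labels Mmin Mmax \<Delta>" "M' \<in> code_labels Mmin Mmax \<Delta>" "M \<noteq> M'"
  shows "real \<Delta> \<le> \<bar>M - M'\<bar>"
proof -
  obtain i j :: nat where ij: "M = Mmin + real i * real \<Delta>" "M' = Mmin + real j * real \<Delta>"
    using assms by (auto simp: code_labels_def)
  then have eq: "M - M' = (real i - real j) * real \<Delta>" by (simp add: algebra_simps)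
  have "i \<noteq> j" using ij assms(3) by auto
  then have "1 \<le> \<bar>real i - real j\<bar>" by linarith
  then have "1 * real \<Delta> \<le> \<bar>real i - real j\<bar> * real \<Delta>" by (intro mult_right_mono) auto
  then show ?thesis unfolding eq by (simp add: abs_mult)
qed

lemma code_labels_subset_magnetic_numbers:
  assumes "Mmin \<in> magnetic_numbers J" "Mmax \<in> magnetic_numbers J"
  shows "code_labels Mmin Mmax \<Delta> \<subseteq> magnetic_numbers J"
proof
  fix M assume "M \<in> code_labels Mmin Mmax \<Delta>"
  then obtain i :: nat where i: "M = Mmin + real i * real \<Delta>" "M \<le> Mmax" by (auto simp: code_labels_def)
  obtain i0 :: nat where i0: "Mmin = - J + real i0" using assms by (auto simp: magnetic_numbers_def)
  have "M = - J + real (i0 + i * \<Delta>)" using i i0 by simp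
  moreover have "M \<le> J" using i assms by (auto simp: magnetic_numbers_def)
  ultimately show "M \<in> magnetic_numbers J"
    unfolding magnetic_numbers_def by (intro CollectI exI[of _ "i0 + i * \<Delta>"] conjI)
qed

context vec_space
begin

lemma span_image_coefficients:
  assumes "finite L" and k: "\<And>i. i \<in> L \<Longrightarrow> k i \<in> carrier_vec n" and inj: "inj_on k L"
    and v: "v \<in> span (k ` L)"
  shows "\<exists>a. \<forall>y<n. v $ y = (\<Sum>i\<in>L. a i * k i $ y)"
proof -
  have car: "k ` L \<subseteq> carrier_vec n" using k by auto
  have finkL: "finite (k ` L)" using assms(1) by simp
  obtain a where a: "v = lincomb a (k ` L)"
    using v unfolding finite_span[OF finkL car] by blast
  have "v $ y = (\<Sum>i\<in>L. a (k i) * k i $ y)" if "y < n" for y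
    unfolding a lincomb_index[OF that car] by (simp only: sum.reindex[OF inj] o_def)
  then show ?thesis by (intro exI[of _ "\<lambda>i. a (k i)"]) simp
qed

end

lemma subspace_dim_orthonormal:
  fixes k :: "'i \<Rightarrow> complex vec"
  assumes finL: "finite L" and k: "\<And>i. i \<in> L \<Longrightarrow> k i \<in> carrier_vec D"
    and orth: "\<And>i j. i \<in> L \<Longrightarrow> j \<in> L \<Longrightarrow> k i \<bullet>c k j = (if i = j then 1 else 0)"
  shows "subspace_dim D (vec_span D (k ` L)) = card L"
proof -
  interpret vec_space "TYPE(complex)" D .
  have car: "k ` L \<subseteq> carrier_vec D" using k by auto
  have inj: "inj_on k L"
    using orth by (intro inj_onI) (metis one_neq_zero)
  have indpt: "lin_indpt (k ` L)"
  proof (rule finite_lin_indpt2)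
    show "\<forall>v\<in>k ` L. a v = 0" if "lincomb a (k ` L) = 0\<^sub>v D" for a
    proof safe
      fix i assume i: "i \<in> L"
      have "(\<Sum>j\<in>L. a (k j) * k j $ y) = 0" if "y < D" for y
      proof -
        have "(\<Sum>j\<in>L. a (k j) * k j $ y) = lincomb a (k ` L) $ y"
          unfolding lincomb_index[OF that car] by (simp only: sum.reindex[OF inj] o_def)
        then show ?thesis using \<open>lincomb a (k ` L) = 0\<^sub>v D\<close> that by simp
      qed
      then show "a (k i) = 0"
        using orthonormal_coefficient[OF finL k orth i, of "\<lambda>j. a (k j)"] by simp
    qed
  qed (use finL car in auto)
  have "vectorspace.dim class_ring (span_vs (k ` L)) = card (k ` L)"
    by (rule dim_span) (use finL car indpt in \<open>auto simp: maximal_def\<close>)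
  then show ?thesis
    by (simp add: subspace_dim_def card_image[OF inj])
qed

section \<open>The inaccuracy at fixed \<open>N\<close>\<close>

lemma magnetic_number_index:
  assumes "2 * J = real L" "M \<in> magnetic_numbers J"
  obtains i where "i \<le> L" "M = - J + real i"
  using assms by (auto simp: magnetic_numbers_def)

text \<open>The two halves meet here: forms of the reduced states are expectation values along the
  multiplet, with \<open>\<kappa> = d * (2 * s + 1)\<close>. The reference word is
  \<open>Mmin\<close>, at distance at most \<open>Mmax - Mmin\<close> from every label.\<close>

lemma multiplet_inaccuracy_le:
  assumes s: "2 * s \<in> \<nat>" and mult: "spin_multiplet s N J ket"
    and M: "Mmin \<in> magnetic_numbers J" "Mmax \<in> magnetic_numbers J"
    and \<Delta>: "\<Delta> \<ge> 1" and Mmax: "Mmax \<in> code_labels Mmin Mmax \<Delta>"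
    and \<Delta>d: "real \<Delta> \<ge> 2 * s * real d + 1"
    and noise: "local_noise s N d S Noise"
    and iso: "isometry_onto m (qudit_dim s ^ N) V (code_space s N ket Mmin Mmax \<Delta>)"
  shows "code_inaccuracy m (qudit_dim s ^ N) V Noise
    \<le> sqrt (2 * (8 * (real d * (2 * s + 1))\<^sup>2 / (2 * J + 1) * (Mmax - Mmin) * (2 * s + 1) ^ d))"
proof -
  define n where "n = qudit_dim s"
  define D where "D = n ^ N"
  have n: "n > 0" by (simp add: n_def qudit_dim_def)
  have rn: "real n = 2 * s + 1" unfolding n_def by (rule qudit_dim_real[OF s])
  have s0: "s \<ge> 0" using s by (auto elim: Nats_cases)
  have S: "S \<subseteq> {..<N}" "card S = d" using noise by (auto simp: local_noise_def)
  have finS: "finite S" using S(1) finite_subset by blast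
  obtain e hS hR where "site_split n N d S e hS hR" using site_split_exists[OF n S] by blast
  then interpret sp: site_split n N d S e hS hR .
  let ?L = "code_labels Mmin Mmax \<Delta>"
  let ?nS = "n ^ d" and ?nR = "n ^ (N - d)" and ?Sc = "{..<N} - S"
  have mult': "2 * J \<in> \<nat>"
    "\<And>M. M \<in> magnetic_numbers J \<Longrightarrow> ket M \<in> carrier_vec D"
    "\<And>M M'. M \<in> magnetic_numbers J \<Longrightarrow> M' \<in> magnetic_numbers J \<Longrightarrow> ket M \<bullet>c ket M' = (if M = M' then 1 else 0)"
    "\<And>M. M \<in> magnetic_numbers J \<Longrightarrow> total_z s N *\<^sub>v ket M = complex_of_real M \<cdot>\<^sub>v ket M"
    "\<And>M. M \<in> magnetic_numbers J \<Longrightarrow> total_plus s N *\<^sub>v ket M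
       = (if M = J then 0\<^sub>v D else complex_of_real (ladder_plus J M) \<cdot>\<^sub>v ket (M + 1))"
    "\<And>M. M \<in> magnetic_numbers J \<Longrightarrow> total_minus s N *\<^sub>v ket M
       = (if M = - J then 0\<^sub>v D else complex_of_real (ladder_minus J M) \<cdot>\<^sub>v ket (M - 1))"
    using mult unfolding spin_multiplet_def Let_def D_def n_def by blast+
  obtain L :: nat where L: "2 * J = real L" using mult'(1) by (auto elim: Nats_cases)
  have mag: "- J + real i \<in> magnetic_numbers J" if "i \<le> L" for i
    using that L unfolding magnetic_numbers_def by auto
  have sub: "?L \<subseteq> magnetic_numbers J" by (rule code_labels_subset_magnetic_numbers[OF M])
  have kc: "ket i \<in> carrier_vec D" if "i \<in> ?L" for i using sub that mult'(2) by blast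
  have orth: "ket i \<bullet>c ket j = (if i = j then 1 else 0)" if "i \<in> ?L" "j \<in> ?L" for i j
    using sub that mult'(3) by blast
  have inj: "inj_on ket ?L" using orth by (intro inj_onI) (metis one_neq_zero)
  have fin: "finite ?L" by (rule finite_code_labels[OF \<Delta> Mmax])
  \<comment> \<open>\<open>total_z\<close> is diagonal in the product basis, so a basis vector with
    nonzero amplitude in \<open>|J, M>\<close> has total charge \<open>M\<close>.\<close>
  have z_charge: "M = (\<Sum>j<N. real (site_index n j y) - s)"
    if "M \<in> magnetic_numbers J" "y < D" "ket M $ y \<noteq> 0" for M y
  proof -
    have "complex_of_real M * ket M $ y
        = complex_of_real (\<Sum>j<N. real (site_index n j y) - s) * ket M $ y"
      using total_z_mult_vec[of "ket M" s N y] mult'(2)[OF that(1)] mult'(4)[OF that(1)] that(2)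
      by (simp add: n_def D_def)
    then show ?thesis using mult_right_cancel[OF that(3)] of_real_eq_iff by blast
  qed
  \<comment> \<open>Two basis vectors that share the configuration off \<open>S\<close> differ in
    charge by at most \<open>2 * s * d\<close>, which is less than the spacing of the labels; one of
    the amplitudes is therefore zero.\<close>
  have cross: "(\<Sum>r<?nR. cnj (ket i $ e p r) * ket j $ e q r) = 0"
    if ij: "i \<in> ?L" "j \<in> ?L" "i \<noteq> j" and pq: "p < ?nS" "q < ?nS" for i j p q
  proof (intro sum.neutral ballI)
    fix r assume "r \<in> {..<?nR}"
    then have r: "r < ?nR" by simp
    have lt: "e p r < D" "e q r < D" using sp.e_lt pq r by (auto simp: D_def)
    have split: "(\<Sum>l<N. real (site_index n l (e p r)) - s)
        = (\<Sum>l\<in>S. real (hS p l) - s) + (\<Sum>l\<in>?Sc. real (hR r l) - s)" if "p < ?nS" for p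
      using sp.e_S[OF that r] sp.e_R[OF that r]
      by (simp add: sum.subset_diff[OF S(1)] add.commute)
    show "cnj (ket i $ e p r) * ket j $ e q r = 0"
    proof (rule ccontr)
      assume "cnj (ket i $ e p r) * ket j $ e q r \<noteq> 0"
      then have nz: "ket i $ e p r \<noteq> 0" "ket j $ e q r \<noteq> 0" by auto
      have "i = (\<Sum>l<N. real (site_index n l (e p r)) - s)" "j = (\<Sum>l<N. real (site_index n l (e q r)) - s)"
        using z_charge[of i "e p r"] z_charge[of j "e q r"] nz ij sub lt by auto
      then have "i - j = (\<Sum>l\<in>S. real (hS p l) - s) - (\<Sum>l\<in>S. real (hS q l) - s)"
        by (simp only: split[OF pq(1)] split[OF pq(2)])
      also have "\<dots> = (\<Sum>l\<in>S. real (hS p l) - real (hS q l))" by (simp flip: sum_subtractf)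
      finally have "\<bar>i - j\<bar> \<le> (\<Sum>l\<in>S. \<bar>real (hS p l) - real (hS q l)\<bar>)" by (simp add: sum_abs)
      also have "\<dots> \<le> (\<Sum>l\<in>S. 2 * s)"
      proof (rule sum_mono)
        fix l assume "l \<in> S"
        then have "hS p l < n" "hS q l < n" using sp.hS(1)[OF pq(1)] sp.hS(1)[OF pq(2)] by auto
        then have "real (hS p l) \<le> 2 * s" "real (hS q l) \<le> 2 * s" using rn by linarith+
        then show "\<bar>real (hS p l) - real (hS q l)\<bar> \<le> 2 * s" by linarith
      qed
      also have "\<dots> = 2 * s * real d" using S by simp
      finally show False using code_labels_distance[OF ij] \<Delta>d by linarith
    qed
  qed
  have V: "V \<in> carrier_mat D m" "adj V * V = 1\<^sub>m m"
    "(\<lambda>x. V *\<^sub>v x) ` carrier_vec m = vec_span D (ket ` ?L)"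
    using iso by (auto simp: isometry_onto_def D_def n_def code_space_def code_basis_def)
  interpret vs: vec_space "TYPE(complex)" D .
  interpret fc: factor_code "?nS" "?nR" D m e ?L ket V
  proof
    show "bij_betw (\<lambda>(p, r). e p r) ({..<?nS} \<times> {..<?nR}) {..<D}"
      unfolding D_def by (rule sp.bij_e)
    show "ket i \<in> (\<lambda>x. V *\<^sub>v x) ` carrier_vec m" if "i \<in> ?L" for i
      unfolding V(3) using vs.in_own_span[of "ket ` ?L"] kc that by blast
    show "\<exists>a. \<forall>y<D. (V *\<^sub>v x) $ y = (\<Sum>i\<in>?L. a i * ket i $ y)" if "x \<in> carrier_vec m" for x
      using vs.span_image_coefficients[OF fin kc inj, of "V *\<^sub>v x"] V(3) that by blast
  qed (use fin kc orth cross V in auto)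
  define x where "x i p r = ket (- J + real i) $ e p r" for i p r
  let ?\<kappa> = "real d * (2 * s + 1)"
  interpret bm: bipartite_multiplet "?nS" "?nR" L
    "site_kernel S hS (spin_plus s)" "site_kernel S hS (spin_minus s)"
    "site_kernel (?Sc) hR (spin_plus s)" "site_kernel (?Sc) hR (spin_minus s)"
    ?\<kappa> x
  proof
    show "site_kernel S hS (spin_minus s) q p = cnj (site_kernel S hS (spin_plus s) p q)"
      if "p < ?nS" "q < ?nS" for p q
      by (rule site_kernel_spin_adjoint[OF _ that]) (use sp.hS(1) in \<open>simp add: n_def\<close>)
    show "site_kernel (?Sc) hR (spin_minus s) q p = cnj (site_kernel (?Sc) hR (spin_plus s) p q)"
      if "p < ?nR" "q < ?nR" for p q
      by (rule site_kernel_spin_adjoint[OF _ that]) (use sp.hR(1) in \<open>simp add: n_def\<close>)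
    show "(\<Sum>q<?nS. cmod (site_kernel S hS (spin_plus s) p q)) \<le> ?\<kappa>"
      "(\<Sum>q<?nS. cmod (site_kernel S hS (spin_plus s) q p)) \<le> ?\<kappa>" if "p < ?nS" for p
      using site_kernel_spin_plus_sums[OF s sp.hS(2)[unfolded n_def] sp.hS(1)[unfolded n_def] that[unfolded n_def]] S(2)
      by (simp_all add: n_def)
    show "?\<kappa> \<ge> 0" using s0 by simp
    fix i assume i: "i \<le> L"
    note mi = mag[OF i]
    have v: "ket (- J + real i) \<in> carrier_vec D" by (rule mult'(2)[OF mi])
    have "complex_of_real (\<Sum>y<D. (cmod (ket (- J + real i) $ y))\<^sup>2) = 1"
      using cscalar_prod_self[OF v] mult'(3)[OF mi mi] by simp
    then have "(\<Sum>y<D. (cmod (ket (- J + real i) $ y))\<^sup>2) = 1" by (metis of_real_eq_1_iff)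
    then show "(\<Sum>p<?nS. \<Sum>r<?nR. (cmod (x i p r))\<^sup>2) = 1"
      by (simp add: D_def sp.sum_sites x_def)
    fix p r assume pr: "p < ?nS" "r < ?nR"
    have lt: "e p r < D" using sp.e_lt[OF pr] by (simp add: D_def)
    have "(total_plus s N *\<^sub>v ket (- J + real i)) $ e p r
        = complex_of_real (sqrt ((real L - real i) * (real i + 1))) * x (i + 1) p r"
    proof (cases "i = L")
      case True
      then have "- J + real i = J" using L by simp
      then show ?thesis using mult'(5)[OF mi] lt True by simp
    next
      case False
      then have "i + 1 \<le> L" using i by simp
      then have v1: "ket (- J + real (i + 1)) \<in> carrier_vec D" by (intro mult'(2) mag)
      have ne: "- J + real i \<noteq> J" using False L by auto
      have lad: "ladder_plus J (- J + real i) = sqrt ((real L - real i) * (real i + 1))"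
        unfolding ladder_plus_def L[symmetric] by (simp add: algebra_simps)
      have shift: "- J + real i + 1 = - J + real (i + 1)" by simp
      show ?thesis
        unfolding mult'(5)[OF mi] if_not_P[OF ne] lad shift x_def
        using lt carrier_vecD[OF v1] by (intro index_smult_vec(1)) simp
    qed
    then show "(\<Sum>q<?nS. site_kernel S hS (spin_plus s) p q * x i q r)
        + (\<Sum>t<?nR. site_kernel (?Sc) hR (spin_plus s) r t * x i p t)
        = complex_of_real (sqrt ((real L - real i) * (real i + 1))) * x (i + 1) p r"
      using sp.total_op_mult_vec[OF v[unfolded D_def] pr, of "spin_plus s"]
      by (simp only: total_plus_def n_def[symmetric] x_def)
    have "(total_minus s N *\<^sub>v ket (- J + real i)) $ e p r
        = complex_of_real (sqrt (real i * (real L - real i + 1))) * x (i - 1) p r"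
    proof (cases "i = 0")
      case True
      then show ?thesis using mult'(6)[OF mi] lt by simp
    next
      case False
      then have v1: "ket (- J + real (i - 1)) \<in> carrier_vec D" using i by (intro mult'(2) mag) simp
      have lad: "ladder_minus J (- J + real i) = sqrt (real i * (real L - real i + 1))"
        unfolding ladder_minus_def L[symmetric] by (simp add: algebra_simps)
      have shift: "- J + real i - 1 = - J + real (i - 1)" using False by (simp add: of_nat_diff)
      have ne: "- J + real i \<noteq> - J" using False by simp
      show ?thesis
        unfolding mult'(6)[OF mi] if_not_P[OF ne] lad shift x_def
        using lt carrier_vecD[OF v1] by (intro index_smult_vec(1)) simp
    qed
    then show "(\<Sum>q<?nS. site_kernel S hS (spin_minus s) p q * x i q r)
        + (\<Sum>t<?nR. site_kernel (?Sc) hR (spin_minus s) r t * x i p t)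
        = complex_of_real (sqrt (real i * (real L - real i + 1))) * x (i - 1) p r"
      using sp.total_op_mult_vec[OF v[unfolded D_def] pr, of "spin_minus s"]
      by (simp only: total_minus_def n_def[symmetric] x_def)
  qed
  define \<delta> where "\<delta> = 8 * ?\<kappa>\<^sup>2 / (2 * J + 1) * (Mmax - Mmin)"
  have Mle: "Mmin \<le> Mmax" using Mmax by (auto simp: code_labels_def)
  have \<delta>0: "\<delta> \<ge> 0" using Mle L by (simp add: \<delta>_def)
  have i0: "Mmin \<in> ?L" using Mle by (auto simp: code_labels_def intro: exI[of _ 0])
  have near: "Re (qform (?nS) (fc.Gm M) f)
      \<le> Re (qform (?nS) (fc.Gm Mmin) f) + \<delta> * (\<Sum>p<?nS. (cmod (f p))\<^sup>2)"
    if inL: "M \<in> ?L" for M f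
  proof -
    obtain i where i: "i \<le> L" "M = - J + real i"
      using magnetic_number_index[OF L] sub inL by blast
    obtain j where j: "j \<le> L" "Mmin = - J + real j"
      using magnetic_number_index[OF L M(1)] by blast
    have G: "Re (qform (?nS) (fc.Gm (- J + real i)) f) = bm.expect f i" for i
      by (simp add: fc.qform_Gm bm.expect_def x_def)
    have W: "\<bar>real i - real j\<bar> \<le> Mmax - Mmin"
      using inL i j by (auto simp: code_labels_def)
    have "bm.expect f i - bm.expect f j
        \<le> 8 * ?\<kappa>\<^sup>2 * (\<Sum>p<?nS. (cmod (f p))\<^sup>2) / (real L + 1) * \<bar>real i - real j\<bar>"
      using bm.expect_variation[OF i(1) j(1), of f] by linarith
    also have "\<dots> \<le> 8 * ?\<kappa>\<^sup>2 * (\<Sum>p<?nS. (cmod (f p))\<^sup>2) / (real L + 1) * (Mmax - Mmin)"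
      by (intro mult_left_mono W) (simp add: sum_nonneg)
    also have "\<dots> = \<delta> * (\<Sum>p<?nS. (cmod (f p))\<^sup>2)"
      by (simp add: \<delta>_def L)
    finally show ?thesis unfolding i(2) j(2) G by simp
  qed
  obtain K where K: "\<And>j. j \<in> {1..n ^ (2 * d)} \<Longrightarrow> acts_on_sites n N S (K j)"
    and Noise: "Noise = kraus_map D (n ^ (2 * d)) K"
    and ch: "quantum_channel D D Noise"
    using noise unfolding local_noise_def Let_def D_def n_def by blast
  define A where "A j = (SOME A. K j = embed_op n N S A)" for j
  have KA: "K j = embed_op n N S (A j)" if "j \<in> {1..n ^ (2 * d)}" for j
    unfolding A_def using K[OF that] unfolding acts_on_sites_def by (rule someI_ex)
  have N_eq: "Noise = kraus_sum D {1..n ^ (2 * d)} K"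
    by (simp add: Noise kraus_map_def kraus_sum_def fun_eq_iff)
  have "code_inaccuracy m D V (kraus_sum D {1..n ^ (2 * d)} K) \<le> sqrt (2 * (\<delta> * real (?nS)))"
  proof (rule fc.inaccuracy_le_sqrt[OF i0 \<delta>0 near])
    show "K j \<in> carrier_mat D D" if "j \<in> {1..n ^ (2 * d)}" for j
      using KA[OF that] by (simp add: embed_op_def D_def)
    show "K j $$ (e p r, e q t) = (if r = t then A j (hS p) (hS q) else 0)"
      if "j \<in> {1..n ^ (2 * d)}" "p < ?nS" "q < ?nS" "r < ?nR" "t < ?nR" for j p q r t
      unfolding KA[OF that(1)] using that by (intro sp.embed_op_index)
  qed (use ch N_eq in auto)
  then show ?thesis
    by (simp add: N_eq D_def n_def[symmetric] \<delta>_def rn)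
qed


section \<open>Asymptotics\<close>

theorem theorem1:
  fixes s a b :: real
    and J Mmin Mmax :: "nat \<Rightarrow> real"
    and \<Delta> :: "nat \<Rightarrow> nat"
    and ket :: "nat \<Rightarrow> real \<Rightarrow> complex vec"
  assumes s: "2 * s \<in> \<nat>"
    and ab: "b < a" "a \<le> 1"
    and multiplet: "\<forall>\<^sub>F N in sequentially. spin_multiplet s N (J N) (ket N)"
    and M_range: "\<forall>\<^sub>F N in sequentially.
      Mmin N \<in> magnetic_numbers (J N) \<and> Mmax N \<in> magnetic_numbers (J N)"
    and spacing: "\<forall>\<^sub>F N in sequentially.
      \<Delta> N \<ge> 1 \<and> Mmax N \<in> code_labels (Mmin N) (Mmax N) (\<Delta> N)"
    and J_scaling: "J \<in> \<Theta>(\<lambda>N. real N powr a)"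
    and width_scaling: "(\<lambda>N. Mmax N - Mmin N) \<in> \<Theta>(\<lambda>N. real N powr b)"
  shows
    "(\<forall>\<^sub>F N in sequentially.
        real (subspace_dim (qudit_dim s ^ N) (code_space s N (ket N) (Mmin N) (Mmax N) (\<Delta> N)))
          = 2 powr logical_qubits (Mmin N) (Mmax N) (\<Delta> N)) \<and>
     (0 < b \<longrightarrow>
        (\<lambda>N. logical_qubits (Mmin N) (Mmax N) (\<Delta> N)) \<in> O(\<lambda>N. b * log 2 (real N))) \<and>
     (b = 0 \<longrightarrow> (\<lambda>N. logical_qubits (Mmin N) (Mmax N) (\<Delta> N)) \<in> O(\<lambda>N. 1)) \<and>
     (\<exists>C. \<forall>\<^sub>F N in sequentially. \<forall>d S Noise m V.
        real (\<Delta> N) \<ge> 2 * s * real d + 1 \<longrightarrow>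
        local_noise s N d S Noise \<longrightarrow>
        isometry_onto m (qudit_dim s ^ N) V
          (code_space s N (ket N) (Mmin N) (Mmax N) (\<Delta> N)) \<longrightarrow>
        code_inaccuracy m (qudit_dim s ^ N) V Noise
          \<le> C * (sqrt (real d) * (2 * s + 1) ^ d * real N powr (- (a - b) / 2)))"
proof -
  let ?lq = "\<lambda>N. logical_qubits (Mmin N) (Mmax N) (\<Delta> N)"
  have s0: "s \<ge> 0" using s by (auto elim: Nats_cases)
  obtain cJ where cJ: "cJ > 0" "\<forall>\<^sub>F N in sequentially. norm (J N) \<ge> cJ * norm (real N powr a)"
    using J_scaling landau_omega.bigE[of J sequentially "\<lambda>N. real N powr a"] by auto
  obtain cW where cW: "cW > 0" "\<forall>\<^sub>F N in sequentially. norm (Mmax N - Mmin N) \<le> cW * norm (real N powr b)"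
    using width_scaling landau_o.bigE[of "\<lambda>N. Mmax N - Mmin N" sequentially "\<lambda>N. real N powr b"] by auto
  \<comment> \<open>None of these facts mentions \<open>d\<close> or the noise, so one threshold for
    \<open>N\<close> serves all of them and the final constant is uniform. The scaling controls only
    \<open>|J N|\<close>; the sign comes from \<open>2 * J N\<close> being natural.\<close>
  have reg: "\<forall>\<^sub>F N in sequentially. spin_multiplet s N (J N) (ket N) \<and>
      Mmin N \<in> magnetic_numbers (J N) \<and> Mmax N \<in> magnetic_numbers (J N) \<and>
      \<Delta> N \<ge> 1 \<and> Mmax N \<in> code_labels (Mmin N) (Mmax N) (\<Delta> N) \<and>
      Mmin N \<le> Mmax N \<and> J N \<ge> cJ * real N powr a \<and> J N > 0 \<and> J N \<le> s * real N \<and>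
      Mmax N - Mmin N \<le> cW * real N powr b \<and> N \<ge> 2"
    using multiplet M_range spacing cJ(2) cW(2) eventually_ge_at_top[of 2]
  proof eventually_elim
    case (elim N)
    have "2 * J N \<in> \<nat>" "J N \<le> s * real N" using elim(1) by (auto simp: spin_multiplet_def Let_def)
    moreover from this have "J N \<ge> 0" by (auto elim: Nats_cases)
    moreover have "cJ * real N powr a > 0" using cJ(1) elim by simp
    moreover have "Mmin N \<le> Mmax N" using elim by (auto simp: code_labels_def)
    ultimately show ?case using elim by auto
  qed
  \<comment> \<open>For \<open>s = 0\<close> no multiplet has positive \<open>J\<close>. The
    conclusion \<open>2 * s + 1 \<ge> 2\<close> is what \<open>dn\<close> relies on.\<close>
  have spos: "s > 0"
  proof -
    obtain N where "J N > 0" "J N \<le> s * real N"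
      using eventually_happens[OF reg] by auto
    then have "s * real N > 0" by linarith
    then show ?thesis using s0 by (simp add: zero_less_mult_iff)
  qed
  then have s1: "2 \<le> 2 * s + 1" using s by (auto elim: Nats_cases)
  have lq: "\<forall>\<^sub>F N in sequentially. 0 \<le> ?lq N \<and>
      ?lq N \<le> log 2 (cW * real N powr b + 1)"
    using reg
  proof eventually_elim
    case (elim N)
    have "(Mmax N - Mmin N) / real (\<Delta> N) \<le> (Mmax N - Mmin N) / 1"
      using elim by (intro divide_left_mono) auto
    also have "\<dots> \<le> cW * real N powr b" using elim by simp
    finally have "(Mmax N - Mmin N) / real (\<Delta> N) \<le> cW * real N powr b" .
    moreover have "(Mmax N - Mmin N) / real (\<Delta> N) \<ge> 0" using elim by simp
    ultimately show ?case by (simp add: logical_qubits_def)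
  qed
  have dim: "\<forall>\<^sub>F N in sequentially.
      real (subspace_dim (qudit_dim s ^ N) (code_space s N (ket N) (Mmin N) (Mmax N) (\<Delta> N)))
        = 2 powr ?lq N"
    using reg
  proof eventually_elim
    case (elim N)
    let ?L = "code_labels (Mmin N) (Mmax N) (\<Delta> N)"
    have sub: "?L \<subseteq> magnetic_numbers (J N)"
      using elim by (intro code_labels_subset_magnetic_numbers) auto
    have "subspace_dim (qudit_dim s ^ N) (vec_span (qudit_dim s ^ N) (ket N ` ?L)) = card ?L"
    proof (rule subspace_dim_orthonormal)
      show "finite ?L" using elim by (intro finite_code_labels) auto
      show "ket N i \<in> carrier_vec (qudit_dim s ^ N)" if "i \<in> ?L" for i
        using elim sub that by (auto simp: spin_multiplet_def Let_def)
      show "ket N i \<bullet>c ket N j = (if i = j then 1 else 0)" if "i \<in> ?L" "j \<in> ?L" for i j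
      proof -
        have "i \<in> magnetic_numbers (J N)" "j \<in> magnetic_numbers (J N)" using that sub by auto
        then show ?thesis using elim unfolding spin_multiplet_def Let_def by blast
      qed
    qed
    moreover have "real (card ?L) = (Mmax N - Mmin N) / real (\<Delta> N) + 1"
      using elim by (intro card_code_labels) auto
    moreover have "(Mmax N - Mmin N) / real (\<Delta> N) + 1 > 0"
      using elim by (intro add_nonneg_pos) auto
    ultimately show ?case by (simp add: code_space_def code_basis_def logical_qubits_def)
  qed
  have log_b: "?lq \<in> O(\<lambda>N. b * log 2 (real N))" if b: "0 < b"
  proof (rule landau_o.bigI)
    show "log 2 (cW + 1) / b + 1 > 0" using cW b by (simp add: add_nonneg_pos)
    show "\<forall>\<^sub>F N in sequentially. norm (?lq N)
        \<le> (log 2 (cW + 1) / b + 1) * norm (b * log 2 (real N))"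
      using lq reg
    proof eventually_elim
      case (elim N)
      have N: "real N \<ge> 2" using elim by simp
      have l1: "log 2 (real N) \<ge> 1" using N by (simp add: le_log_iff)
      \<comment> \<open>This absorbs the summand 1 into \<open>(cW + 1) * real N powr b\<close>; the
        constant left by the logarithm is absorbed in turn since
        \<open>log 2 (real N) \<ge> 1\<close>.\<close>
      have "real N powr b \<ge> 1" using N b by (intro ge_one_powr_ge_zero) auto
      moreover from this have "cW * real N powr b > 0" using cW(1) N by (intro mult_pos_pos) auto
      ultimately have "log 2 (cW * real N powr b + 1) \<le> log 2 ((cW + 1) * real N powr b)"
        using cW(1) by (subst log_le_cancel_iff) (auto simp: algebra_simps)
      also have "\<dots> = log 2 (cW + 1) + b * log 2 (real N)"
        using cW N by (simp add: log_mult log_powr)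
      also have "\<dots> \<le> log 2 (cW + 1) * log 2 (real N) + b * log 2 (real N)"
        using l1 cW mult_left_mono[of 1 "log 2 (real N)" "log 2 (cW + 1)"] by simp
      also have "\<dots> = (log 2 (cW + 1) / b + 1) * norm (b * log 2 (real N))"
        using b l1 by (simp add: algebra_simps)
      finally show ?case using elim by simp
    qed
  qed
  \<comment> \<open>At \<open>b = 0\<close> the comparison function
    \<open>b * log 2 (real N)\<close> is zero, whereas the bounded width still bounds the number of
    qubits by a constant.\<close>
  have log_0: "?lq \<in> O(\<lambda>N. 1)" if b: "b = 0"
  proof (rule bigoI)
    show "\<forall>\<^sub>F N in sequentially. norm (?lq N)
        \<le> log 2 (cW + 1) * norm (1 :: real)"
      using lq reg by eventually_elim (simp add: b)
  qed
  \<comment> \<open>The 8 is the 16 of the bound at fixed \<open>N\<close>, halved by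
    \<open>2 * J N + 1 \<ge> 2 * J N\<close>; the square of \<open>2 * s + 1\<close> comes from
    \<open>\<kappa>\<close>.\<close>
  define C where "C = sqrt (8 * (2 * s + 1)\<^sup>2 * cW / cJ)"
  have "\<forall>\<^sub>F N in sequentially. \<forall>d S Noise m V.
        real (\<Delta> N) \<ge> 2 * s * real d + 1 \<longrightarrow>
        local_noise s N d S Noise \<longrightarrow>
        isometry_onto m (qudit_dim s ^ N) V
          (code_space s N (ket N) (Mmin N) (Mmax N) (\<Delta> N)) \<longrightarrow>
        code_inaccuracy m (qudit_dim s ^ N) V Noise
          \<le> C * (sqrt (real d) * (2 * s + 1) ^ d * real N powr (- (a - b) / 2))"
    using reg
  proof eventually_elim
    case (elim N)
    show ?case
    proof (intro allI impI)
      fix d S Noise m V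
      assume h: "real (\<Delta> N) \<ge> 2 * s * real d + 1" "local_noise s N d S Noise"
        "isometry_onto m (qudit_dim s ^ N) V (code_space s N (ket N) (Mmin N) (Mmax N) (\<Delta> N))"
      let ?n = "2 * s + 1" and ?W = "Mmax N - Mmin N"
      have Na: "real N powr a > 0" using elim by simp
      have "?W / (2 * J N + 1) \<le> (cW * real N powr b) / (2 * (cJ * real N powr a))"
        using elim cJ cW Na by (intro frac_le) auto
      also have "\<dots> = cW / (2 * cJ) * real N powr (b - a)"
        by (simp add: powr_diff)
      finally have W: "?W / (2 * J N + 1) \<le> cW / (2 * cJ) * real N powr (b - a)" .
      \<comment> \<open>One of the two factors \<open>d\<close> from \<open>\<kappa>\<^sup>2\<close>
        is traded for \<open>?n ^ d\<close>, which leaves \<open>d * (?n ^ d)\<^sup>2\<close>, a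
        square of the required form.\<close>
      have "real d \<le> 2 ^ d" using less_exp[of d] by (metis less_imp_le of_nat_le_iff of_nat_numeral of_nat_power)
      also have "\<dots> \<le> ?n ^ d" using s1 by (intro power_mono) auto
      finally have dn: "real d \<le> ?n ^ d" .
      have "2 * (8 * (real d * ?n)\<^sup>2 / (2 * J N + 1) * ?W * ?n ^ d)
          = 16 * ?n\<^sup>2 * (real d * (real d * ?n ^ d)) * (?W / (2 * J N + 1))"
        by (simp add: power2_eq_square)
      also have "\<dots> \<le> 16 * ?n\<^sup>2 * (real d * (?n ^ d * ?n ^ d)) * (cW / (2 * cJ) * real N powr (b - a))"
        using elim s1 dn by (intro mult_mono W mult_left_mono mult_right_mono mult_nonneg_nonneg) auto
      also have "\<dots> = (8 * ?n\<^sup>2 * cW / cJ) * (real d * (?n ^ d)\<^sup>2 * (real N powr (- (a - b) / 2))\<^sup>2)"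
      proof -
        have "real N powr (b - a) = (real N powr (- (a - b) / 2))\<^sup>2"
          by (simp add: power2_eq_square flip: powr_add)
        then show ?thesis by (simp add: power2_eq_square)
      qed
      finally have le: "2 * (8 * (real d * ?n)\<^sup>2 / (2 * J N + 1) * ?W * ?n ^ d)
          \<le> (8 * ?n\<^sup>2 * cW / cJ) * (real d * (?n ^ d)\<^sup>2 * (real N powr (- (a - b) / 2))\<^sup>2)" .
      have "code_inaccuracy m (qudit_dim s ^ N) V Noise
          \<le> sqrt (2 * (8 * (real d * ?n)\<^sup>2 / (2 * J N + 1) * ?W * ?n ^ d))"
        using elim h by (intro multiplet_inaccuracy_le[OF s]) auto
      also have "\<dots> \<le> sqrt ((8 * ?n\<^sup>2 * cW / cJ) * (real d * (?n ^ d)\<^sup>2 * (real N powr (- (a - b) / 2))\<^sup>2))"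
        using le by (rule real_sqrt_le_mono)
      also have "\<dots> = C * (sqrt (real d) * ?n ^ d * real N powr (- (a - b) / 2))"
        using s1 by (simp add: C_def real_sqrt_mult real_sqrt_divide)
      finally show "code_inaccuracy m (qudit_dim s ^ N) V Noise
          \<le> C * (sqrt (real d) * ?n ^ d * real N powr (- (a - b) / 2))" .
    qed
  qed
  then show ?thesis using dim log_b log_0 by blast
qed

end
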